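(* Let $W$ be a finite Coxeter group and $w\in W$ a quasi-Coxeter element. For $x\in[1,w]$ let $P_x$ be the parabolic subgroup associated with $x$, and let $\mathcal{P}(w)=\{P_x: x\in[1,w]\}$. Then the map $$p:[1,w]\to\mathcal{P}(w),\qquad x\mapsto P_x$$ is an isomorphism between the posets $([1,w],\preceq)$ and $(\mathcal{P}(w),\le)$, where $\le$ is the subgroup relation.
   Context: Let $(W,R)$ be a finite Coxeter system and $T=\bigcup_{g\in W}g^{-1}Rg$ its set of reflections. The reflection length $\ell_T(g)$ is the least $k$ such that $g$ is a product of $k$ elements of $T$; a factorization $g=t_1\cdots t_k$ with $t_i\in T$, $k=\ell_T(g)$, is a reduced $T$-decomposition. An element $w$ is quasi-Coxeter if it has a reduced $T$-decomposition $w=t_1\cdots t_m$ with $\langle t_1,\dots,t_m\rangle=W$. The absolute order is $x\preceq y$ iff $\ell_T(y)=\ell_T(x)+\ell_T(x^{-1}y)$, and $[1,w]=\{x\in W:x\preceq w\}$. A parabolic subgroup is a conjugate of a subgroup generated by a subset of $R$. It is known that every $x\in[1,w]$ (with $w$ quasi-Coxeter) has a reduced $T$-decomposition $x=t_1\cdots t_k$ such that $P_x:=\langle t_1,\dots,t_k\rangle$ is a parabolic subgroup of $W$; $P_x$ does not depend on the chosen reduced $T$-decomposition. *)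

theory Defs
  imports "HOL-Algebra.Algebra"
begin

section \<open>Group presentations\<close>

text \<open>
  A word is a list of signed letters: \<open>(s, True)\<close> stands for \<open>s\<close> and \<open>(s, False)\<close> for its formal
  inverse. Two words are identified in the group presented by generators \<open>S\<close> and relators \<open>Q\<close> iff
  they are connected by insertions and deletions of factors \<open>s s\<inverse>\<close>, \<open>s\<inverse> s\<close> and of relators.
\<close>

inductive word_step :: "'a set \<Rightarrow> ('a \<times> bool) list set \<Rightarrow> ('a \<times> bool) list \<Rightarrow> ('a \<times> bool) list \<Rightarrow> bool"
  for S Q where
  cancel: "s \<in> S \<Longrightarrow> word_step S Q (u @ [(s, b), (s, \<not> b)] @ v) (u @ v)"
| relator: "q \<in> Q \<Longrightarrow> word_step S Q (u @ q @ v) (u @ v)"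

definition list_prod :: "('a, 'b) monoid_scheme \<Rightarrow> 'a list \<Rightarrow> 'a" where
  "list_prod G xs = foldr (\<otimes>\<^bsub>G\<^esub>) xs \<one>\<^bsub>G\<^esub>"

definition word_value :: "('a, 'b) monoid_scheme \<Rightarrow> ('a \<times> bool) list \<Rightarrow> 'a" where
  "word_value G u = list_prod G (map (\<lambda>(s, b). if b then s else inv\<^bsub>G\<^esub> s) u)"

definition has_presentation :: "('a, 'b) monoid_scheme \<Rightarrow> 'a set \<Rightarrow> ('a \<times> bool) list set \<Rightarrow> bool" where
  "has_presentation G S Q \<longleftrightarrow>
     S \<subseteq> carrier G \<and> generate G S = carrier G \<and> Q \<subseteq> lists (S \<times> UNIV) \<and>
     (\<forall>u \<in> lists (S \<times> UNIV). \<forall>v \<in> lists (S \<times> UNIV).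
        word_value G u = word_value G v \<longleftrightarrow> equivclp (word_step S Q) u v)"

section \<open>Coxeter systems\<close>

text \<open>The entry \<open>0\<close> of a Coxeter matrix encodes \<open>\<infinity>\<close>; the corresponding relator is the empty word.\<close>

definition coxeter_matrix :: "'a set \<Rightarrow> ('a \<Rightarrow> 'a \<Rightarrow> nat) \<Rightarrow> bool" where
  "coxeter_matrix R m \<longleftrightarrow>
     (\<forall>r\<in>R. \<forall>s\<in>R. m r s = m s r \<and> (m r s = 1 \<longleftrightarrow> r = s))"

definition coxeter_relators :: "'a set \<Rightarrow> ('a \<Rightarrow> 'a \<Rightarrow> nat) \<Rightarrow> ('a \<times> bool) list set" where
  "coxeter_relators R m =
     {concat (replicate (m r s) [(r, True), (s, True)]) | r s. r \<in> R \<and> s \<in> R}"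

definition coxeter_system :: "('a, 'b) monoid_scheme \<Rightarrow> 'a set \<Rightarrow> bool" where
  "coxeter_system W R \<longleftrightarrow>
     group W \<and> (\<exists>m. coxeter_matrix R m \<and> has_presentation W R (coxeter_relators R m))"

definition reflections :: "('a, 'b) monoid_scheme \<Rightarrow> 'a set \<Rightarrow> 'a set" where
  "reflections W R = (\<Union>g\<in>carrier W. (\<lambda>r. inv\<^bsub>W\<^esub> g \<otimes>\<^bsub>W\<^esub> r \<otimes>\<^bsub>W\<^esub> g) ` R)"

definition parabolic_subgroup :: "('a, 'b) monoid_scheme \<Rightarrow> 'a set \<Rightarrow> 'a set \<Rightarrow> bool" where
  "parabolic_subgroup W R P \<longleftrightarrow>
     (\<exists>I g. I \<subseteq> R \<and> g \<in> carrier W \<and> P = (\<lambda>h. inv\<^bsub>W\<^esub> g \<otimes>\<^bsub>W\<^esub> h \<otimes>\<^bsub>W\<^esub> g) ` generate W I)"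

section \<open>Reflection length and absolute order\<close>

definition refl_length :: "('a, 'b) monoid_scheme \<Rightarrow> 'a set \<Rightarrow> 'a \<Rightarrow> nat" where
  "refl_length W R g =
     (LEAST k. \<exists>ts. ts \<in> lists (reflections W R) \<and> length ts = k \<and> list_prod W ts = g)"

definition reduced_decomp :: "('a, 'b) monoid_scheme \<Rightarrow> 'a set \<Rightarrow> 'a \<Rightarrow> 'a list \<Rightarrow> bool" where
  "reduced_decomp W R g ts \<longleftrightarrow>
     ts \<in> lists (reflections W R) \<and> list_prod W ts = g \<and> length ts = refl_length W R g"

definition quasi_coxeter :: "('a, 'b) monoid_scheme \<Rightarrow> 'a set \<Rightarrow> 'a \<Rightarrow> bool" where
  "quasi_coxeter W R w \<longleftrightarrow>
     w \<in> carrier W \<and> (\<exists>ts. reduced_decomp W R w ts \<and> generate W (set ts) = carrier W)"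

definition abs_le :: "('a, 'b) monoid_scheme \<Rightarrow> 'a set \<Rightarrow> 'a \<Rightarrow> 'a \<Rightarrow> bool" where
  "abs_le W R x y \<longleftrightarrow>
     refl_length W R y = refl_length W R x + refl_length W R (inv\<^bsub>W\<^esub> x \<otimes>\<^bsub>W\<^esub> y)"

definition abs_interval :: "('a, 'b) monoid_scheme \<Rightarrow> 'a set \<Rightarrow> 'a \<Rightarrow> 'a set" where
  "abs_interval W R w = {x \<in> carrier W. abs_le W R x w}"

section \<open>The parabolic subgroup associated with an element\<close>

text \<open>
  For \<open>x\<close> below a quasi-Coxeter element of a finite Coxeter group, the description below is satisfied
  by exactly one subgroup; this is not assumed anywhere.
\<close>

definition assoc_parabolic :: "('a, 'b) monoid_scheme \<Rightarrow> 'a set \<Rightarrow> 'a \<Rightarrow> 'a set" where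
  "assoc_parabolic W R x =
     (THE P. parabolic_subgroup W R P \<and> (\<exists>ts. reduced_decomp W R x ts \<and> P = generate W (set ts)))"

definition assoc_parabolics :: "('a, 'b) monoid_scheme \<Rightarrow> 'a set \<Rightarrow> 'a \<Rightarrow> 'a set set" where
  "assoc_parabolics W R w = assoc_parabolic W R ` abs_interval W R w"

definition subgroup_le :: "('a, 'b) monoid_scheme \<Rightarrow> 'a set \<Rightarrow> 'a set \<Rightarrow> bool" where
  "subgroup_le G H K \<longleftrightarrow> subgroup H (G\<lparr>carrier := K\<rparr>)"

section \<open>Poset isomorphisms\<close>

definition poset_on :: "'a set \<Rightarrow> ('a \<Rightarrow> 'a \<Rightarrow> bool) \<Rightarrow> bool" where
  "poset_on A rel \<longleftrightarrow> reflp_on A rel \<and> antisymp_on A rel \<and> transp_on A rel"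

definition poset_iso ::
  "'a set \<Rightarrow> ('a \<Rightarrow> 'a \<Rightarrow> bool) \<Rightarrow> 'b set \<Rightarrow> ('b \<Rightarrow> 'b \<Rightarrow> bool) \<Rightarrow> ('a \<Rightarrow> 'b) \<Rightarrow> bool" where
  "poset_iso A leA B leB f \<longleftrightarrow>
     poset_on A leA \<and> poset_on B leB \<and> bij_betw f A B \<and>
     (\<forall>x\<in>A. \<forall>y\<in>A. leA x y \<longleftrightarrow> leB (f x) (f y))"

end

theory Submission
  imports Defs
begin

text \<open>
  The group acts on a real vector space by the geometric representation attached to the Coxeter
  matrix. Finiteness makes the invariant form positive definite (\<open>B_pos\<close>), and the fact that a
  generator lengthens an element exactly if the element sends its simple root to a positive root
  (\<open>length_positivity\<close>) makes the action faithful and identifies the parabolic subgroups with the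
  pointwise stabilisers of subspaces (\<open>fixator_parabolic\<close>, \<open>parabolic_eq_fixator\<close>). By
  Carter's lemma (\<open>carter\<close>) a factorisation into reflections is reduced iff its roots are linearly
  independent, and then these roots span the orthogonal complement of the fixed space. Hence a
  parabolic subgroup generated by a reduced factorisation of x has to be the fixator of the fixed
  space of x: there is at most one subgroup P(x), and comparing such subgroups means comparing fixed
  spaces.

  The core of the proof is that P(x) exists: each prefix of each reduced factorisation of a
  quasi-Coxeter element w generates the whole fixator of its fixed space (\<open>prefix_parabolic\<close>). One
  has to show that every root in the linear span of the prefix belongs to the reflection subgroup
  generated by the prefix. This is a lattice argument that avoids the classification. Scaled to equal
  length, the roots span a lattice over a ring of real algebraic integers that contains all entries
  of the Gram matrix. The map 1 - w carries the dual lattice onto the lattice spanned by the roots of a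
  generating factorisation, and into the lattice spanned by the roots of any other factorisation of w;
  so the roots of every factorisation of w form a basis of the root lattice
  (\<open>factorisation_ring_span\<close>). By linear independence the roots in the span of a prefix are then
  combinations of the prefix with coefficients in the ring, and a shortest-sum argument for a suitable
  integral form shows that a root of the lattice spanned by a root subsystem lies in this subsystem
  (\<open>root_in_lattice\<close>).

  The ring used is generated by the square root of 2 and the golden ratio, which covers all labels up
  to 5 of the Coxeter graph. An edge with a larger label is a whole component of the graph
  (\<open>large_label_isolated\<close>), and in such a dihedral component the claim is elementary
  (\<open>dihedral_factorisation\<close>).

  Finally, if x and y lie below w and the fixed space of y is contained in that of x, then x lies below
  y (\<open>fixed_subset_imp_le\<close>). This is an argument of Brady and Watt: where 1 - w takes values in the
  image of 1 - x, the elements w and x agree.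
\<close>

section \<open>The ring generated by the square root of two and the golden ratio\<close>

definition golden :: real where "golden = (1 + sqrt 5) / 2"

lemma golden_sq: "golden * golden = golden + 1"
  by (simp add: golden_def field_simps)

lemma golden_bounds: "1.618 < golden" "golden < 1.619"
proof -
  have "2.236 < sqrt 5" by (rule real_less_rsqrt) (simp add: power2_eq_square)
  then show "1.618 < golden" by (simp add: golden_def)
  have "sqrt 5 < 2.238" by (rule real_less_lsqrt) (simp_all add: power2_eq_square)
  then show "golden < 1.619" by (simp add: golden_def)
qed

text \<open>With e running through the two square roots of 2, and f through the two roots of the polynomial
  X^2 - X - 1, the same four integers give the four conjugates of an algebraic integer.\<close>
definition quad :: "real \<Rightarrow> real \<Rightarrow> int \<Rightarrow> int \<Rightarrow> int \<Rightarrow> int \<Rightarrow> real" where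
  "quad e f a b c d = of_int a + of_int b * e + of_int c * f + of_int d * (e * f)"

definition bas :: "int \<Rightarrow> int \<Rightarrow> int \<Rightarrow> int \<Rightarrow> real" where
  "bas = quad (sqrt 2) golden"

definition ring4 :: "real set" where "ring4 = {y. \<exists>a b c d. y = bas a b c d}"

lemma five_not_square:
  fixes y z :: int
  assumes "5 * y^2 = z^2" shows "y = 0"
  using assms
proof (induction "nat \<bar>y\<bar>" arbitrary: y z rule: less_induct)
  case less
  have p5: "Factorial_Ring.prime (5::int)" by simp
  show ?case
  proof (rule ccontr)
    assume ny: "y \<noteq> 0"
    have "5 dvd z^2" using less.prems by (metis dvd_triv_left)
    from prime_dvd_power[OF p5 this] obtain z' where z: "z = 5 * z'" unfolding dvd_def by blast
    have y2: "y^2 = 5 * z'^2" using less.prems by (simp add: z power_mult_distrib)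
    then have "5 dvd y^2" by simp
    from prime_dvd_power[OF p5 this] obtain y' where y: "y = 5 * y'" unfolding dvd_def by blast
    have "5 * y'^2 = z'^2" using y2 by (simp add: y power_mult_distrib)
    moreover have "nat \<bar>y'\<bar> < nat \<bar>y\<bar>" using ny y by (simp add: abs_mult)
    ultimately have "y' = 0" using less.hyps[of y' z'] by blast
    then show False using ny y by simp
  qed
qed

lemma golden_int_zero:
  assumes "of_int x + of_int y * golden = 0" shows "x = 0 \<and> y = (0::int)"
proof -
  have e: "of_int y * sqrt 5 = - of_int (2 * x + y)"
    using assms by (simp add: golden_def field_simps)
  have "(of_int y * sqrt 5)^2 = (of_int (2 * x + y) :: real)^2" unfolding e by (rule power2_minus)
  then have "(of_int (5 * y^2) :: real) = of_int ((2*x+y)^2)"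
    by (simp add: power_mult_distrib)
  then have q: "5 * y^2 = (2*x+y)^2" by (simp only: of_int_eq_iff)
  have "y = 0" using five_not_square[OF q] .
  then show ?thesis using assms by simp
qed

text \<open>Infinite descent: 2 stays prime in the ring of integers of the field generated by the golden
  ratio, hence is not a square there.\<close>
lemma two_not_golden_square:
  fixes a b c d :: int
  assumes "a^2 + c^2 = 2 * (b^2 + d^2)" "2*a * c + c^2 = 2 * (2*b*d + d^2)"
  shows "a = 0 \<and> b = 0 \<and> c = 0 \<and> d = 0"
  using assms
proof (induction "nat (\<bar>a\<bar> + \<bar>b\<bar> + \<bar>c\<bar> + \<bar>d\<bar>)" arbitrary: a b c d rule: less_induct)
  case less
  show ?case
  proof (cases "a = 0 \<and> c = 0")
    case True
    then have "b^2 + d^2 = 0" using less.prems(1) by (simp del: sum_power2_eq_zero_iff)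
    then show ?thesis using True by (simp add: sum_power2_eq_zero_iff)
  next
    case False
    have "even (2*a * c + c^2)" using less.prems(2) by simp
    then have ec: "even c" by simp
    have "even (a^2 + c^2)" using less.prems(1) by simp
    then have ea: "even a" using ec by simp
    obtain a' c' where ac: "a = 2 * a'" "c = 2 * c'" using ea ec by (auto elim!: evenE)
    have 1: "b^2 + d^2 = 2 * (a'^2 + c'^2)" "2*b*d + d^2 = 2 * (2*a'* c' + c'^2)"
      using less.prems by (simp_all add: ac power2_eq_square)
    have "nat (\<bar>b\<bar> + \<bar>a'\<bar> + \<bar>d\<bar> + \<bar>c'\<bar>) < nat (\<bar>a\<bar> + \<bar>b\<bar> + \<bar>c\<bar> + \<bar>d\<bar>)"
      using False ac by auto
    from less.hyps[OF this 1] show ?thesis by (simp add: ac)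
  qed
qed

text \<open>A vanishing combination would make 2 a square in the field of the golden ratio.\<close>
lemma bas_eq_0: assumes "bas a b c d = 0" shows "a = 0 \<and> b = 0 \<and> c = 0 \<and> d = 0"
proof -
  have e: "of_int a + of_int c * golden = - (sqrt 2 * (of_int b + of_int d * golden))"
    using assms by (simp add: bas_def quad_def algebra_simps)
  have g2: "golden^2 = golden + 1" using golden_sq by (simp add: power2_eq_square)
  have "(of_int a + of_int c * golden)^2 = 2 * (of_int b + of_int d * golden)^2"
    unfolding e by (simp add: power_mult_distrib)
  then have "of_int (a^2 + c^2 - 2 * (b^2 + d^2)) + of_int (2*a * c + c^2 - 2*(2*b*d + d^2)) * golden = 0"
    by (simp add: power2_sum power_mult_distrib g2 algebra_simps)
  from golden_int_zero[OF this] show ?thesis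
    by (intro two_not_golden_square) auto
qed

lemma bas_diff: "bas a b c d - bas a' b' c' d' = bas (a-a') (b-b') (c-c') (d-d')"
  by (simp add: bas_def quad_def algebra_simps)

lemma bas_inject: "bas a b c d = bas a' b' c' d' \<longleftrightarrow> a = a' \<and> b = b' \<and> c = c' \<and> d = d'"
  using bas_eq_0[of "a-a'" "b-b'" "c-c'" "d-d'"] bas_diff[of a b c d a' b' c' d'] by auto

text \<open>The coordinates of an element of the ring are unique, so the conjugates of the element and its
  constant coefficient depend only on its value as a real number. On other reals the descriptions are
  meaningless.\<close>
definition conj_of :: "real \<Rightarrow> real \<Rightarrow> real \<Rightarrow> real" where
  "conj_of e f y = (THE z. \<exists>a b c d. y = bas a b c d \<and> z = quad e f a b c d)"

definition tau :: "real \<Rightarrow> int" where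
  "tau y = (THE a. \<exists>b c d. y = bas a b c d)"

lemma conj_of_bas: "conj_of e f (bas a b c d) = quad e f a b c d"
  unfolding conj_of_def by (rule the_equality) (auto simp: bas_inject)

lemma tau_bas [simp]: "tau (bas a b c d) = a"
  unfolding tau_def by (rule the_equality) (auto simp: bas_inject)

lemma bas_ring4 [simp, intro]: "bas a b c d \<in> ring4" by (auto simp: ring4_def)

lemma ring4_cases: assumes "y \<in> ring4" obtains a b c d where "y = bas a b c d"
  using assms by (auto simp: ring4_def)

lemma quad_add: "quad e f a b c d + quad e f a' b' c' d' = quad e f (a+a') (b+b') (c + c') (d+d')"
  by (simp add: quad_def algebra_simps)

lemma quad_mult:
  assumes "e * e = 2" "f * f = f + 1"
  shows "quad e f a b c d * quad e f a' b' c' d' =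
    quad e f (a*a' + 2*b*b' + c * c' + 2*d*d') (a*b' + b*a' + c*d' + d * c')
      (a * c' + c*a' + 2*b*d' + 2*d*b' + c * c' + 2*d*d') (a*d' + d*a' + b * c' + c*b' + c*d' + d * c')"
proof -
  have r1: "e * (e * x) = 2 * x" "f * (f * x) = f * x + x" for x
    using assms by (simp_all add: mult.assoc[symmetric] algebra_simps)
  show ?thesis unfolding quad_def
    by (simp add: algebra_simps assms r1)
qed

lemma sq2: "sqrt 2 * sqrt 2 = 2" by simp

lemmas bas_mult = quad_mult[OF sq2 golden_sq, folded bas_def]
lemmas bas_add = quad_add[of "sqrt 2" golden, folded bas_def]

lemma ring4_add [intro]: "x \<in> ring4 \<Longrightarrow> y \<in> ring4 \<Longrightarrow> x + y \<in> ring4"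
  by (auto elim!: ring4_cases simp: bas_add)
lemma ring4_mult [intro]: "x \<in> ring4 \<Longrightarrow> y \<in> ring4 \<Longrightarrow> x * y \<in> ring4"
  by (auto elim!: ring4_cases simp: bas_mult)
lemma ring4_of_int [simp, intro]: "of_int n \<in> ring4"
proof -
  have "of_int n = bas n 0 0 0" by (simp add: bas_def quad_def)
  then show ?thesis by simp
qed
lemma ring4_0 [simp]: "0 \<in> ring4" and ring4_1 [simp]: "1 \<in> ring4" and ring4_2 [simp]: "2 \<in> ring4"
  using ring4_of_int[of 0] ring4_of_int[of 1] ring4_of_int[of 2] by simp_all
lemma ring4_minus [intro]: "x \<in> ring4 \<Longrightarrow> - x \<in> ring4"
  using ring4_mult[OF ring4_of_int[of "-1"], of x] by simp
lemma ring4_diff [intro]: "x \<in> ring4 \<Longrightarrow> y \<in> ring4 \<Longrightarrow> x - y \<in> ring4"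
  using ring4_add[of x "-y"] by auto
lemma ring4_sum: "(\<And>x. x \<in> A \<Longrightarrow> f x \<in> ring4) \<Longrightarrow> sum f A \<in> ring4"
  by (induction A rule: infinite_finite_induct) auto

lemma ring4_sqrt2 [simp]: "sqrt 2 \<in> ring4" and ring4_golden [simp]: "golden \<in> ring4"
proof -
  have "sqrt 2 = bas 0 1 0 0" "golden = bas 0 0 1 0" by (simp_all add: bas_def quad_def)
  then show "sqrt 2 \<in> ring4" "golden \<in> ring4" by (metis bas_ring4)+
qed

lemma conj_of_hom:
  assumes "x \<in> ring4" "y \<in> ring4" "e * e = 2" "f * f = f + 1"
  shows "conj_of e f (x + y) = conj_of e f x + conj_of e f y"
    "conj_of e f (x * y) = conj_of e f x * conj_of e f y"
  using assms by (auto elim!: ring4_cases simp: bas_add bas_mult conj_of_bas quad_add quad_mult)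

lemma conj_of_int: "conj_of e f (of_int n) = of_int n"
proof -
  have "of_int n = bas n 0 0 0" by (simp add: bas_def quad_def)
  then show ?thesis using conj_of_bas[of e f n 0 0 0] by (simp add: quad_def)
qed

lemma tau_add: assumes "x \<in> ring4" "y \<in> ring4" shows "tau (x + y) = tau x + tau y"
  using assms by (auto elim!: ring4_cases simp: bas_add)

abbreviation golden' :: real where "golden' \<equiv> 1 - golden"

lemma golden'_sq: "golden' * golden' = golden' + 1"
  using golden_sq by (simp add: algebra_simps)

text \<open>These are the numbers 2 cos(q pi), q rational, that lie in the ring.\<close>
definition small_values :: "real set" where
  "small_values = {0, 1, -1, 2, -2, sqrt 2, - sqrt 2, golden, - golden, golden - 1, 1 - golden}"

text \<open>The norm of an algebraic integer is an integer.\<close>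
lemma golden_norm_ge_1:
  assumes "(a, c) \<noteq> (0, 0::int)"
  shows "1 \<le> \<bar>of_int a + of_int c * golden\<bar> * \<bar>of_int a + of_int c * golden'\<bar>"
proof -
  have "(of_int a + of_int c * golden) * (of_int a + of_int c * golden')
      = of_int (a*a + a * c - c * c) + of_int (c * c) * (1 + golden - golden * golden)"
    by (simp add: algebra_simps)
  also have "\<dots> = of_int (a*a + a * c - c * c)" by (simp add: golden_sq)
  finally have e: "\<bar>of_int a + of_int c * golden\<bar> * \<bar>of_int a + of_int c * golden'\<bar>
      = of_int \<bar>a*a + a * c - c * c\<bar>" by (simp add: abs_mult[symmetric])
  have "a*a + a * c - c * c \<noteq> 0"
  proof
    assume "a*a + a * c - c * c = 0"
    then have "\<bar>of_int a + of_int c * golden\<bar> * \<bar>of_int a + of_int c * golden'\<bar> = 0" using e by simp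
    then have "of_int a + of_int c * golden = 0 \<or> of_int a + of_int c * golden' = 0" by (simp only: mult_eq_0_iff abs_eq_0)
    moreover have "of_int a + of_int c * golden' = of_int (a + c) + of_int (-c) * golden"
    proof -
      have "x + y * (1 - g) = (x + y) + (- y) * g" for x y g :: real by (simp add: algebra_simps)
      then show ?thesis unfolding of_int_add of_int_minus .
    qed
    ultimately have "of_int a + of_int c * golden = 0 \<or> of_int (a + c) + of_int (-c) * golden = 0"
      by metis
    then have "a = 0 \<and> c = 0 \<or> a + c = 0 \<and> - c = 0"
      using golden_int_zero[of a c] golden_int_zero[of "a + c" "-c"] by blast
    then show False using assms by auto
  qed
  then show ?thesis unfolding e by linarith
qed

lemma golden_int_small:
  fixes a c :: int
  assumes "\<bar>of_int a + of_int c * golden\<bar> \<le> M" "\<bar>of_int a + of_int c * golden'\<bar> \<le> M" "M \<le> 2"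
  shows "c \<in> {-1,0,1} \<and> \<bar>2 * a + c\<bar> \<le> 4"
proof -
  have c: "\<bar>of_int c * (2 * golden - 1)\<bar> \<le> 4" using assms by (simp add: algebra_simps)
  have "\<bar>of_int c\<bar> < (2::real)"
  proof (rule ccontr)
    assume "\<not> ?thesis"
    then have "2 * 2.236 \<le> \<bar>of_int c\<bar> * (2 * golden - 1)"
      using golden_bounds by (intro mult_mono) auto
    also have "\<dots> \<le> 4" using c golden_bounds by (simp add: abs_mult)
    finally show False by simp
  qed
  then have "\<bar>c\<bar> < 2" by linarith
  moreover have "\<bar>of_int (2 * a + c)\<bar> \<le> (4::real)" using assms by (simp add: algebra_simps)
  then have "\<bar>2 * a + c\<bar> \<le> 4" by linarith
  ultimately show ?thesis by auto
qed

text \<open>The elements all of whose conjugates lie in [-2, 2] have the form 2 cos(q pi) with q rational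
  (Kronecker); here they can be listed. Writing x + sqrt 2 z with x and z in the golden ring, the
  norms of x and z are integers, and the arithmetic-geometric mean inequality makes one of them zero.\<close>
lemma small_conjugates:
  assumes "y \<in> ring4"
    and small: "\<And>e f. e = sqrt 2 \<or> e = - sqrt 2 \<Longrightarrow> f = golden \<or> f = golden' \<Longrightarrow> \<bar>conj_of e f y\<bar> \<le> 2"
  shows "y \<in> small_values"
proof -
  obtain a b c d where y: "y = bas a b c d" using assms(1) by (rule ring4_cases)
  define xx where "xx f = of_int a + of_int c * f" for f :: real
  define zz where "zz f = of_int b + of_int d * f" for f :: real
  have q: "quad e f a b c d = xx f + e * zz f" for e f
    by (simp add: quad_def xx_def zz_def algebra_simps)
  have bd: "\<bar>xx f\<bar> + sqrt 2 * \<bar>zz f\<bar> \<le> 2" if "f = golden \<or> f = golden'" for f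
  proof -
    have "\<bar>xx f + sqrt 2 * zz f\<bar> \<le> 2" "\<bar>xx f - sqrt 2 * zz f\<bar> \<le> 2"
      using small[of "sqrt 2" f] small[of "- sqrt 2" f] that
      by (auto simp: y conj_of_bas q)
    moreover have "sqrt 2 * \<bar>zz f\<bar> = \<bar>sqrt 2 * zz f\<bar>" by (simp add: abs_mult)
    ultimately show ?thesis by linarith
  qed
  have prod: "\<bar>xx f\<bar> * \<bar>zz f\<bar> \<le> 1 / sqrt 2" if "f = golden \<or> f = golden'" for f
  proof -
    have 1: "0 \<le> \<bar>xx f\<bar>" "0 \<le> sqrt 2 * \<bar>zz f\<bar>" by auto
    have "4 * (\<bar>xx f\<bar> * (sqrt 2 * \<bar>zz f\<bar>)) \<le> (\<bar>xx f\<bar> + sqrt 2 * \<bar>zz f\<bar>)^2"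
      using zero_le_power2[of "\<bar>xx f\<bar> - sqrt 2 * \<bar>zz f\<bar>"] by (simp add: power2_eq_square algebra_simps)
    also have "\<dots> \<le> 2^2" using bd[OF that] 1 by (intro power_mono) auto
    finally show ?thesis by (simp add: field_simps)
  qed
  have "(a, c) = (0,0) \<or> (b, d) = (0,0)"
  proof (rule ccontr)
    assume n: "\<not> ?thesis"
    have "1 * 1 \<le> (\<bar>xx golden\<bar> * \<bar>xx golden'\<bar>) * (\<bar>zz golden\<bar> * \<bar>zz golden'\<bar>)"
      unfolding xx_def zz_def using n by (intro mult_mono golden_norm_ge_1) auto
    also have "\<dots> = (\<bar>xx golden\<bar> * \<bar>zz golden\<bar>) * (\<bar>xx golden'\<bar> * \<bar>zz golden'\<bar>)" by simp
    also have "\<dots> \<le> (1 / sqrt 2) * (1 / sqrt 2)" by (intro mult_mono prod) auto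
    finally show False by simp
  qed
  then show ?thesis
  proof
    assume z: "(b, d) = (0, 0)"
    have x: "\<bar>xx golden\<bar> \<le> 2" "\<bar>xx golden'\<bar> \<le> 2" using bd[of golden] bd[of golden'] z by (auto simp: zz_def)
    have "c \<in> {-1,0,1} \<and> \<bar>2 * a + c\<bar> \<le> 4"
      using golden_int_small[of a c 2] x by (simp add: xx_def)
    then have c: "c = 0 \<and> (a = -2 \<or> a = -1 \<or> a = 0 \<or> a = 1 \<or> a = 2) \<or>
        c = 1 \<and> (a = -2 \<or> a = -1 \<or> a = 0 \<or> a = 1) \<or> c = -1 \<and> (a = -1 \<or> a = 0 \<or> a = 1 \<or> a = 2)"
      by auto
    have yx: "y = of_int a + of_int c * golden" using z by (simp add: y bas_def quad_def)
    have x': "\<bar>of_int a + of_int c * golden\<bar> \<le> 2" "\<bar>of_int a + of_int c * golden'\<bar> \<le> 2"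
      using x by (simp_all add: xx_def)
    have "c = 0 \<and> (a = -2 \<or> a = -1 \<or> a = 0 \<or> a = 1 \<or> a = 2) \<or>
        c = 1 \<and> (a = -1 \<or> a = 0) \<or> c = -1 \<and> (a = 0 \<or> a = 1)"
      using c
    proof (elim disjE conjE)
      assume h: "c = 1" "a = -2" show ?thesis using x'(2) golden_bounds unfolding h by simp
    next
      assume h: "c = 1" "a = 1" show ?thesis using x'(1) golden_bounds unfolding h by simp
    next
      assume h: "c = -1" "a = -1" show ?thesis using x'(1) golden_bounds unfolding h by simp
    next
      assume h: "c = -1" "a = 2" show ?thesis using x'(2) golden_bounds unfolding h by simp
    qed simp_all
    then have "y = -2 \<or> y = -1 \<or> y = 0 \<or> y = 1 \<or> y = 2 \<or> y = golden - 1 \<or> y = golden \<or>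
        y = - golden \<or> y = 1 - golden"
      unfolding yx by (elim disjE conjE) (simp_all only: of_int_0 of_int_1 of_int_minus of_int_numeral
        mult_zero_left add_0_left add_0_right mult_1_left mult_minus_left uminus_add_conv_diff
        diff_conv_add_uminus add.commute, simp_all)
    then show ?thesis unfolding small_values_def by blast
  next
    assume z: "(a, c) = (0, 0)"
    have s2: "sqrt 2 > 1.41" by (rule real_less_rsqrt) (simp add: power2_eq_square)
    have zb: "\<bar>zz f\<bar> \<le> 1.42" if "f = golden \<or> f = golden'" for f
    proof -
      have "1.41 * \<bar>zz f\<bar> \<le> sqrt 2 * \<bar>zz f\<bar>" using s2 by (intro mult_right_mono) auto
      also have "\<dots> \<le> 2" using bd[OF that] by linarith
      finally show ?thesis by simp
    qed
    have x': "\<bar>of_int b + of_int d * golden\<bar> \<le> 1.42" "\<bar>of_int b + of_int d * golden'\<bar> \<le> 1.42"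
      using zb[of golden] zb[of golden'] by (simp_all add: zz_def)
    then have "d \<in> {-1,0,1} \<and> \<bar>2 * b + d\<bar> \<le> 4"
      using golden_int_small[of b d "1.42"] by simp
    then have c: "d = 0 \<and> (b = -2 \<or> b = -1 \<or> b = 0 \<or> b = 1 \<or> b = 2) \<or>
        d = 1 \<and> (b = -2 \<or> b = -1 \<or> b = 0 \<or> b = 1) \<or> d = -1 \<and> (b = -1 \<or> b = 0 \<or> b = 1 \<or> b = 2)"
      by auto
    have yx: "y = sqrt 2 * (of_int b + of_int d * golden)" using z by (simp add: y bas_def quad_def algebra_simps)
    have "d = 0 \<and> (b = -1 \<or> b = 0 \<or> b = 1)"
      using c
    proof (elim disjE conjE)
      assume h: "d = 0" "b = -2" show ?thesis using x'(1) unfolding h by simp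
    next
      assume h: "d = 0" "b = 2" show ?thesis using x'(1) unfolding h by simp
    next
      assume h: "d = 1" "b = -2" show ?thesis using x'(2) golden_bounds unfolding h by simp
    next
      assume h: "d = 1" "b = -1" show ?thesis using x'(2) golden_bounds unfolding h by simp
    next
      assume h: "d = 1" "b = 0" show ?thesis using x'(1) golden_bounds unfolding h by simp
    next
      assume h: "d = 1" "b = 1" show ?thesis using x'(1) golden_bounds unfolding h by simp
    next
      assume h: "d = -1" "b = -1" show ?thesis using x'(1) golden_bounds unfolding h by simp
    next
      assume h: "d = -1" "b = 0" show ?thesis using x'(1) golden_bounds unfolding h by simp
    next
      assume h: "d = -1" "b = 1" show ?thesis using x'(2) golden_bounds unfolding h by simp
    next
      assume h: "d = -1" "b = 2" show ?thesis using x'(2) golden_bounds unfolding h by simp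
    qed simp_all
    then have "y = - sqrt 2 \<or> y = 0 \<or> y = sqrt 2" unfolding yx by (elim disjE conjE) simp_all
    then show ?thesis unfolding small_values_def by blast
  qed
qed

section \<open>Coordinate vectors\<close>

text \<open>A type of its own is used because the type of functions should not become an instance of the
  arithmetic classes.\<close>
datatype 'a vect = Vect (coef: "'a \<Rightarrow> real")

lemma vect_eq_iff: "f = g \<longleftrightarrow> (\<forall>x. coef f x = coef g x)"
  by (auto intro: vect.expand)

instantiation vect :: (type) real_vector
begin

definition zero_vect_def: "0 = Vect (\<lambda>x. 0)"
definition plus_vect_def: "f + g = Vect (\<lambda>x. coef f x + coef g x)"
definition minus_vect_def: "f - g = Vect (\<lambda>x. coef f x - coef g x)"
definition uminus_vect_def: "- f = Vect (\<lambda>x. - coef f x)"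
definition scaleR_vect_def: "c *\<^sub>R f = Vect (\<lambda>x. c * coef f x)"

instance
  by standard (simp_all add: vect_eq_iff zero_vect_def plus_vect_def minus_vect_def uminus_vect_def
    scaleR_vect_def algebra_simps)

end

lemma coef_simps [simp]:
  "coef 0 x = 0" "coef (f + g) x = coef f x + coef g x" "coef (f - g) x = coef f x - coef g x"
  "coef (- f) x = - coef f x" "coef (c *\<^sub>R f) x = c * coef f x"
  by (simp_all add: zero_vect_def plus_vect_def minus_vect_def uminus_vect_def scaleR_vect_def)

lemma coef_sum: "coef (sum h A) x = (\<Sum>r\<in>A. coef (h r) x)"
  by (induction A rule: infinite_finite_induct) auto

section \<open>The geometric representation\<close>

lemma (in group) list_prod_closed [simp, intro]:
  "set xs \<subseteq> carrier G \<Longrightarrow> list_prod G xs \<in> carrier G"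
  by (induction xs) (auto simp: list_prod_def)

lemma list_prod_Nil [simp]: "list_prod G [] = \<one>\<^bsub>G\<^esub>"
  and list_prod_Cons [simp]: "list_prod G (x # xs) = x \<otimes>\<^bsub>G\<^esub> list_prod G xs"
  by (simp_all add: list_prod_def)

lemma (in group) list_prod_append:
  "set xs \<subseteq> carrier G \<Longrightarrow> set ys \<subseteq> carrier G \<Longrightarrow> list_prod G (xs @ ys) = list_prod G xs \<otimes> list_prod G ys"
  by (induction xs) (auto simp: m_assoc)

lemma (in group) list_prod_in_generate:
  "set xs \<subseteq> S \<Longrightarrow> list_prod G xs \<in> generate G S"
  by (induction xs) (auto intro: generate.one generate.incl generate.eng)

text \<open>Simple roots are the unit vectors; the geometry is in the form \<open>B\<close> below.\<close>
definition sroot :: "'a \<Rightarrow> 'a vect" where "sroot r = Vect (\<lambda>x. if x = r then 1 else 0)"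

locale finite_coxeter = group W for W :: "('a, 'b) monoid_scheme" (structure) +
  fixes R :: "'a set" and m :: "'a \<Rightarrow> 'a \<Rightarrow> nat"
  assumes matrix: "coxeter_matrix R m"
    and presentation: "has_presentation W R (coxeter_relators R m)"
    and finW: "finite (carrier W)"
begin

lemma R_carrier: "R \<subseteq> carrier W" and gen_R: "generate W R = carrier W"
  using presentation by (simp_all add: has_presentation_def)

lemma R_in [simp, intro]: "r \<in> R \<Longrightarrow> r \<in> carrier W" using R_carrier by auto

lemma finR [simp]: "finite R" using R_carrier finW by (rule finite_subset)

lemma m_sym: "r \<in> R \<Longrightarrow> s \<in> R \<Longrightarrow> m r s = m s r"
  and m_one: "r \<in> R \<Longrightarrow> s \<in> R \<Longrightarrow> m r s = 1 \<longleftrightarrow> r = s"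
  using matrix unfolding coxeter_matrix_def by blast+

text \<open>All roots are scaled to have square length 2. As usual the label infinity, encoded by 0, gets the
  entry of two roots of opposite direction; by \<open>m_pos\<close> it does not occur in a finite group.\<close>
definition gram :: "'a \<Rightarrow> 'a \<Rightarrow> real" where
  "gram r s = (if m r s = 0 then - 2 else - 2 * cos (pi / m r s))"

definition B :: "'a vect \<Rightarrow> 'a vect \<Rightarrow> real" where
  "B f g = (\<Sum>r\<in>R. \<Sum>s\<in>R. coef f r * coef g s * gram r s)"

definition srefl :: "'a \<Rightarrow> 'a vect \<Rightarrow> 'a vect" where
  "srefl r f = f - B f (sroot r) *\<^sub>R sroot r"

lemma gram_sym: "r \<in> R \<Longrightarrow> s \<in> R \<Longrightarrow> gram r s = gram s r"
  by (simp add: gram_def m_sym)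

lemma gram_diag: "r \<in> R \<Longrightarrow> gram r r = 2"
  using m_one[of r r] by (simp add: gram_def)

lemma B_sym: "B f g = B g f"
  unfolding B_def by (subst sum.swap) (auto intro!: sum.cong simp: gram_sym)

lemma B_add_left: "B (f + g) h = B f h + B g h"
  by (simp add: B_def sum.distrib algebra_simps)
lemma B_scale_left: "B (c *\<^sub>R f) h = c * B f h"
  by (simp add: B_def sum_distrib_left algebra_simps)
lemma B_add_right: "B h (f + g) = B h f + B h g"
  by (metis B_sym B_add_left)
lemma B_scale_right: "B h (c *\<^sub>R f) = c * B h f"
  by (metis B_sym B_scale_left)
lemma B_minus_left: "B (- f) h = - B f h" using B_scale_left[of "-1" f h] by simp
lemma B_minus_right: "B h (- f) = - B h f" using B_scale_right[of h "-1" f] by simp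
lemma B_diff_left: "B (f - g) h = B f h - B g h"
  using B_add_left[of f "-g" h] by (simp add: B_minus_left)
lemma B_diff_right: "B h (f - g) = B h f - B h g"
  using B_add_right[of h f "-g"] by (simp add: B_minus_right)
lemma B_0_left [simp]: "B 0 h = 0" using B_scale_left[of 0 0 h] by simp
lemma B_0_right [simp]: "B h 0 = 0" using B_scale_right[of h 0 0] by simp
lemma B_sum_left: "B (sum f A) h = (\<Sum>x\<in>A. B (f x) h)"
  by (induction A rule: infinite_finite_induct) (auto simp: B_add_left)
lemma B_sum_right: "B h (sum f A) = (\<Sum>x\<in>A. B h (f x))"
  by (induction A rule: infinite_finite_induct) (auto simp: B_add_right)

lemmas B_simps = B_add_left B_add_right B_scale_left B_scale_right B_minus_left B_minus_right
  B_diff_left B_diff_right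

lemma B_sroot: "r \<in> R \<Longrightarrow> s \<in> R \<Longrightarrow> B (sroot r) (sroot s) = gram r s"
proof -
  assume r: "r \<in> R" and s: "s \<in> R"
  have "B (sroot r) (sroot s) = (\<Sum>x\<in>R. if x = r then (\<Sum>y\<in>R. if y = s then gram x y else 0) else 0)"
    unfolding B_def by (intro sum.cong) (auto simp: sroot_def if_distrib[of "\<lambda>x. x * _"] cong: if_cong)
  also have "\<dots> = gram r s" using r s by (simp add: sum.delta)
  finally show ?thesis .
qed

lemma B_sroot_self [simp]: "r \<in> R \<Longrightarrow> B (sroot r) (sroot r) = 2"
  by (simp add: B_sroot gram_diag)

lemma linear_srefl: "linear (srefl r)"
  by (rule linearI) (simp_all add: srefl_def B_simps algebra_simps scaleR_add_left)

lemma srefl_srefl [simp]: "r \<in> R \<Longrightarrow> srefl r (srefl r f) = f"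
  by (simp add: srefl_def B_simps algebra_simps scaleR_diff_left)

lemma B_srefl: "r \<in> R \<Longrightarrow> B (srefl r f) (srefl r g) = B f g"
  by (simp add: srefl_def B_simps B_sym[of "sroot r" g] algebra_simps)

lemma plane_step:
  assumes r: "r \<in> R" and s: "s \<in> R" and b: "gram r s = - 2 * c"
  shows "srefl s (x *\<^sub>R sroot r + y *\<^sub>R sroot s) = x *\<^sub>R sroot r + (2 * c * x - y) *\<^sub>R sroot s"
    "srefl r (x *\<^sub>R sroot r + y *\<^sub>R sroot s) = (2 * c * y - x) *\<^sub>R sroot r + y *\<^sub>R sroot s"
  using r s b gram_sym[OF r s]
  by (simp_all add: srefl_def B_simps B_sroot gram_diag vect_eq_iff algebra_simps)

lemma angle:
  assumes r: "r \<in> R" and s: "s \<in> R" and "r \<noteq> s" and k: "m r s > 0"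
  defines "t \<equiv> pi / real (m r s)"
  shows "0 < t" "t \<le> pi / 2" "sin t > 0" "gram r s = - 2 * cos t" "real (m r s) * t = pi" "m r s \<ge> 2"
proof -
  have "m r s \<noteq> 1" using m_one assms by simp
  then show k2: "m r s \<ge> 2" using k by simp
  then show t: "0 < t" "t \<le> pi / 2" by (auto simp: t_def field_simps)
  show "sin t > 0" using t pi_gt_zero by (intro sin_gt_zero) linarith+
  show "gram r s = - 2 * cos t" "real (m r s) * t = pi" using k by (auto simp: t_def gram_def)
qed

lemma sin_chebyshev: "2 * cos t * sin (x * t) - sin ((x - 1) * t) = sin ((x + 1) * (t::real))"
  by (simp add: ring_distribs sin_add sin_diff)

text \<open>On the plane of the two simple roots the product of the two reflections is a rotation by twice
  the angle pi / m; since the form is nondegenerate on this plane, every vector differs from one in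
  the plane by a vector that both reflections fix.\<close>
lemma srefl_srefl_power:
  assumes r: "r \<in> R" and s: "s \<in> R" and k: "m r s > 0"
  shows "((srefl r \<circ> srefl s) ^^ m r s) f = f"
proof (cases "r = s")
  case True
  have "m s s = 1" using m_one[OF s s] by simp
  then show ?thesis using s unfolding True by simp
next
  case False
  define t where "t = pi / real (m r s)"
  note a = angle[OF r s False k, folded t_def]
  let ?F = "srefl r \<circ> srefl s"
  define P where "P j = sin (j * t) *\<^sub>R sroot r + sin ((j - 1) * t) *\<^sub>R sroot s" for j :: real
  have lin: "linear (?F ^^ n)" for n
  proof (induction n)
    case 0
    show ?case using linear_ident by (simp add: id_def)
  next
    case (Suc n)
    then show ?case unfolding funpow.simps by (intro linear_compose linear_srefl)
  qed
  have step: "?F (P j) = P (j + 2)" for j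
  proof -
    have e: "sin ((j + 1) * t) = 2 * cos t * sin (j * t) - sin ((j - 1) * t)"
      by (rule sin_chebyshev[symmetric])
    have e2: "sin ((j + 2) * t) = 2 * cos t * sin ((j + 1) * t) - sin (j * t)"
      using sin_chebyshev[of t "j + 1"] by (simp add: algebra_simps)
    show ?thesis unfolding P_def o_def plane_step[OF r s a(4)] e[symmetric] e2[symmetric] by (simp add: algebra_simps)
  qed
  have steps: "(?F ^^ n) (P j) = P (j + 2 * real n)" for n j
  proof (induction n arbitrary: j)
    case (Suc n)
    have "(?F ^^ Suc n) (P j) = (?F ^^ n) (?F (P j))" by (simp only: funpow_Suc_right o_apply)
    also have "\<dots> = P (j + 2 * real (Suc n))" unfolding step Suc.IH by (simp add: algebra_simps)
    finally show ?case .
  qed simp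
  have per: "sin (x * t + 2 * (real (m r s) * t)) = sin (x * t)" for x
    unfolding a(5) by simp
  have fixP: "(?F ^^ m r s) (P j) = P j" for j
  proof -
    have "P (j + 2 * real (m r s)) = P j"
      unfolding P_def using per[of j] per[of "j - 1"] by (simp add: algebra_simps)
    then show ?thesis unfolding steps .
  qed
  define c where "c = cos t"
  have c: "1 - c^2 > 0" using a(3) unfolding c_def by (simp add: sin_squared_eq[symmetric])
  define p q where "p = B f (sroot r)" and "q = B f (sroot s)"
  define x y where "x = (p + c * q) / (2 * (1 - c^2))" and "y = (q + c * p) / (2 * (1 - c^2))"
  define z where "z = x *\<^sub>R sroot r + y *\<^sub>R sroot s"
  have zP: "z = (x / sin t) *\<^sub>R P 1 + (- y / sin t) *\<^sub>R P 0"
    using a(3) by (simp add: z_def P_def vect_eq_iff)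
  have z: "(?F ^^ m r s) z = z"
    unfolding zP linear_add[OF lin] linear_scale[OF lin] fixP ..
  have B1: "B z (sroot r) = 2 * x - 2 * c * y" "B z (sroot s) = 2 * y - 2 * c * x"
    using a(4) r s gram_sym[OF r s] by (simp_all add: z_def B_simps B_sroot gram_diag c_def)
  have nz: "2 * (1 - c^2) \<noteq> 0" using c by simp
  have "x * (2 * (1 - c^2)) = p + c * q" "y * (2 * (1 - c^2)) = q + c * p"
    unfolding x_def y_def by (simp_all only: times_divide_eq_left nonzero_mult_div_cancel_right[OF nz])
  then have cc: "2 * x * (1 - c^2) = p + c * q" "2 * y * (1 - c^2) = q + c * p"
    by (simp_all only: mult.commute mult.left_commute)
  have "(2 * x - 2 * c * y) * (1 - c^2) = 2 * x * (1 - c^2) - c * (2 * y * (1 - c^2))"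
    by (simp add: algebra_simps)
  also have "\<dots> = p * (1 - c^2)" unfolding cc by (simp add: algebra_simps power2_eq_square)
  finally have e1: "(2 * x - 2 * c * y) * (1 - c^2) = p * (1 - c^2)" .
  have "(2 * y - 2 * c * x) * (1 - c^2) = 2 * y * (1 - c^2) - c * (2 * x * (1 - c^2))"
    by (simp add: algebra_simps)
  also have "\<dots> = q * (1 - c^2)" unfolding cc by (simp add: algebra_simps power2_eq_square)
  finally have e2: "(2 * y - 2 * c * x) * (1 - c^2) = q * (1 - c^2)" .
  have "B z (sroot r) = p" "B z (sroot s) = q" using c e1 e2 unfolding B1 by (simp_all only: mult_cancel_right) auto
  then have f0: "srefl r (f - z) = f - z" "srefl s (f - z) = f - z"
    by (simp_all add: srefl_def B_simps p_def q_def)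
  have f: "(?F ^^ n) (f - z) = f - z" for n by (induction n) (simp_all add: f0)
  have "(?F ^^ m r s) ((f - z) + z) = (f - z) + z"
    unfolding linear_add[OF lin] f z ..
  then show ?thesis by simp
qed

text \<open>A letter and its formal inverse act alike, because simple reflections are involutions.\<close>
definition act_word :: "('a \<times> bool) list \<Rightarrow> 'a vect \<Rightarrow> 'a vect" where
  "act_word u = foldr (\<lambda>p. srefl (fst p)) u"

lemma act_word_append: "act_word (u @ v) f = act_word u (act_word v f)"
  by (simp add: act_word_def)

lemma act_word_simps [simp]: "act_word [] f = f" "act_word (p # u) f = srefl (fst p) (act_word u f)"
  by (simp_all add: act_word_def)

lemma act_word_step:
  assumes "word_step R (coxeter_relators R m) u v" shows "act_word u = act_word v"
  using assms
proof cases
  case (cancel s u v b)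
  then show ?thesis by (simp add: fun_eq_iff act_word_append)
next
  case (relator q u v)
  then obtain r s where q: "q = concat (replicate (m r s) [(r, True), (s, True)])" "r \<in> R" "s \<in> R"
    by (auto simp: coxeter_relators_def)
  have c: "act_word (concat (replicate n [(r, True), (s, True)])) f = ((srefl r \<circ> srefl s) ^^ n) f" for n f
    by (induction n) simp_all
  have "act_word q f = f" for f
    unfolding q(1) c using srefl_srefl_power[OF q(2,3)] by (cases "m r s = 0") simp_all
  then show ?thesis using relator by (simp add: fun_eq_iff act_word_append)
qed

lemma act_word_equiv:
  assumes "equivclp (word_step R (coxeter_relators R m)) u v" shows "act_word u = act_word v"
  using assms by (induction rule: equivclp_induct) (auto dest: act_word_step)

definition words :: "('a \<times> bool) list set" where "words = lists (R \<times> UNIV)"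

lemma word_value_simps: "word_value W [] = \<one>"
  "word_value W (p # u) = (if snd p then fst p else inv (fst p)) \<otimes> word_value W u"
  by (auto simp: word_value_def split: prod.splits)

lemma word_value_closed: "u \<in> words \<Longrightarrow> word_value W u \<in> carrier W"
  unfolding words_def by (induction u) (auto simp: word_value_simps)

lemma word_value_append:
  "u \<in> words \<Longrightarrow> v \<in> words \<Longrightarrow> word_value W (u @ v) = word_value W u \<otimes> word_value W v"
proof (induction u)
  case (Cons p u)
  then have "u \<in> words" "fst p \<in> R" by (auto simp: words_def)
  then show ?case using Cons by (auto simp: word_value_simps m_assoc word_value_closed)
qed (auto simp: word_value_simps word_value_closed)

lemma ex_word:
  assumes "g \<in> carrier W" shows "\<exists>u\<in>words. word_value W u = g"
proof -
  have "g \<in> generate W R" using assms gen_R by simp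
  then show ?thesis
  proof induction
    case one
    show ?case by (rule bexI[of _ "[]"]) (auto simp: word_value_simps words_def)
  next
    case (incl r)
    then show ?case by (intro bexI[of _ "[(r, True)]"]) (auto simp: word_value_simps words_def)
  next
    case (inv r)
    then show ?case by (intro bexI[of _ "[(r, False)]"]) (auto simp: word_value_simps words_def)
  next
    case (eng g h)
    then obtain u v where "u \<in> words" "v \<in> words" "word_value W u = g" "word_value W v = h" by auto
    then show ?case by (intro bexI[of _ "u @ v"]) (auto simp: word_value_append words_def)
  qed
qed

definition act :: "'a \<Rightarrow> 'a vect \<Rightarrow> 'a vect" where
  "act g = act_word (SOME u. u \<in> words \<and> word_value W u = g)"

text \<open>This is where the presentation is used: words with the same value are related by steps that do not
  change the action.\<close>
lemma act_word_value: assumes "u \<in> words" shows "act (word_value W u) = act_word u"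
proof -
  let ?v = "SOME v. v \<in> words \<and> word_value W v = word_value W u"
  have v: "?v \<in> words \<and> word_value W ?v = word_value W u" by (rule someI[of _ u]) (use assms in auto)
  then have "equivclp (word_step R (coxeter_relators R m)) ?v u"
    using presentation assms unfolding has_presentation_def words_def by blast
  then show ?thesis unfolding act_def by (rule act_word_equiv)
qed

lemma act_mult: assumes "g \<in> carrier W" "h \<in> carrier W" shows "act (g \<otimes> h) f = act g (act h f)"
proof -
  obtain u v where u: "u \<in> words" "v \<in> words" "word_value W u = g" "word_value W v = h"
    using ex_word assms by metis
  have uv: "u @ v \<in> words" using u by (auto simp: words_def)
  have "act (g \<otimes> h) = act_word (u @ v)" using act_word_value[OF uv] u by (simp add: word_value_append)
  then show ?thesis using act_word_value u by (simp add: act_word_append) metis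
qed

lemma act_one [simp]: "act \<one> f = f"
  using act_word_value[of "[]"] by (simp add: word_value_simps words_def)

lemma act_R: "r \<in> R \<Longrightarrow> act r f = srefl r f"
  using act_word_value[of "[(r, True)]"] by (simp add: word_value_simps words_def)

lemma act_inv [simp]: "g \<in> carrier W \<Longrightarrow> act (inv g) (act g f) = f" "g \<in> carrier W \<Longrightarrow> act g (act (inv g) f) = f"
  by (simp_all flip: act_mult)

lemma R_sq: "r \<in> R \<Longrightarrow> r \<otimes> r = \<one>"
proof -
  assume r: "r \<in> R"
  let ?Q = "coxeter_relators R m"
  have "concat (replicate (m r r) [(r, True), (r, True)]) \<in> ?Q" unfolding coxeter_relators_def using r by blast
  then have "[(r, True), (r, True)] \<in> ?Q" using m_one[OF r r] by simp
  then have "word_step R ?Q ([] @ [(r, True), (r, True)] @ []) ([] @ [])" by (rule word_step.relator)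
  then have "equivclp (word_step R ?Q) [(r, True), (r, True)] []" by (simp add: r_into_equivclp)
  then have "word_value W [(r, True), (r, True)] = word_value W []"
    using presentation r unfolding has_presentation_def by (auto simp: in_lists_conv_set)
  then show ?thesis using r by (simp add: word_value_simps)
qed

lemma R_inv: "r \<in> R \<Longrightarrow> inv r = r" using R_sq by (simp add: inv_equality)

lemma ex_list: assumes "g \<in> carrier W" shows "\<exists>xs. set xs \<subseteq> R \<and> list_prod W xs = g"
proof -
  obtain u where u: "u \<in> words" "word_value W u = g" using ex_word[OF assms] by auto
  have "list_prod W (map fst u) = word_value W u"
    using u(1) unfolding words_def by (induction u) (auto simp: word_value_simps R_inv)
  then show ?thesis using u by (intro exI[of _ "map fst u"]) (auto simp: words_def)
qed

text \<open>Generators are involutions, so left multiplication by generators reaches every element.\<close>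
lemma W_induct [consumes 1, case_names one mult]:
  assumes "g \<in> carrier W" and one: "P \<one>"
    and step: "\<And>r g. r \<in> R \<Longrightarrow> g \<in> carrier W \<Longrightarrow> P g \<Longrightarrow> P (r \<otimes> g)"
  shows "P g"
proof -
  obtain xs where xs: "set xs \<subseteq> R" "list_prod W xs = g" using ex_list[OF assms(1)] by auto
  have "P (list_prod W xs)" using xs(1)
    by (induction xs) (use one step R_carrier in auto)
  then show ?thesis using xs by simp
qed

lemma linear_act: assumes "g \<in> carrier W" shows "linear (act g)"
  using assms
proof (induction rule: W_induct)
  case one
  then show ?case by (simp add: linear_iff)
next
  case (mult r g)
  have "act (r \<otimes> g) = srefl r \<circ> act g" using mult by (auto simp: act_mult act_R)
  then show ?case using mult linear_srefl linear_compose by metis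
qed

lemmas act_lin = linear_add[OF linear_act] linear_scale[OF linear_act] linear_diff[OF linear_act]
  linear_0[OF linear_act] linear_neg[OF linear_act] linear_sum[OF linear_act]

lemma B_act [simp]: "g \<in> carrier W \<Longrightarrow> B (act g f) (act g h) = B f h"
  by (induction rule: W_induct) (simp_all add: act_mult act_R B_srefl)

lemma B_act_inv: "g \<in> carrier W \<Longrightarrow> B (act g f) h = B f (act (inv g) h)"
  using B_act[of g f "act (inv g) h"] by simp

text \<open>The coordinates of a vector are indexed by a whole type. The form does not see the coordinates
  outside the generating set, so it can only be definite on this subspace.\<close>
definition root_space :: "'a vect set" where "root_space = {f. \<forall>x. x \<notin> R \<longrightarrow> coef f x = 0}"

lemma root_space_expand: assumes "f \<in> root_space" shows "f = (\<Sum>r\<in>R. coef f r *\<^sub>R sroot r)"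
  using assms
  by (auto simp: vect_eq_iff coef_sum root_space_def sroot_def if_distrib sum.delta cong: if_cong)

lemma subspace_root_space: "subspace root_space" by (auto simp: subspace_def root_space_def)

lemma sroot_root_space: "r \<in> R \<Longrightarrow> sroot r \<in> root_space" by (auto simp: root_space_def sroot_def)

lemma act_root_space: "g \<in> carrier W \<Longrightarrow> f \<in> root_space \<Longrightarrow> act g f \<in> root_space"
proof (induction rule: W_induct)
  case (mult r g)
  then show ?case
    by (auto simp: act_mult act_R srefl_def intro!: subspace_diff[OF subspace_root_space] subspace_scale[OF subspace_root_space] sroot_root_space)
qed simp

section \<open>Positive definiteness\<close>

text \<open>The standard trick: summing a positive definite form over the finite group makes it invariant.\<close>
definition avg :: "'a vect \<Rightarrow> 'a vect \<Rightarrow> real" where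
  "avg f g = (\<Sum>h\<in>carrier W. \<Sum>x\<in>R. coef (act h f) x * coef (act h g) x)"

lemma avg_sym: "avg f g = avg g f" by (simp add: avg_def mult.commute)

lemma avg_add: "avg (f + g) k = avg f k + avg g k"
  unfolding avg_def sum.distrib[symmetric] by (intro sum.cong) (auto simp: act_lin algebra_simps)

lemma avg_scale: "avg (c *\<^sub>R f) k = c * avg f k"
  unfolding avg_def sum_distrib_left by (intro sum.cong) (auto simp: act_lin algebra_simps)

lemma avg_sum: "avg (\<Sum>r\<in>A. c r *\<^sub>R f r) k = (\<Sum>r\<in>A. c r * avg (f r) k)"
proof (induction A rule: infinite_finite_induct)
  case empty
  show ?case using avg_scale[of 0 0 k] by simp
next
  case (infinite A)
  show ?case using avg_scale[of 0 0 k] infinite by simp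
qed (simp add: avg_add avg_scale)

lemma avg_act: assumes "k \<in> carrier W" shows "avg (act k f) (act k g) = avg f g"
proof -
  have "avg (act k f) (act k g) = (\<Sum>h\<in>carrier W. (\<Sum>x\<in>R. coef (act (h \<otimes> k) f) x * coef (act (h \<otimes> k) g) x))"
    unfolding avg_def using assms by (intro sum.cong) (auto simp: act_mult)
  also have "\<dots> = avg f g" unfolding avg_def
    by (rule sum.reindex_bij_witness[of _ "\<lambda>h. h \<otimes> inv k" "\<lambda>h. h \<otimes> k"])
       (use assms in \<open>auto simp: m_assoc\<close>)
  finally show ?thesis .
qed

lemma avg_pos: assumes "f \<in> root_space" "f \<noteq> 0" shows "avg f f > 0"
proof -
  obtain x where "coef f x \<noteq> 0" using assms(2) by (auto simp: vect_eq_iff)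
  then have x: "x \<in> R" "coef f x \<noteq> 0" using assms by (auto simp: root_space_def)
  have "(\<Sum>y\<in>R. coef (act \<one> f) y * coef (act \<one> f) y) > 0"
    by (rule sum_pos2[of _ x]) (use x in \<open>auto simp: zero_less_mult_iff linorder_neq_iff\<close>)
  then show ?thesis unfolding avg_def
    by (intro sum_pos2[OF finW one_closed]) (auto intro!: sum_nonneg)
qed

lemma avg_sroot: assumes "r \<in> R" shows "avg f (sroot r) = B f (sroot r) * (avg (sroot r) (sroot r) / 2)"
proof -
  have s: "srefl r (sroot r) = (-1) *\<^sub>R sroot r" using assms by (simp add: srefl_def scaleR_2)
  have "avg f (sroot r) = avg (srefl r f) (srefl r (sroot r))" using avg_act[of r f "sroot r"] assms by (simp add: act_R)
  also have "\<dots> = - avg (f + (- B f (sroot r)) *\<^sub>R sroot r) (sroot r)"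
    unfolding s avg_sym[of _ "(-1) *\<^sub>R sroot r"] avg_scale by (simp add: srefl_def avg_sym)
  also have "\<dots> = - (avg f (sroot r) - B f (sroot r) * avg (sroot r) (sroot r))"
    unfolding avg_add avg_scale by simp
  finally show ?thesis by simp
qed

text \<open>For every invariant inner product each generator is the orthogonal reflection in its simple
  root, and simple roots that are not orthogonal have equal length. Rescaling the simple roots
  therefore turns the averaged inner product into B.\<close>
lemma B_pos: assumes f: "f \<in> root_space" and "f \<noteq> 0" shows "B f f > 0"
proof -
  define c where "c r = avg (sroot r) (sroot r) / 2" for r
  have av0: "sroot r \<noteq> 0" for r :: 'a by (auto simp: sroot_def vect_eq_iff intro!: exI[of _ r])
  have c: "c r > 0" if "r \<in> R" for r using avg_pos[OF sroot_root_space[OF that] av0] by (simp add: c_def)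
  define f' where "f' = (\<Sum>r\<in>R. (coef f r / sqrt (c r)) *\<^sub>R sroot r)"
  have quot: "avg (sroot r) (sroot s) / (sqrt (c r) * sqrt (c s)) = gram r s" if "r \<in> R" "s \<in> R" for r s
  proof (cases "gram r s = 0")
    case True
    then show ?thesis using that avg_sroot[of s "sroot r"] by (simp add: B_sroot)
  next
    case False
    have "gram r s * c s = gram s r * c r"
      using avg_sroot[of s "sroot r"] avg_sroot[of r "sroot s"] avg_sym[of "sroot r" "sroot s"] that by (simp add: c_def B_sroot)
    then have "c s = c r" using False gram_sym that by simp
    moreover have "avg (sroot r) (sroot s) = gram r s * c s"
      using avg_sroot[of s "sroot r"] that unfolding c_def by (simp only: B_sroot)
    ultimately show ?thesis using that c[of s] by simp
  qed
  have "avg f' f' = (\<Sum>r\<in>R. \<Sum>s\<in>R. (coef f r / sqrt (c r)) * (coef f s / sqrt (c s)) * avg (sroot r) (sroot s))"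
  proof -
    have 1: "avg f' k = (\<Sum>r\<in>R. (coef f r / sqrt (c r)) * avg (sroot r) k)" for k
      unfolding f'_def by (rule avg_sum)
    have 2: "avg (sroot r) f' = (\<Sum>s\<in>R. (coef f s / sqrt (c s)) * avg (sroot r) (sroot s))" for r
      using 1[of "sroot r"] by (simp only: avg_sym[of "sroot r"])
    show ?thesis
      by (simp only: 1[of f'] 2 sum_distrib_left mult.assoc)
  qed
  also have "\<dots> = B f f" unfolding B_def
    by (intro sum.cong refl) (simp flip: quot add: field_simps)
  finally have e: "avg f' f' = B f f" .
  have f'1: "f' \<in> root_space" unfolding f'_def
    by (intro subspace_sum[OF subspace_root_space] subspace_scale[OF subspace_root_space] sroot_root_space) auto
  obtain x where "coef f x \<noteq> 0" using assms(2) by (auto simp: vect_eq_iff)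
  then have x: "x \<in> R" "coef f x \<noteq> 0" using f by (auto simp: root_space_def)
  have "coef f' x = coef f x / sqrt (c x)"
  proof -
    define g where "g = Vect (\<lambda>y. if y \<in> R then coef f y / sqrt (c y) else 0)"
    have "g = (\<Sum>r\<in>R. coef g r *\<^sub>R sroot r)" by (rule root_space_expand) (simp add: root_space_def g_def)
    also have "\<dots> = f'" unfolding f'_def by (intro sum.cong) (auto simp: g_def)
    finally have "coef f' x = coef g x" by simp
    then show ?thesis using x by (simp add: g_def)
  qed
  then have "f' \<noteq> 0" using x c[of x] by auto
  then show ?thesis using avg_pos[OF f'1] e by simp
qed

text \<open>With an infinite label the sum of the two simple roots would be isotropic.\<close>
lemma m_pos: assumes "r \<in> R" "s \<in> R" shows "m r s > 0"
proof (rule ccontr)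
  assume "\<not> ?thesis"
  then have m0: "m r s = 0" by simp
  then have ne: "r \<noteq> s" using m_one[of r s] assms by auto
  have b: "gram r s = -2" using m0 by (simp add: gram_def)
  have "sroot r + sroot s \<in> root_space" using assms by (intro subspace_add[OF subspace_root_space] sroot_root_space)
  moreover have "sroot r + sroot s \<noteq> 0" using ne by (auto simp: sroot_def vect_eq_iff intro!: exI[of _ r])
  ultimately have "B (sroot r + sroot s) (sroot r + sroot s) > 0" by (rule B_pos)
  then show False using assms b gram_sym[of r s] by (simp add: B_simps B_sroot gram_diag)
qed

end

section \<open>Length and positivity\<close>

text \<open>The alternating word of the given length whose last letter is the first argument; every reduced
  word in two generators has this form.\<close>
fun alt :: "'a \<Rightarrow> 'a \<Rightarrow> nat \<Rightarrow> 'a list" where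
  "alt s r 0 = []"
| "alt s r (Suc k) = alt r s k @ [s]"

lemma length_alt [simp]: "length (alt s r k) = k"
  by (induction k arbitrary: s r) auto

lemma set_alt: "set (alt s r k) \<subseteq> {r, s}"
  by (induction k arbitrary: s r) auto

lemma alt_Cons: "alt s r (Suc k) = (if even k then s else r) # alt s r k"
proof (induction k arbitrary: s r)
  case (Suc k)
  have "alt s r (Suc (Suc k)) = alt r s (Suc k) @ [s]" by simp
  also have "\<dots> = (if even k then r else s) # alt r s k @ [s]" unfolding Suc by simp
  finally show ?case by simp
qed simp

lemma alt_suffix: "\<exists>pre. alt s r (n + j) = pre @ alt s r j"
proof (induction j arbitrary: s r)
  case (Suc j)
  obtain pre where "alt r s (n + j) = pre @ alt r s j" using Suc by blast
  then show ?case by auto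
qed simp

lemma alternating_eq_alt:
  assumes "set ys \<subseteq> {r, s}" "ys \<noteq> [] \<Longrightarrow> last ys = s" "\<And>as x bs. ys \<noteq> as @ x # x # bs"
  shows "ys = alt s r (length ys)"
  using assms
proof (induction ys arbitrary: r s rule: rev_induct)
  case (snoc x ys)
  have x: "x = s" using snoc.prems(2) by simp
  have "ys = alt r s (length ys)"
  proof (rule snoc.IH)
    show "set ys \<subseteq> {s, r}" using snoc.prems(1) by auto
    show "last ys = r" if "ys \<noteq> []"
    proof (rule ccontr)
      assume "last ys \<noteq> r"
      moreover have "last ys \<in> set ys" using that by simp
      ultimately have "last ys = s" using snoc.prems(1) by auto
      then have "ys @ [x] = butlast ys @ s # s # []" using that x
        by (metis append.assoc append_Cons append_Nil append_butlast_last_id)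
      then show False using snoc.prems(3) by blast
    qed
    show "ys \<noteq> as @ z # z # bs" for as z bs
      using snoc.prems(3)[of as z "bs @ [x]"] by auto
  qed
  then show ?case using x by simp
qed simp

context finite_coxeter
begin

definition len :: "'a \<Rightarrow> nat" where
  "len g = (LEAST k. \<exists>xs. set xs \<subseteq> R \<and> length xs = k \<and> list_prod W xs = g)"

lemma list_R_closed [simp]: "set xs \<subseteq> R \<Longrightarrow> list_prod W xs \<in> carrier W"
  using R_carrier by (intro list_prod_closed) auto

lemma list_R_append: "set xs \<subseteq> R \<Longrightarrow> set ys \<subseteq> R \<Longrightarrow>
    list_prod W (xs @ ys) = list_prod W xs \<otimes> list_prod W ys"
  using R_carrier by (intro list_prod_append) auto

lemma len_le: "set xs \<subseteq> R \<Longrightarrow> len (list_prod W xs) \<le> length xs"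
  unfolding len_def by (rule Least_le) auto

lemma ex_reduced: assumes "g \<in> carrier W"
  shows "\<exists>xs. set xs \<subseteq> R \<and> length xs = len g \<and> list_prod W xs = g"
proof -
  obtain xs where "set xs \<subseteq> R" "list_prod W xs = g" using ex_list[OF assms] by auto
  then have "\<exists>ys. set ys \<subseteq> R \<and> length ys = length xs \<and> list_prod W ys = g" by auto
  then show ?thesis unfolding len_def by (rule LeastI)
qed

lemma len_mult: assumes "g \<in> carrier W" "h \<in> carrier W" shows "len (g \<otimes> h) \<le> len g + len h"
proof -
  obtain xs ys where "set xs \<subseteq> R" "length xs = len g" "list_prod W xs = g"
    "set ys \<subseteq> R" "length ys = len h" "list_prod W ys = h" using ex_reduced assms by metis
  then show ?thesis using len_le[of "xs @ ys"] by (simp add: list_R_append)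
qed

lemma len_R: "r \<in> R \<Longrightarrow> len r \<le> 1" using len_le[of "[r]"] by simp

lemma mult_R_R [simp]: "g \<in> carrier W \<Longrightarrow> r \<in> R \<Longrightarrow> g \<otimes> r \<otimes> r = g"
  by (simp add: m_assoc R_sq)

lemma R_mult_R [simp]: "g \<in> carrier W \<Longrightarrow> r \<in> R \<Longrightarrow> r \<otimes> (r \<otimes> g) = g"
  by (simp add: m_assoc[symmetric] R_sq)

lemma ex_descent: assumes "g \<in> carrier W" "g \<noteq> \<one>"
  shows "\<exists>r\<in>R. len g = Suc (len (g \<otimes> r))"
proof -
  obtain xs where xs: "set xs \<subseteq> R" "length xs = len g" "list_prod W xs = g" using ex_reduced assms by metis
  have "xs \<noteq> []" using xs assms by auto
  then obtain ys r where ys: "xs = ys @ [r]" by (metis append_butlast_last_id)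
  have r: "r \<in> R" "set ys \<subseteq> R" using ys xs by auto
  have g: "g = list_prod W ys \<otimes> r" using xs r by (simp add: ys list_R_append)
  have "len (g \<otimes> r) \<le> length ys" using len_le[of ys] r by (simp add: g)
  moreover have "len g \<le> len (g \<otimes> r) + len r" using len_mult[of "g \<otimes> r" r] assms r by simp
  ultimately show ?thesis using len_R[of r] r xs ys by (intro bexI[of _ r]) auto
qed

lemma alt_R: "r \<in> R \<Longrightarrow> s \<in> R \<Longrightarrow> set (alt s r k) \<subseteq> R" using set_alt[of s r k] by auto

text \<open>Adding two letters on the right multiplies by rs.\<close>
lemma prod_alt_even:
  assumes "r \<in> R" "s \<in> R"
  shows "list_prod W (alt s r (2 * j)) = (r \<otimes> s) [^] j"
    "list_prod W (alt s r (Suc (2 * j))) = s \<otimes> (r \<otimes> s) [^] j"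
proof -
  have step: "list_prod W (alt s r (Suc (Suc k))) = list_prod W (alt s r k) \<otimes> (r \<otimes> s)" for k
    using assms alt_R[OF assms] by (simp add: list_R_append)
  show "list_prod W (alt s r (2 * j)) = (r \<otimes> s) [^] j"
    by (induction j) (use assms in \<open>auto simp: step simp del: alt.simps(2)\<close>)
  show "list_prod W (alt s r (Suc (2 * j))) = s \<otimes> (r \<otimes> s) [^] j"
  proof (induction j)
    case (Suc j)
    have "list_prod W (alt s r (Suc (2 * Suc j))) = list_prod W (alt s r (Suc (2 * j))) \<otimes> (r \<otimes> s)"
      using step[of "Suc (2 * j)"] by simp
    then show ?case using Suc assms by (simp add: m_assoc del: alt.simps(2))
  qed (use assms in simp)
qed

lemma relation: assumes "r \<in> R" "s \<in> R" shows "(r \<otimes> s) [^] m r s = \<one>"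
proof -
  let ?Q = "coxeter_relators R m" and ?u = "concat (replicate (m r s) [(r, True), (s, True)])"
  have "?u \<in> ?Q" unfolding coxeter_relators_def using assms by blast
  then have "word_step R ?Q ([] @ ?u @ []) ([] @ [])" by (rule word_step.relator)
  then have e: "equivclp (word_step R ?Q) ?u []" by (simp add: r_into_equivclp)
  have u: "?u \<in> lists (R \<times> UNIV)" using assms by (auto simp: in_lists_conv_set)
  have "word_value W ?u = word_value W []"
    using presentation e u unfolding has_presentation_def by blast
  moreover have "word_value W (concat (replicate n [(r, True), (s, True)])) = (r \<otimes> s) [^] n" for n
    by (induction n) (use assms in \<open>auto simp: word_value_simps m_assoc nat_pow_Suc2[symmetric] simp flip: m_assoc\<close>)
  ultimately show ?thesis by (simp add: word_value_simps)
qed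

lemma pow_swap: assumes "r \<in> R" "s \<in> R" shows "(s \<otimes> r) [^] (j::nat) = inv ((r \<otimes> s) [^] j)"
proof -
  have "inv (r \<otimes> s) = s \<otimes> r" using assms by (simp add: inv_mult_group R_inv)
  then show ?thesis using assms nat_pow_inv[of "r \<otimes> s" j] by simp
qed

lemma braid: assumes r: "r \<in> R" and s: "s \<in> R"
  shows "list_prod W (alt s r (m r s)) = list_prod W (alt r s (m r s))"
proof (cases "even (m r s)")
  case True
  then obtain j where j: "m r s = 2 * j" by (auto elim: evenE)
  let ?x = "(r \<otimes> s) [^] j"
  have "?x \<otimes> ?x = \<one>" using relation[OF r s] r s unfolding j by (simp add: nat_pow_mult mult_2)
  then have "inv ?x = ?x" using r s by (simp add: inv_equality)
  then show ?thesis unfolding j prod_alt_even[OF r s] prod_alt_even[OF s r] pow_swap[OF r s] by simp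
next
  case False
  then obtain j where j: "m r s = Suc (2 * j)" by (auto elim: oddE)
  let ?x = "(r \<otimes> s) [^] j"
  have x: "?x \<in> carrier W" using r s by simp
  have xx: "?x \<otimes> ?x = (r \<otimes> s) [^] (2 * j)" using r s by (simp add: nat_pow_mult mult_2)
  have "(r \<otimes> s) \<otimes> (?x \<otimes> ?x) = \<one>"
    unfolding xx using nat_pow_Suc2[of "r \<otimes> s" "2 * j"] relation[OF r s] j r s by (simp del: nat_pow_Suc)
  then have "(r \<otimes> (s \<otimes> ?x)) \<otimes> ?x = \<one>" using r s x by (simp add: m_assoc)
  then have i: "inv ?x = r \<otimes> (s \<otimes> ?x)" using r s x by (intro inv_equality) auto
  have "r \<otimes> inv ?x = s \<otimes> ?x" unfolding i using r s x by simp
  then show ?thesis unfolding j prod_alt_even[OF r s] prod_alt_even[OF s r] pow_swap[OF r s] by simp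
qed

definition nonneg :: "'a vect \<Rightarrow> bool" where "nonneg f \<longleftrightarrow> (\<forall>x. 0 \<le> coef f x)"

lemma nonneg_add: "nonneg f \<Longrightarrow> nonneg g \<Longrightarrow> nonneg (f + g)"
  and nonneg_scale: "0 \<le> c \<Longrightarrow> nonneg f \<Longrightarrow> nonneg (c *\<^sub>R f)"
  by (auto simp: nonneg_def)

text \<open>With respect to the two simple roots the coordinates are Chebyshev polynomials of the second kind,
  which are written here as sines in order to read off their signs.\<close>
lemma act_alt:
  assumes r: "r \<in> R" and s: "s \<in> R" and ne: "r \<noteq> s"
  defines "t \<equiv> pi / real (m r s)"
  shows "act (list_prod W (alt s r k)) (sin t *\<^sub>R sroot r) =
    (if even k then sin ((real k + 1) * t) *\<^sub>R sroot r + sin (real k * t) *\<^sub>R sroot s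
     else sin (real k * t) *\<^sub>R sroot r + sin ((real k + 1) * t) *\<^sub>R sroot s)"
proof (induction k)
  case (Suc k)
  note a = angle[OF r s ne m_pos[OF r s], folded t_def]
  have c: "sin ((real (Suc k) + 1) * t) = 2 * cos t * sin ((real k + 1) * t) - sin (real k * t)"
    using sin_chebyshev[of t "real k + 1"] by (simp add: algebra_simps)
  then have c': "2 * cos t * sin ((real k + 1) * t) - sin (real k * t) = sin ((2 + real k) * t)"
    by (simp add: add.commute)
  have k1: "real (Suc k) = real k + 1" by simp
  have "act (list_prod W (alt s r (Suc k))) (sin t *\<^sub>R sroot r) =
      srefl (if even k then s else r) (act (list_prod W (alt s r k)) (sin t *\<^sub>R sroot r))"
    unfolding alt_Cons using r s alt_R[OF r s] by (simp add: act_mult act_R)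
  also have "\<dots> = (if even (Suc k) then sin ((real (Suc k) + 1) * t) *\<^sub>R sroot r + sin (real (Suc k) * t) *\<^sub>R sroot s
     else sin (real (Suc k) * t) *\<^sub>R sroot r + sin ((real (Suc k) + 1) * t) *\<^sub>R sroot s)"
    unfolding Suc c k1 by (cases "even k") (simp_all add: plane_step[OF r s a(4)] c')
  finally show ?case .
qed simp

text \<open>The key fact about Coxeter groups. Following Deodhar, g is factored as v h with h in the
  dihedral group of r and a descent s of g, the lengths adding up and v as short as possible; then
  both vr and vs are not shorter than v, so v is handled by induction and h by an explicit
  computation in the plane.\<close>
theorem length_positivity:
  assumes "r \<in> R" "g \<in> carrier W" "len g \<le> len (g \<otimes> r)"
  shows "nonneg (act g (sroot r))"
  using assms
proof (induction "len g" arbitrary: g r rule: less_induct)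
  case less
  note r = less.prems(1) and g = less.prems(2) and up = less.prems(3)
  show ?case
  proof (cases "g = \<one>")
    case True
    then show ?thesis by (simp add: nonneg_def sroot_def)
  next
    case False
    obtain s where s: "s \<in> R" "len g = Suc (len (g \<otimes> s))" using ex_descent[OF g False] by auto
    have rs: "r \<noteq> s" using s up by auto
    define P where "P v ys \<longleftrightarrow> v \<in> carrier W \<and> set ys \<subseteq> {r, s} \<and> g = v \<otimes> list_prod W ys \<and>
      len v + length ys = len g" for v ys
    have "P (g \<otimes> s) [s]" unfolding P_def using g s by simp
    then obtain v ys where P: "P v ys" and least: "\<And>v' ys'. P v' ys' \<Longrightarrow> len v \<le> len v'"
      using ex_has_least_nat[of "\<lambda>(v, ys). P v ys" "(g \<otimes> s, [s])" "\<lambda>(v, ys). len v"] by auto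
    have v: "v \<in> carrier W" "set ys \<subseteq> {r, s}" "g = v \<otimes> list_prod W ys" "len v + length ys = len g"
      using P by (auto simp: P_def)
    have ysR: "set ys \<subseteq> R" using v r s by auto
    have vlt: "len v < len g" using least[OF \<open>P (g \<otimes> s) [s]\<close>] s by simp
    have up_v: "len v \<le> len (v \<otimes> x)" if x: "x \<in> {r, s}" for x
    proof (rule ccontr)
      assume n: "\<not> ?thesis"
      have xR: "x \<in> R" using x r s by auto
      have e: "g = (v \<otimes> x) \<otimes> list_prod W (x # ys)" using v xR ysR by (simp add: m_assoc)
      have "len g \<le> len (v \<otimes> x) + len (list_prod W (x # ys))"
        by (subst e, rule len_mult) (use v xR ysR in auto)
      also have "len (list_prod W (x # ys)) \<le> length (x # ys)" by (rule len_le) (use xR ysR in auto)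
      finally have "P (v \<otimes> x) (x # ys)" unfolding P_def using v x xR e n by auto
      then show False using least n by fastforce
    qed
    have shorter: "length ys \<le> length zs" if "set zs \<subseteq> R" "list_prod W zs = list_prod W ys" for zs
    proof -
      have "len (v \<otimes> list_prod W zs) \<le> len v + len (list_prod W zs)" using v that ysR by (intro len_mult) auto
      then have "len g \<le> len v + len (list_prod W zs)" using v(3) that(2) by simp
      then show ?thesis using len_le[OF that(1)] v(4) by simp
    qed
    have last_not_r: "list_prod W zs \<otimes> r \<noteq> list_prod W ys" if "set zs \<subseteq> R" "length zs < length ys" for zs
    proof
      assume e: "list_prod W zs \<otimes> r = list_prod W ys"
      have "g \<otimes> r = v \<otimes> list_prod W zs" unfolding v(3) e[symmetric] using v that r by (simp add: m_assoc R_sq)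
      then have "len (g \<otimes> r) \<le> len v + len (list_prod W zs)" using len_mult[of v "list_prod W zs"] v that by simp
      then show False using len_le[OF that(1)] that(2) v(4) up by simp
    qed
    have ys: "ys = alt s r (length ys)"
    proof (rule alternating_eq_alt[OF v(2)])
      show "last ys = s" if "ys \<noteq> []"
      proof (rule ccontr)
        assume "last ys \<noteq> s"
        moreover have "last ys \<in> {r, s}" using v(2) last_in_set[OF that] by blast
        ultimately have "ys = butlast ys @ [r]" using that by (metis append_butlast_last_id insertE singletonD)
        moreover have "set (butlast ys) \<subseteq> R" using ysR by (meson in_set_butlastD subset_iff)
        ultimately have "list_prod W (butlast ys) \<otimes> r = list_prod W ys"
          using r list_R_append[of "butlast ys" "[r]"] by simp
        then show False using last_not_r[of "butlast ys"] \<open>set (butlast ys) \<subseteq> R\<close> that by simp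
      qed
      show "ys \<noteq> as @ x # x # bs" for as x bs
      proof
        assume e: "ys = as @ x # x # bs"
        have "set as \<subseteq> R" "set bs \<subseteq> R" "x \<in> R" using ysR e by auto
        then have "list_prod W (as @ bs) = list_prod W ys" using e by (simp add: list_R_append)
        then show False using shorter[of "as @ bs"] e \<open>set as \<subseteq> R\<close> \<open>set bs \<subseteq> R\<close> by simp
      qed
    qed
    let ?k = "length ys"
    have km: "?k < m r s"
    proof (rule ccontr)
      assume "\<not> ?thesis"
      then obtain n where n: "?k = n + m r s" by (metis add.commute le_Suc_ex not_less)
      obtain pre where pre: "alt s r ?k = pre @ alt s r (m r s)" using alt_suffix n by metis
      have preR: "set pre \<subseteq> R" using ysR ys pre by (metis Un_subset_iff set_append)
      obtain m' where m': "m r s = Suc m'" using m_pos[OF r s(1)] by (cases "m r s") auto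
      have "list_prod W ys = list_prod W pre \<otimes> list_prod W (alt s r (m r s))"
        using preR alt_R[OF r s(1)] by (subst ys) (simp add: pre list_R_append)
      also have "\<dots> = list_prod W pre \<otimes> list_prod W (alt r s (m r s))" using braid[OF r s(1)] by simp
      also have "\<dots> = list_prod W (pre @ alt s r m') \<otimes> r"
        using preR alt_R[OF r s(1)] r by (simp add: m' list_R_append m_assoc)
      finally have "list_prod W (pre @ alt s r m') \<otimes> r = list_prod W ys" by simp
      moreover have "length (pre @ alt s r m') < length ys"
        using arg_cong[OF pre, of length] m' by simp
      ultimately show False using last_not_r[of "pre @ alt s r m'"] preR alt_R[OF r s(1)] by auto
    qed
    define t where "t = pi / real (m r s)"
    note a = angle[OF r s(1) rs m_pos[OF r s(1)], folded t_def]
    have "(real ?k + 1) * t \<le> real (m r s) * t" using km a(1) by (intro mult_right_mono) auto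
    then have kt: "(real ?k + 1) * t \<le> pi" using a(5) by simp
    have "real ?k * t \<le> (real ?k + 1) * t" using a(1) by (intro mult_right_mono) auto
    then have s1: "0 \<le> sin (real ?k * t)" using kt a(1) by (intro sin_ge_zero) (simp, linarith)
    have s2: "0 \<le> sin ((real ?k + 1) * t)" using kt a(1) by (intro sin_ge_zero) auto
    have vr: "nonneg (act v (sroot r))" using less.hyps[OF vlt r v(1)] up_v by simp
    have vs: "nonneg (act v (sroot s))" using less.hyps[OF vlt s(1) v(1)] up_v by simp
    have hR: "list_prod W ys \<in> carrier W" using ysR by simp
    have "act (list_prod W ys) (sin t *\<^sub>R sroot r) =
        (if even ?k then sin ((real ?k + 1) * t) *\<^sub>R sroot r + sin (real ?k * t) *\<^sub>R sroot s
         else sin (real ?k * t) *\<^sub>R sroot r + sin ((real ?k + 1) * t) *\<^sub>R sroot s)"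
      using act_alt[OF r s(1) rs, of ?k, folded t_def] ys by simp
    moreover have "sin t *\<^sub>R act g (sroot r) = act v (act (list_prod W ys) (sin t *\<^sub>R sroot r))"
      using act_mult[OF v(1) hR] v(1,3) hR g by (simp add: act_lin)
    ultimately have "nonneg (sin t *\<^sub>R act g (sroot r))"
      using vr vs s1 s2 v(1) by (auto simp: act_lin intro!: nonneg_add nonneg_scale)
    then show ?thesis using a(3) by (auto simp: nonneg_def zero_le_mult_iff)
  qed
qed

lemma ex_negative:
  assumes "g \<in> carrier W" "g \<noteq> \<one>"
  shows "\<exists>r\<in>R. len (g \<otimes> r) < len g \<and> nonneg (- act g (sroot r))"
proof -
  obtain r where r: "r \<in> R" "len g = Suc (len (g \<otimes> r))" using ex_descent[OF assms] by auto
  have "nonneg (act (g \<otimes> r) (sroot r))" using r assms by (intro length_positivity) auto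
  moreover have "srefl r (sroot r) = - sroot r" using r by (simp add: srefl_def scaleR_2)
  ultimately show ?thesis using r assms by (intro bexI[of _ r]) (auto simp: act_mult act_R act_lin)
qed

lemma faithful: assumes "g \<in> carrier W" "\<And>r. r \<in> R \<Longrightarrow> act g (sroot r) = sroot r" shows "g = \<one>"
proof (rule ccontr)
  assume "g \<noteq> \<one>"
  then obtain r where "r \<in> R" "nonneg (- act g (sroot r))" using ex_negative assms by blast
  then show False using assms(2)[of r] by (auto simp: nonneg_def sroot_def dest: spec[of _ r])
qed

lemma act_eqD: assumes "g \<in> carrier W" "h \<in> carrier W" "\<And>v. v \<in> root_space \<Longrightarrow> act g v = act h v" shows "g = h"
proof -
  have "inv h \<otimes> g = \<one>" using assms by (intro faithful) (auto simp: act_mult sroot_root_space)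
  then show ?thesis using assms by (metis inv_closed inv_equality inv_inv)
qed

section \<open>Stabilisers are parabolic\<close>

definition dominant :: "'a vect \<Rightarrow> bool" where "dominant v \<longleftrightarrow> (\<forall>r\<in>R. 0 \<le> B v (sroot r))"

lemma B_nonneg: assumes "dominant v" "f \<in> root_space" "nonneg f" shows "0 \<le> B v f"
  using assms by (subst root_space_expand[OF assms(2)], unfold B_sum_right, intro sum_nonneg) (auto simp: B_simps dominant_def nonneg_def)

text \<open>If g fixes v and r is a descent of g, then the root g r is negative, so that v has inner product at
  most 0 with it, but also inner product at least 0 with the simple root r. Both products agree, and
  r fixes v; now g r is shorter.\<close>
lemma dominant_stabiliser:
  assumes v: "dominant v" and "g \<in> carrier W" "act g v = v"
  shows "g \<in> generate W {r \<in> R. B v (sroot r) = 0}"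
  using assms(2,3)
proof (induction "len g" arbitrary: g rule: less_induct)
  case less
  show ?case
  proof (cases "g = \<one>")
    case True
    then show ?thesis by (simp add: generate.one)
  next
    case False
    then obtain r where r: "r \<in> R" "len (g \<otimes> r) < len g" "nonneg (- act g (sroot r))"
      using ex_negative less.prems by blast
    have "0 \<le> B v (- act g (sroot r))"
      using r less.prems by (intro B_nonneg[OF v]) (auto intro!: subspace_neg[OF subspace_root_space] act_root_space sroot_root_space)
    also have "B v (- act g (sroot r)) = - B (act g v) (act g (sroot r))" using less.prems by (simp add: B_simps)
    also have "\<dots> = - B v (sroot r)" using less.prems(1) by simp
    finally have 0: "B v (sroot r) = 0" using v r by (auto simp: dominant_def)
    have "g \<otimes> r \<in> generate W {r \<in> R. B v (sroot r) = 0}"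
    proof (rule less.hyps[OF r(2)])
      show "g \<otimes> r \<in> carrier W" using less.prems(1) r(1) by simp
      show "act (g \<otimes> r) v = v" using less.prems r(1) 0 by (simp add: act_mult act_R srefl_def)
    qed
    moreover have "r \<in> generate W {r \<in> R. B v (sroot r) = 0}" using r 0 by (intro generate.incl) auto
    ultimately have "(g \<otimes> r) \<otimes> r \<in> generate W {r \<in> R. B v (sroot r) = 0}" by (rule generate.eng)
    then show ?thesis using less.prems r by simp
  qed
qed

text \<open>Inner products with linearly independent vectors can be prescribed. As in the Gram-Schmidt process,
  the next vector is replaced by its component orthogonal to the previous ones.\<close>
lemma dual_vector:
  assumes "finite S" "independent S" "S \<subseteq> root_space"
  shows "\<exists>v\<in>span S. \<forall>s\<in>S. B v s = c s"
  using assms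
proof (induction S arbitrary: c rule: finite_induct)
  case empty
  show ?case by (intro bexI[of _ 0]) auto
next
  case (insert u S)
  have ind: "independent S" "u \<notin> span S" using insert.prems insert.hyps by (auto simp: independent_insert)
  have S: "S \<subseteq> root_space" "u \<in> root_space" using insert.prems by auto
  obtain p where p: "p \<in> span S" "\<And>s. s \<in> S \<Longrightarrow> B p s = B u s" using insert.IH[OF ind(1) S(1), of "B u"] by blast
  obtain v where v: "v \<in> span S" "\<And>s. s \<in> S \<Longrightarrow> B v s = c s" using insert.IH[OF ind(1) S(1), of c] by blast
  define q where "q = u - p"
  have qS: "B q s = 0" if "s \<in> S" for s using p that by (simp add: q_def B_simps)
  have spV: "span S \<subseteq> root_space" using S(1) subspace_root_space by (rule span_minimal)
  have q0: "q \<noteq> 0" using p(1) ind(2) by (auto simp: q_def)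
  have "q \<in> root_space" unfolding q_def using S p spV by (intro subspace_diff[OF subspace_root_space]) auto
  then have qq: "B q q > 0" using q0 by (rule B_pos)
  have "B q x = 0" if "x \<in> span S" for x using that
    by (induction rule: span_induct_alt) (auto simp: B_simps qS)
  then have "B q p = 0" using p by blast
  then have qu: "B q u = B q q" by (simp add: q_def B_simps)
  define k where "k = (c u - B v u) / B q u"
  have "B (v + k *\<^sub>R q) s = c s" if "s \<in> insert u S" for s
    using that v qS qq qu by (auto simp: B_simps k_def)
  moreover have "v + k *\<^sub>R q \<in> span (insert u S)"
  proof -
    have "span S \<subseteq> span (insert u S)" by (rule span_mono) auto
    then have "v \<in> span (insert u S)" "p \<in> span (insert u S)" using v p by auto
    moreover have "u \<in> span (insert u S)" by (rule span_base) simp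
    ultimately show ?thesis unfolding q_def by (intro span_add span_scale span_diff)
  qed
  ultimately show ?case by blast
qed

lemma inj_sroot: "inj_on sroot R" by (auto simp: inj_on_def sroot_def fun_eq_iff split: if_splits)

lemma independent_sroot: "independent (sroot ` R)"
proof (rule independent_if_scalars_zero)
  fix f x assume 0: "(\<Sum>x\<in>sroot ` R. f x *\<^sub>R x) = 0" and "x \<in> sroot ` R"
  then obtain r where r: "r \<in> R" "x = sroot r" by auto
  have "(\<Sum>r\<in>R. f (sroot r) *\<^sub>R sroot r) = 0" using 0 by (simp add: sum.reindex[OF inj_sroot])
  then have "coef (\<Sum>r\<in>R. f (sroot r) *\<^sub>R sroot r) r = 0" by simp
  then show "f x = 0" using r by (simp add: coef_sum sroot_def if_distrib sum.delta cong: if_cong)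
qed simp

lemma prescribed_simple: "\<exists>v\<in>root_space. \<forall>r\<in>R. B v (sroot r) = c r"
proof -
  have "sroot ` R \<subseteq> root_space" using sroot_root_space by auto
  then obtain v where v: "v \<in> span (sroot ` R)" "\<forall>s\<in>sroot ` R. B v s = c (the_inv_into R sroot s)"
    using dual_vector[of "sroot ` R" "\<lambda>s. c (the_inv_into R sroot s)"] independent_sroot by auto
  moreover have "span (sroot ` R) \<subseteq> root_space" using \<open>sroot ` R \<subseteq> root_space\<close> subspace_root_space by (rule span_minimal)
  ultimately show ?thesis by (intro bexI[of _ v]) (auto simp: the_inv_into_f_f[OF inj_sroot])
qed

text \<open>In the orbit of v, take the vector with the largest inner product with an interior vector p of the
  fundamental chamber. A simple reflection at a wall that separates it from p would increase it.\<close>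
lemma ex_dominant: "\<exists>g\<in>carrier W. dominant (act g v)"
proof -
  obtain p where p: "p \<in> root_space" "\<And>r. r \<in> R \<Longrightarrow> B p (sroot r) = 1" using prescribed_simple[of "\<lambda>_. 1"] by auto
  obtain g where g: "g \<in> carrier W" and max: "\<And>h. h \<in> carrier W \<Longrightarrow> B (act h v) p \<le> B (act g v) p"
  proof -
    let ?M = "(\<lambda>g. B (act g v) p) ` carrier W"
    have "Max ?M \<in> ?M" using finW one_closed by (intro Max_in) auto
    then obtain g where "g \<in> carrier W" "B (act g v) p = Max ?M" by auto
    then show ?thesis using that finW by simp
  qed
  have "0 \<le> B (act g v) (sroot r)" if "r \<in> R" for r
    using max[of "r \<otimes> g"] that g p(2)[OF that] by (simp add: act_mult act_R srefl_def B_simps B_sym[of "sroot r" p])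
  then show ?thesis using g by (auto simp: dominant_def)
qed

lemma inv_cancel: "g \<in> carrier W \<Longrightarrow> h \<in> carrier W \<Longrightarrow> inv g \<otimes> (g \<otimes> h) = h"
  "g \<in> carrier W \<Longrightarrow> h \<in> carrier W \<Longrightarrow> g \<otimes> (inv g \<otimes> h) = h"
  by (simp_all flip: m_assoc)

definition fixator :: "'a vect set \<Rightarrow> 'a set" where
  "fixator U = {g \<in> carrier W. \<forall>u\<in>U. act g u = u}"

lemma fixator_generate:
  assumes "I \<subseteq> R" "\<And>r. r \<in> I \<Longrightarrow> B v (sroot r) = 0" "h \<in> generate W I"
  shows "act h v = v" "h \<in> carrier W"
proof -
  have "h \<in> carrier W \<and> act h v = v" using assms(3)
  proof induction
    case (incl r)
    then show ?case using assms(1,2) by (auto simp: act_R srefl_def)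
  next
    case (inv r)
    then have "r \<in> R" using assms(1) by auto
    then show ?case using assms(2)[OF inv] by (auto simp: R_inv act_R srefl_def)
  qed (auto simp: act_mult)
  then show "act h v = v" "h \<in> carrier W" by auto
qed

text \<open>Every orbit contains a dominant vector, and the stabiliser of a dominant vector is generated by
  simple reflections.\<close>
lemma stabiliser_parabolic: "parabolic_subgroup W R (fixator {v})"
proof -
  obtain g where g: "g \<in> carrier W" "dominant (act g v)" using ex_dominant by blast
  let ?I = "{r \<in> R. B (act g v) (sroot r) = 0}"
  have "fixator {v} = (\<lambda>h. inv g \<otimes> h \<otimes> g) ` generate W ?I"
  proof (intro equalityI subsetI)
    fix h assume "h \<in> fixator {v}"
    then have h: "h \<in> carrier W" "act h v = v" by (auto simp: fixator_def)
    have "g \<otimes> h \<otimes> inv g \<in> generate W ?I"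
      using h g by (intro dominant_stabiliser) (simp_all add: act_mult)
    moreover have "h = inv g \<otimes> (g \<otimes> h \<otimes> inv g) \<otimes> g" using g(1) h(1) by (simp add: m_assoc inv_cancel)
    ultimately show "h \<in> (\<lambda>h. inv g \<otimes> h \<otimes> g) ` generate W ?I" by blast
  next
    fix h assume "h \<in> (\<lambda>h. inv g \<otimes> h \<otimes> g) ` generate W ?I"
    then obtain k where k: "k \<in> generate W ?I" "h = inv g \<otimes> k \<otimes> g" by auto
    have z: "B (act g v) (sroot r) = 0" if "r \<in> ?I" for r using that by simp
    have sub: "?I \<subseteq> R" by auto
    have kv: "act k (act g v) = act g v" by (rule fixator_generate(1)[OF sub _ k(1)]) (erule z)
    have kW: "k \<in> carrier W" by (rule fixator_generate(2)[OF sub _ k(1)]) (erule z)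
    have "act h v = act (inv g) (act k (act g v))" unfolding k(2) using g(1) kW by (simp only: act_mult m_closed inv_closed)
    then have "act h v = v" unfolding kv using g(1) by simp
    moreover have "h \<in> carrier W" unfolding k(2) using g(1) kW by simp
    ultimately show "h \<in> fixator {v}" by (simp add: fixator_def)
  qed
  moreover have "?I \<subseteq> R" by auto
  ultimately show ?thesis unfolding parabolic_subgroup_def using g(1)
    by (intro exI[of _ ?I] exI[of _ g] conjI)
qed

text \<open>The fixator of a subspace is the stabiliser of a generic point of it: if u has the smallest
  stabiliser but some h in it moves u', then a small multiple of u' can be added to u so as to
  decrease the stabiliser.\<close>
lemma fixator_parabolic:
  assumes U: "subspace U"
  shows "parabolic_subgroup W R (fixator U)"
proof -
  have "0 \<in> U" using U by (rule subspace_0)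
  then obtain u where u: "u \<in> U" and least: "\<And>u'. u' \<in> U \<Longrightarrow> card (fixator {u}) \<le> card (fixator {u'})"
    using ex_has_least_nat[of "\<lambda>u. u \<in> U" 0 "\<lambda>u. card (fixator {u})"] by blast
  have fin: "finite (fixator A)" for A using finW by (simp add: fixator_def)
  have "act h u' = u'" if h: "h \<in> fixator {u}" and u': "u' \<in> U" for h u'
  proof (rule ccontr)
    assume ne: "act h u' \<noteq> u'"
    define bad where "bad g = {e. act g (u + e *\<^sub>R u') = u + e *\<^sub>R u' \<and> \<not> (act g u = u \<and> act g u' = u')}" for g
    have "finite (bad g)" if g: "g \<in> carrier W" for g
    proof (rule ccontr)
      assume inf: "infinite (bad g)"
      then obtain a where a: "a \<in> bad g" by (metis finite.emptyI equals0I)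
      obtain b where b: "b \<in> bad g" "b \<noteq> a" using inf by (metis finite.emptyI finite_insert infinite_imp_nonempty insert_absorb2 subset_singleton_iff finite_subset subsetI singletonI singletonD)
      have 1: "act g u - u + a *\<^sub>R (act g u' - u') = 0" "act g u - u + b *\<^sub>R (act g u' - u') = 0"
        using a b g by (auto simp: bad_def act_lin algebra_simps)
      then have "a *\<^sub>R (act g u' - u') = b *\<^sub>R (act g u' - u')" by (metis add_left_cancel)
      then have "act g u' = u'" using b by simp
      moreover have "act g u = u" using 1 calculation by simp
      ultimately show False using a by (auto simp: bad_def)
    qed
    then have "finite (\<Union>g\<in>carrier W. bad g)" using finW by simp
    then obtain e :: real where e: "e \<notin> (\<Union>g\<in>carrier W. bad g)"
      using ex_new_if_finite infinite_UNIV_char_0 by blast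
    have "fixator {u + e *\<^sub>R u'} \<subseteq> fixator {u} - {h}"
      using e ne by (auto simp: fixator_def bad_def)
    then have "card (fixator {u + e *\<^sub>R u'}) \<le> card (fixator {u} - {h})" using fin by (intro card_mono) auto
    also have "\<dots> < card (fixator {u})" using h fin by (intro card_Diff1_less) auto
    finally show False using least[of "u + e *\<^sub>R u'"] u u' U by (simp add: subspace_add subspace_scale)
  qed
  then have "fixator U = fixator {u}" using u by (auto simp: fixator_def)
  then show ?thesis using stabiliser_parabolic by simp
qed

definition fixed :: "'a set \<Rightarrow> 'a vect set" where
  "fixed H = {v \<in> root_space. \<forall>h\<in>H. act h v = v}"

text \<open>A standard parabolic subgroup is the stabiliser of a vector in the relative interior of a face of
  the fundamental chamber, and this vector is fixed by the subgroup.\<close>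
lemma parabolic_eq_fixator:
  assumes "parabolic_subgroup W R P" shows "P = fixator (fixed P)" "P \<subseteq> carrier W"
proof -
  obtain I g where I: "I \<subseteq> R" and g: "g \<in> carrier W" and P: "P = (\<lambda>h. inv g \<otimes> h \<otimes> g) ` generate W I"
    using assms by (auto simp: parabolic_subgroup_def)
  obtain l where l: "l \<in> root_space" "\<And>r. r \<in> R \<Longrightarrow> B l (sroot r) = (if r \<in> I then 0 else 1)"
    using prescribed_simple[of "\<lambda>r. if r \<in> I then 0 else 1"] by auto
  have l0: "B l (sroot r) = 0" if "r \<in> I" for r using l(2)[of r] I that by auto
  have fx: "act h l = l" "h \<in> carrier W" if "h \<in> generate W I" for h
    using fixator_generate[OF I l0 that] by auto
  show sub: "P \<subseteq> carrier W" using fx g by (auto simp: P)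
  have "act (inv g) l \<in> fixed P" using fx g l by (auto simp: fixed_def P act_mult intro!: act_root_space)
  moreover have "h \<in> P" if h: "h \<in> carrier W" "act h (act (inv g) l) = act (inv g) l" for h
  proof -
    have "act (g \<otimes> h \<otimes> inv g) l = l" using g h by (simp add: act_mult)
    then have "g \<otimes> h \<otimes> inv g \<in> generate W {r \<in> R. B l (sroot r) = 0}"
      using g h l by (intro dominant_stabiliser) (auto simp: dominant_def)
    also have "{r \<in> R. B l (sroot r) = 0} = I" using l I by (auto split: if_splits)
    finally have "inv g \<otimes> (g \<otimes> h \<otimes> inv g) \<otimes> g \<in> P" unfolding P by blast
    then show "h \<in> P" using g h by (simp add: m_assoc inv_cancel)
  qed
  ultimately show "P = fixator (fixed P)" using sub by (auto simp: fixator_def fixed_def)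
qed

end

section \<open>Reflections and their roots\<close>

context finite_coxeter
begin

definition roots :: "'a vect set" where
  "roots = {act g (sroot r) | g r. g \<in> carrier W \<and> r \<in> R}"

text \<open>The group element acting as the reflection in a root; there is only one, since the action is
  faithful.\<close>
definition reflection :: "'a vect \<Rightarrow> 'a" where
  "reflection \<alpha> = (SOME t. t \<in> carrier W \<and> (\<forall>v. act t v = v - B v \<alpha> *\<^sub>R \<alpha>))"

lemma rootsE: assumes "\<alpha> \<in> roots" obtains g r where "g \<in> carrier W" "r \<in> R" "\<alpha> = act g (sroot r)"
  using assms by (auto simp: roots_def)

lemma roots_root_space: "\<alpha> \<in> roots \<Longrightarrow> \<alpha> \<in> root_space"
  by (auto simp: roots_def intro!: act_root_space sroot_root_space)

lemma root_norm [simp]: "\<alpha> \<in> roots \<Longrightarrow> B \<alpha> \<alpha> = 2"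
  by (auto simp: roots_def)

lemma root_nz: "\<alpha> \<in> roots \<Longrightarrow> \<alpha> \<noteq> 0"
proof
  assume "\<alpha> \<in> roots" "\<alpha> = 0"
  then show False by (metis B_0_left root_norm zero_neq_numeral)
qed

lemma act_roots: "g \<in> carrier W \<Longrightarrow> \<alpha> \<in> roots \<Longrightarrow> act g \<alpha> \<in> roots"
  by (elim rootsE) (auto simp: roots_def act_mult[symmetric])

lemma sroot_roots: "r \<in> R \<Longrightarrow> sroot r \<in> roots"
proof -
  assume "r \<in> R"
  then have "act \<one> (sroot r) \<in> roots" unfolding roots_def using one_closed by blast
  then show ?thesis by simp
qed

lemma finite_roots: "finite roots"
proof -
  have "roots = (\<lambda>(g, r). act g (sroot r)) ` (carrier W \<times> R)" by (auto simp: roots_def)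
  then show ?thesis using finW by simp
qed

lemma conj_act:
  assumes "g \<in> carrier W" "r \<in> R"
  shows "act (g \<otimes> r \<otimes> inv g) v = v - B v (act g (sroot r)) *\<^sub>R act g (sroot r)"
proof -
  have "act (g \<otimes> r \<otimes> inv g) v = act g (srefl r (act (inv g) v))" using assms by (simp add: act_mult act_R)
  also have "\<dots> = v - B (act (inv g) v) (sroot r) *\<^sub>R act g (sroot r)" using assms by (simp add: srefl_def act_lin)
  also have "B (act (inv g) v) (sroot r) = B v (act g (sroot r))" using assms by (simp add: B_act_inv)
  finally show ?thesis .
qed

lemma reflection_props: assumes "\<alpha> \<in> roots"
  shows refl_closed [simp]: "reflection \<alpha> \<in> carrier W"
    and act_refl: "act (reflection \<alpha>) v = v - B v \<alpha> *\<^sub>R \<alpha>"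
proof -
  obtain g r where "g \<in> carrier W" "r \<in> R" "\<alpha> = act g (sroot r)" using assms by (rule rootsE)
  then have "\<exists>t. t \<in> carrier W \<and> (\<forall>v. act t v = v - B v \<alpha> *\<^sub>R \<alpha>)"
    using conj_act by (intro exI[of _ "g \<otimes> r \<otimes> inv g"]) auto
  then have "reflection \<alpha> \<in> carrier W \<and> (\<forall>v. act (reflection \<alpha>) v = v - B v \<alpha> *\<^sub>R \<alpha>)"
    unfolding reflection_def by (rule someI_ex)
  then show "reflection \<alpha> \<in> carrier W" "act (reflection \<alpha>) v = v - B v \<alpha> *\<^sub>R \<alpha>" by auto
qed

lemma refl_eqI:
  assumes "\<alpha> \<in> roots" "t \<in> carrier W" "\<And>v. v \<in> root_space \<Longrightarrow> act t v = v - B v \<alpha> *\<^sub>R \<alpha>"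
  shows "t = reflection \<alpha>"
  using assms by (intro act_eqD) (auto simp: act_refl)

lemma refl_sroot: "r \<in> R \<Longrightarrow> reflection (sroot r) = r"
  by (rule refl_eqI[symmetric]) (auto simp: sroot_roots act_R srefl_def)

lemma refl_sq: "\<alpha> \<in> roots \<Longrightarrow> reflection \<alpha> \<otimes> reflection \<alpha> = \<one>"
  by (intro act_eqD) (auto simp: act_mult act_refl B_simps algebra_simps scaleR_diff_left)

lemma refl_inv: "\<alpha> \<in> roots \<Longrightarrow> inv (reflection \<alpha>) = reflection \<alpha>"
  by (simp add: inv_equality refl_sq)

lemma refl_root: "\<alpha> \<in> roots \<Longrightarrow> \<beta> \<in> roots \<Longrightarrow> \<beta> - B \<beta> \<alpha> *\<^sub>R \<alpha> \<in> roots"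
  using act_roots[of "reflection \<alpha>" \<beta>] by (simp add: act_refl)

lemma minus_root: "\<alpha> \<in> roots \<Longrightarrow> - \<alpha> \<in> roots"
  using refl_root[of \<alpha> \<alpha>] by (simp add: scaleR_2)

lemma refl_minus: "\<alpha> \<in> roots \<Longrightarrow> reflection (- \<alpha>) = reflection \<alpha>"
  by (rule refl_eqI) (auto simp: minus_root act_refl B_simps)

lemma refl_conj: assumes "g \<in> carrier W" "\<alpha> \<in> roots" shows "reflection (act g \<alpha>) = g \<otimes> reflection \<alpha> \<otimes> inv g"
  using assms by (intro refl_eqI[symmetric])
    (auto simp: act_roots act_mult act_refl act_lin B_act_inv[symmetric] B_act_inv)

lemma parallel_roots: assumes "\<alpha> \<in> roots" "\<beta> \<in> roots" "\<alpha> = c *\<^sub>R \<beta>" shows "reflection \<alpha> = reflection \<beta>"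
proof -
  have "2 = B (c *\<^sub>R \<beta>) (c *\<^sub>R \<beta>)" using assms root_norm by metis
  also have "\<dots> = c * c * 2" using assms by (simp add: B_simps)
  finally have "(c - 1) * (c + 1) = 0" by (simp add: algebra_simps)
  then have "c = 1 \<or> c = -1" by auto
  then show ?thesis using assms refl_minus by auto
qed

lemma reflections_eq: "reflections W R = reflection ` roots"
proof (intro equalityI subsetI)
  fix t assume "t \<in> reflections W R"
  then obtain g r where t: "g \<in> carrier W" "r \<in> R" "t = inv g \<otimes> r \<otimes> g" by (auto simp: reflections_def)
  then have "t = reflection (act (inv g) (sroot r))" by (simp add: refl_conj sroot_roots refl_sroot)
  then show "t \<in> reflection ` roots" using t by (auto intro!: imageI act_roots sroot_roots)
next
  fix t assume "t \<in> reflection ` roots"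
  then obtain g r where t: "g \<in> carrier W" "r \<in> R" "t = reflection (act g (sroot r))" by (auto elim: rootsE)
  then have "t = inv (inv g) \<otimes> r \<otimes> inv g" by (simp add: refl_conj sroot_roots refl_sroot)
  then show "t \<in> reflections W R" using t unfolding reflections_def by (intro UN_I[of "inv g"]) auto
qed

definition rprod :: "'a vect list \<Rightarrow> 'a" where "rprod \<gamma>s = list_prod W (map reflection \<gamma>s)"

lemma rprod_simps [simp]: "rprod [] = \<one>" "rprod (\<gamma> # \<gamma>s) = reflection \<gamma> \<otimes> rprod \<gamma>s"
  by (simp_all add: rprod_def)

lemma rprod_closed [simp]: "set \<gamma>s \<subseteq> roots \<Longrightarrow> rprod \<gamma>s \<in> carrier W"
  by (induction \<gamma>s) auto

lemma rprod_append: "set \<gamma>s \<subseteq> roots \<Longrightarrow> set \<delta>s \<subseteq> roots \<Longrightarrow> rprod (\<gamma>s @ \<delta>s) = rprod \<gamma>s \<otimes> rprod \<delta>s"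
  by (induction \<gamma>s) (auto simp: m_assoc)

lemma rprod_generate: "set \<gamma>s \<subseteq> S \<Longrightarrow> rprod \<gamma>s \<in> generate W (reflection ` S)"
  unfolding rprod_def by (rule list_prod_in_generate) auto

lemma generate_rprod:
  assumes "S \<subseteq> roots" "g \<in> generate W (reflection ` S)"
  shows "\<exists>\<gamma>s. set \<gamma>s \<subseteq> S \<and> rprod \<gamma>s = g"
  using assms(2)
proof induction
  case one
  show ?case by (intro exI[of _ "[]"]) auto
next
  case (incl t)
  then obtain \<alpha> where "\<alpha> \<in> S" "t = reflection \<alpha>" by auto
  then show ?case using assms(1) by (intro exI[of _ "[\<alpha>]"]) auto
next
  case (inv t)
  then obtain \<alpha> where "\<alpha> \<in> S" "t = reflection \<alpha>" by auto
  then show ?case using assms(1) by (intro exI[of _ "[\<alpha>]"]) (auto simp: refl_inv subset_iff)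
next
  case (eng g h)
  then obtain \<gamma>s \<delta>s where "set \<gamma>s \<subseteq> S" "rprod \<gamma>s = g" "set \<delta>s \<subseteq> S" "rprod \<delta>s = h" by auto
  then show ?case using assms(1) by (intro exI[of _ "\<gamma>s @ \<delta>s"]) (auto simp: rprod_append)
qed

lemma rprod_moves:
  assumes "set \<gamma>s \<subseteq> roots" shows "v - act (rprod \<gamma>s) v \<in> span (set \<gamma>s)"
  using assms
proof (induction \<gamma>s)
  case (Cons \<gamma> \<gamma>s)
  let ?u = "act (rprod \<gamma>s) v"
  have e: "v - act (rprod (\<gamma> # \<gamma>s)) v = (v - ?u) + B ?u \<gamma> *\<^sub>R \<gamma>"
    using Cons.prems by (simp add: act_mult act_refl)
  have "v - ?u \<in> span (set (\<gamma> # \<gamma>s))" using Cons span_mono[of "set \<gamma>s" "set (\<gamma> # \<gamma>s)"] by auto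
  then show ?case unfolding e by (intro span_add span_scale) (auto intro: span_base)
qed (simp add: span_0)

lemma rprod_fixes:
  assumes "set \<gamma>s \<subseteq> roots" "\<And>\<gamma>. \<gamma> \<in> set \<gamma>s \<Longrightarrow> B v \<gamma> = 0" shows "act (rprod \<gamma>s) v = v"
  using assms by (induction \<gamma>s) (auto simp: act_mult act_refl)

definition lin_indep :: "'a vect list \<Rightarrow> bool" where
  "lin_indep \<gamma>s \<longleftrightarrow> distinct \<gamma>s \<and> independent (set \<gamma>s)"

lemma lin_indep_Cons: "lin_indep (\<gamma> # \<gamma>s) \<longleftrightarrow> \<gamma> \<notin> span (set \<gamma>s) \<and> lin_indep \<gamma>s"
  unfolding lin_indep_def using span_base[of \<gamma> "set \<gamma>s"] by (auto simp: independent_insert)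

lemma lin_indep_Nil [simp]: "lin_indep []" by (simp add: lin_indep_def independent_empty)

lemma span_orth: assumes "\<And>s. s \<in> S \<Longrightarrow> B v s = 0" "x \<in> span S" shows "B v x = 0"
  using assms(2) by (induction rule: span_induct_alt) (auto simp: B_simps assms(1))

text \<open>Comparing v with its image under all factors but the first shows that this image differs from v by
  a multiple of the first root and by a combination of the others; independence makes both vanish.\<close>
lemma rprod_fixed_orth:
  assumes "set \<gamma>s \<subseteq> roots" "lin_indep \<gamma>s" "act (rprod \<gamma>s) v = v" "\<gamma> \<in> set \<gamma>s" shows "B v \<gamma> = 0"
  using assms
proof (induction \<gamma>s arbitrary: \<gamma>)
  case (Cons \<delta> \<gamma>s)
  let ?u = "act (rprod \<gamma>s) v"
  have v: "v = ?u - B ?u \<delta> *\<^sub>R \<delta>" using Cons.prems by (simp add: act_mult act_refl)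
  have "v - ?u \<in> span (set \<gamma>s)" using Cons.prems by (intro rprod_moves) auto
  then have "B ?u \<delta> *\<^sub>R \<delta> \<in> span (set \<gamma>s)" using v by (metis (no_types, lifting) diff_add_cancel diff_diff_eq2 minus_diff_eq span_neg add_diff_cancel_left' cancel_ab_semigroup_add_class.diff_right_commute diff_self diff_0)
  then have 0: "B ?u \<delta> = 0"
    using Cons.prems(2) span_scale[of "B ?u \<delta> *\<^sub>R \<delta>" "set \<gamma>s" "1 / B ?u \<delta>"]
    by (auto simp: lin_indep_Cons split: if_splits)
  then have u: "?u = v" using v by simp
  then show ?case using Cons 0 by (auto simp: lin_indep_Cons)
qed simp

text \<open>Solving (1 - w) a = xi for a product w of reflections in linearly independent roots. The
  equations for the inner products of a with the roots are triangular; hence they can be solved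
  inside any set Z closed under addition.\<close>
lemma rprod_solve:
  assumes "set \<gamma>s \<subseteq> roots" "lin_indep \<gamma>s"
    and Z: "0 \<in> Z" "\<And>x y. x \<in> Z \<Longrightarrow> y \<in> Z \<Longrightarrow> x + y \<in> Z"
    and c: "\<And>\<gamma>. \<gamma> \<in> set \<gamma>s \<Longrightarrow> c \<gamma> \<in> Z"
    and cB: "\<And>\<gamma> \<delta>. \<gamma> \<in> set \<gamma>s \<Longrightarrow> \<delta> \<in> set \<gamma>s \<Longrightarrow> c \<gamma> * B \<gamma> \<delta> \<in> Z"
  shows "\<exists>a\<in>root_space. a - act (rprod \<gamma>s) a = (\<Sum>\<gamma>\<in>set \<gamma>s. c \<gamma> *\<^sub>R \<gamma>) \<and> (\<forall>\<gamma>\<in>set \<gamma>s. B a \<gamma> \<in> Z)"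
  using assms(1,2) c cB
proof (induction \<gamma>s)
  case Nil
  show ?case by (intro bexI[of _ 0]) (auto simp: subspace_0[OF subspace_root_space])
next
  case (Cons \<gamma> \<gamma>s)
  have \<gamma>: "\<gamma> \<in> roots" "set \<gamma>s \<subseteq> roots" "lin_indep \<gamma>s" "\<gamma> \<notin> set \<gamma>s"
    using Cons.prems(1,2) span_base[of \<gamma> "set \<gamma>s"] by (auto simp: lin_indep_Cons)
  let ?\<xi> = "\<Sum>\<delta>\<in>set \<gamma>s. c \<delta> *\<^sub>R \<delta>" and ?w = "rprod \<gamma>s"
  obtain a where a: "a \<in> root_space" "a - act ?w a = ?\<xi>" "\<And>\<delta>. \<delta> \<in> set \<gamma>s \<Longrightarrow> B a \<delta> \<in> Z"
    using Cons.IH[OF \<gamma>(2,3)] Cons.prems(3,4) by auto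
  have "set (\<gamma> # \<gamma>s) \<subseteq> root_space" using Cons.prems(1) roots_root_space by auto
  then obtain d where d: "d \<in> span (set (\<gamma> # \<gamma>s))" "\<And>\<delta>. \<delta> \<in> set (\<gamma> # \<gamma>s) \<Longrightarrow> B d \<delta> = (if \<delta> = \<gamma> then 1 else 0)"
    using dual_vector[of "set (\<gamma> # \<gamma>s)" "\<lambda>\<delta>. if \<delta> = \<gamma> then 1 else 0"] Cons.prems(2)
    unfolding lin_indep_def by blast
  have dV: "d \<in> root_space" using d(1) span_minimal[OF \<open>set (\<gamma> # \<gamma>s) \<subseteq> root_space\<close> subspace_root_space] by auto
  have dorth: "B d \<delta> = 0" if "\<delta> \<in> set \<gamma>s" for \<delta> using d(2)[of \<delta>] that \<gamma>(4) by auto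
  have d1: "B d \<gamma> = 1" using d(2)[of \<gamma>] by simp
  have wd: "act ?w d = d" using \<gamma>(2) dorth by (rule rprod_fixes)
  define k where "k = c \<gamma> - B (act ?w a) \<gamma>"
  define b where "b = a + k *\<^sub>R d"
  have wb: "act ?w b = act ?w a + k *\<^sub>R d" using \<gamma>(2) by (simp add: b_def act_lin wd)
  have "b - act (rprod (\<gamma> # \<gamma>s)) b = (b - act ?w b) + B (act ?w b) \<gamma> *\<^sub>R \<gamma>"
    using \<gamma> by (simp add: act_mult act_refl)
  also have "b - act ?w b = ?\<xi>" unfolding wb using a(2) by (simp add: b_def algebra_simps)
  also have "B (act ?w b) \<gamma> = c \<gamma>" unfolding wb by (simp add: B_simps d1 k_def)
  finally have 1: "b - act (rprod (\<gamma> # \<gamma>s)) b = (\<Sum>\<delta>\<in>set (\<gamma> # \<gamma>s). c \<delta> *\<^sub>R \<delta>)"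
    using \<gamma>(4) by (simp add: add.commute)
  have Bb: "B b \<gamma> = c \<gamma> + (\<Sum>\<delta>\<in>set \<gamma>s. c \<delta> * B \<delta> \<gamma>)"
  proof -
    have "act ?w a = a - ?\<xi>" using a(2) by (metis diff_diff_eq2 diff_add_cancel add_diff_cancel_left')
    then have "B (act ?w a) \<gamma> = B a \<gamma> - (\<Sum>\<delta>\<in>set \<gamma>s. c \<delta> * B \<delta> \<gamma>)" by (simp add: B_simps B_sum_left)
    then show ?thesis by (simp add: b_def B_simps d1 k_def)
  qed
  have sumZ: "sum f A \<in> Z" if "\<And>x. x \<in> A \<Longrightarrow> f x \<in> Z" for f :: "'a vect \<Rightarrow> real" and A
    using that by (induction A rule: infinite_finite_induct) (auto intro: Z)
  have "B b \<gamma> \<in> Z" unfolding Bb using Cons.prems(3,4) by (intro Z(2) sumZ) auto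
  moreover have "B b \<delta> \<in> Z" if "\<delta> \<in> set \<gamma>s" for \<delta> using a(3)[OF that] dorth[OF that] by (simp add: b_def B_simps)
  moreover have "b \<in> root_space" unfolding b_def using a(1) dV by (intro subspace_add[OF subspace_root_space] subspace_scale[OF subspace_root_space])
  ultimately show ?case using 1 by (intro bexI[of _ b]) auto
qed

lemma rprod_moves_onto:
  assumes "set \<gamma>s \<subseteq> roots" "lin_indep \<gamma>s" "\<xi> \<in> span (set \<gamma>s)"
  shows "\<exists>a\<in>root_space. a - act (rprod \<gamma>s) a = \<xi>"
proof -
  obtain c where "(\<Sum>\<gamma>\<in>set \<gamma>s. c \<gamma> *\<^sub>R \<gamma>) = \<xi>" using assms(3) by (auto simp: span_finite)
  then show ?thesis using rprod_solve[OF assms(1,2), of UNIV c] by auto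
qed

section \<open>Carter's lemma\<close>

text \<open>For g of finite order the image of 1 - g is the orthogonal complement of the fixed space: the
  average over the powers of g of a vector orthogonal to the fixed space is a fixed vector
  orthogonal to itself, hence zero. Summing the telescoping partial sums gives the preimage.\<close>
lemma orth_fixed_moved:
  assumes g: "g \<in> carrier W" and \<alpha>: "\<alpha> \<in> root_space" and orth: "\<And>u. u \<in> fixed {g} \<Longrightarrow> B u \<alpha> = 0"
  shows "\<exists>a\<in>root_space. a - act g a = \<alpha>"
proof -
  define N where "N = order W"
  have N: "N > 0" using finW one_closed unfolding N_def order_def by (auto simp: card_gt_0_iff)
  define x where "x k = act (g [^] k) \<alpha>" for k :: nat
  have x0: "x 0 = \<alpha>" by (simp add: x_def)
  have xS: "act g (x k) = x (Suc k)" for k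
    unfolding x_def nat_pow_Suc2[OF g] using g by (simp add: act_mult)
  have xN: "x N = \<alpha>" using g finW by (simp add: x_def N_def pow_order_eq_1)
  have xV: "x k \<in> root_space" for k unfolding x_def using g \<alpha> by (intro act_root_space) auto
  define q where "q j = (\<Sum>k<j. x k)" for j
  have qV: "q j \<in> root_space" for j unfolding q_def using xV by (intro subspace_sum[OF subspace_root_space])
  have gq: "act g (q j) = q j + x j - \<alpha>" for j
  proof (induction j)
    case (Suc j)
    have "act g (q (Suc j)) = act g (q j) + x (Suc j)" using g by (simp add: q_def act_lin xS)
    then show ?case unfolding Suc by (simp add: q_def)
  qed (use g in \<open>simp add: q_def act_lin x0\<close>)
  have p: "q N \<in> fixed {g}" using gq[of N] qV by (simp add: fixed_def xN)
  have Bx: "B (q N) (x k) = 0" for k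
  proof -
    have "q N = act (g [^] k) (q N)"
    proof (induction k)
      case (Suc k)
      have "act (g [^] Suc k) (q N) = act g (act (g [^] k) (q N))"
        unfolding nat_pow_Suc2[OF g] using g by (simp add: act_mult)
      then show ?case using Suc p by (simp add: fixed_def)
    qed simp
    then have "B (q N) (x k) = B (act (g [^] k) (q N)) (act (g [^] k) \<alpha>)" by (simp add: x_def)
    also have "\<dots> = B (q N) \<alpha>" using g by (intro B_act) auto
    finally show ?thesis using orth[OF p] by simp
  qed
  have "B (q N) (q N) = (\<Sum>k<N. B (q N) (x k))" by (subst (2) q_def) (rule B_sum_right)
  then have "B (q N) (q N) = 0" by (simp add: Bx)
  then have q0: "q N = 0" using B_pos[OF qV[of N]] by force
  define a where "a = (1 / real N) *\<^sub>R (\<Sum>j<N. q j)"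
  have "(\<Sum>j<N. q j) - act g (\<Sum>j<N. q j) = (\<Sum>j<N. \<alpha> - x j)"
    using g by (simp add: act_lin sum_subtractf[symmetric] gq)
  also have "\<dots> = real N *\<^sub>R \<alpha> - q N" by (simp add: sum_subtractf q_def sum_constant_scaleR)
  finally have s: "(\<Sum>j<N. q j) - act g (\<Sum>j<N. q j) = real N *\<^sub>R \<alpha>" using q0 by simp
  have "a - act g a = (1 / real N) *\<^sub>R ((\<Sum>j<N. q j) - act g (\<Sum>j<N. q j))"
    using g by (simp add: a_def act_lin scaleR_diff_right)
  also have "\<dots> = \<alpha>" unfolding s using N by simp
  finally have "a - act g a = \<alpha>" .
  moreover have "a \<in> root_space" unfolding a_def using qV by (intro subspace_scale[OF subspace_root_space] subspace_sum[OF subspace_root_space])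
  ultimately show ?thesis by blast
qed

lemma subspace_fixed: assumes "H \<subseteq> carrier W" shows "subspace (fixed H)"
proof -
  have "act h (x + y) = act h x + act h y" "act h (c *\<^sub>R x) = c *\<^sub>R act h x" "act h 0 = 0"
    if "h \<in> H" for h x y c
    using that assms by (auto simp: act_lin)
  then show ?thesis using subspace_root_space unfolding subspace_def fixed_def by auto
qed

text \<open>If g is not trivial then the fixator of its fixed space is a non-trivial parabolic subgroup,
  so it contains a reflection; its root lies in the image of 1 - g, and multiplying g by it enlarges
  the fixed space.\<close>
theorem independent_decomposition:
  assumes "g \<in> carrier W" shows "\<exists>\<gamma>s. set \<gamma>s \<subseteq> roots \<and> lin_indep \<gamma>s \<and> rprod \<gamma>s = g"
  using assms
proof (induction "card (fixator (fixed {g}))" arbitrary: g rule: less_induct)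
  case less
  note g = less.prems
  show ?case
  proof (cases "g = \<one>")
    case True
    then show ?thesis by (intro exI[of _ "[]"]) simp
  next
    case False
    let ?U = "fixed {g}"
    have "parabolic_subgroup W R (fixator ?U)" using g by (intro fixator_parabolic subspace_fixed) auto
    then obtain I h where I: "I \<subseteq> R" and h: "h \<in> carrier W"
      and P: "fixator ?U = (\<lambda>k. inv h \<otimes> k \<otimes> h) ` generate W I" by (auto simp: parabolic_subgroup_def)
    have gP: "g \<in> fixator ?U" using g by (auto simp: fixator_def fixed_def)
    have "I \<noteq> {}"
    proof
      assume "I = {}"
      then have "fixator ?U = {\<one>}" using h unfolding P by (auto simp: generate_empty)
      then show False using gP False by auto
    qed
    then obtain r where r: "r \<in> I" by auto
    then have rR: "r \<in> R" using I by auto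
    define \<alpha> where "\<alpha> = act (inv h) (sroot r)"
    have \<alpha>: "\<alpha> \<in> roots" unfolding \<alpha>_def using h rR by (intro act_roots sroot_roots) auto
    have "reflection \<alpha> = inv h \<otimes> r \<otimes> h" unfolding \<alpha>_def using h rR by (simp add: refl_conj sroot_roots refl_sroot)
    then have tP: "reflection \<alpha> \<in> fixator ?U" unfolding P using r by (auto intro: generate.incl)
    have orth: "B u \<alpha> = 0" if "u \<in> ?U" for u
      using tP that \<alpha> root_nz[OF \<alpha>] by (auto simp: fixator_def act_refl)
    obtain a where a: "a \<in> root_space" "a - act g a = \<alpha>"
      using orth_fixed_moved[OF g roots_root_space[OF \<alpha>] orth] by blast
    have ga: "act g a = a - \<alpha>" using a(2) by (metis diff_diff_eq2 diff_add_cancel add_diff_cancel_left')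
    have "B a a = B (a - \<alpha>) (a - \<alpha>)" using B_act[OF g, of a a] ga by simp
    then have a1: "B a \<alpha> = 1" using \<alpha> by (simp add: B_simps B_sym[of \<alpha> a])
    define g' where "g' = reflection \<alpha> \<otimes> g"
    have g': "g' \<in> carrier W" using g \<alpha> by (simp add: g'_def)
    have g'a: "act g' a = a" using g \<alpha> by (simp add: g'_def act_mult act_refl ga B_simps a1 algebra_simps)
    have sub: "?U \<subseteq> fixed {g'}"
      using g \<alpha> orth by (auto simp: fixed_def g'_def act_mult act_refl)
    have "fixator (fixed {g'}) \<subseteq> fixator ?U - {reflection \<alpha>}"
    proof
      fix k assume k: "k \<in> fixator (fixed {g'})"
      have "act k a = a" using k a(1) g'a by (auto simp: fixator_def fixed_def)
      moreover have "act (reflection \<alpha>) a \<noteq> a" using \<alpha> a1 root_nz[OF \<alpha>] by (simp add: act_refl)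
      ultimately show "k \<in> fixator ?U - {reflection \<alpha>}" using k sub by (auto simp: fixator_def)
    qed
    moreover have fin: "finite (fixator ?U)" using finW by (simp add: fixator_def)
    ultimately have "card (fixator (fixed {g'})) \<le> card (fixator ?U - {reflection \<alpha>})" by (intro card_mono) auto
    also have "\<dots> < card (fixator ?U)" using tP fin by (intro card_Diff1_less)
    finally obtain \<gamma>s where \<gamma>s: "set \<gamma>s \<subseteq> roots" "lin_indep \<gamma>s" "rprod \<gamma>s = g'"
      using less.hyps g' by blast
    have "B a \<gamma> = 0" if "\<gamma> \<in> set \<gamma>s" for \<gamma> using rprod_fixed_orth[OF \<gamma>s(1,2) _ that, of a] g'a \<gamma>s(3) by simp
    then have "\<alpha> \<notin> span (set \<gamma>s)" using span_orth[of "set \<gamma>s" a \<alpha>] a1 by auto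
    then have "lin_indep (\<alpha> # \<gamma>s)" using \<gamma>s by (simp add: lin_indep_Cons)
    moreover have "rprod (\<alpha> # \<gamma>s) = g" using \<gamma>s \<alpha> g refl_sq[OF \<alpha>] by (simp add: g'_def m_assoc[symmetric])
    ultimately show ?thesis using \<gamma>s \<alpha> by (intro exI[of _ "\<alpha> # \<gamma>s"]) auto
  qed
qed

abbreviation rlen :: "'a \<Rightarrow> nat" where "rlen \<equiv> refl_length W R"

lemma rprod_span_mono:
  assumes "set \<gamma>s \<subseteq> roots" "lin_indep \<gamma>s" "set \<delta>s \<subseteq> roots" "rprod \<delta>s = rprod \<gamma>s"
  shows "set \<gamma>s \<subseteq> span (set \<delta>s)"
proof
  fix \<gamma> assume "\<gamma> \<in> set \<gamma>s"
  then obtain a where "a - act (rprod \<delta>s) a = \<gamma>"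
    using rprod_moves_onto[OF assms(1,2) span_base] assms(4) by auto
  then show "\<gamma> \<in> span (set \<delta>s)" using rprod_moves[OF assms(3)] by metis
qed

lemma lin_indep_length_le:
  assumes "lin_indep \<gamma>s" "set \<gamma>s \<subseteq> span (set \<delta>s)" shows "length \<gamma>s \<le> card (set \<delta>s)"
  using independent_span_bound[of "set \<delta>s" "set \<gamma>s"] assms by (simp add: lin_indep_def distinct_card)

lemma lists_reflections: "ts \<in> lists (reflections W R) \<longleftrightarrow> (\<exists>\<gamma>s. set \<gamma>s \<subseteq> roots \<and> ts = map reflection \<gamma>s)"
proof
  assume "ts \<in> lists (reflections W R)"
  then show "\<exists>\<gamma>s. set \<gamma>s \<subseteq> roots \<and> ts = map reflection \<gamma>s"
  proof (induction ts)
    case (Cons t ts)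
    then obtain \<gamma>s \<gamma> where "set \<gamma>s \<subseteq> roots" "ts = map reflection \<gamma>s" "\<gamma> \<in> roots" "t = reflection \<gamma>"
      unfolding reflections_eq by blast
    then show ?case by (intro exI[of _ "\<gamma> # \<gamma>s"]) auto
  qed simp
qed (auto simp: reflections_eq in_lists_conv_set subset_iff)

lemma rlen_eq_Least: "rlen g = (LEAST k. \<exists>\<gamma>s. set \<gamma>s \<subseteq> roots \<and> length \<gamma>s = k \<and> rprod \<gamma>s = g)"
proof -
  have "(\<exists>ts. ts \<in> lists (reflections W R) \<and> length ts = k \<and> list_prod W ts = g) \<longleftrightarrow>
      (\<exists>\<gamma>s. set \<gamma>s \<subseteq> roots \<and> length \<gamma>s = k \<and> rprod \<gamma>s = g)" for k
    unfolding lists_reflections rprod_def by (metis length_map)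
  then show ?thesis unfolding refl_length_def by simp
qed

lemma rlen_le: "set \<gamma>s \<subseteq> roots \<Longrightarrow> rlen (rprod \<gamma>s) \<le> length \<gamma>s"
  unfolding rlen_eq_Least by (rule Least_le) auto

lemma rlen_lin_indep: assumes "set \<gamma>s \<subseteq> roots" "lin_indep \<gamma>s" shows "rlen (rprod \<gamma>s) = length \<gamma>s"
proof (rule antisym)
  have "\<exists>\<delta>s. set \<delta>s \<subseteq> roots \<and> length \<delta>s = rlen (rprod \<gamma>s) \<and> rprod \<delta>s = rprod \<gamma>s"
    unfolding rlen_eq_Least by (rule LeastI[of _ "length \<gamma>s"]) (use assms in auto)
  then obtain \<delta>s where \<delta>s: "set \<delta>s \<subseteq> roots" "length \<delta>s = rlen (rprod \<gamma>s)" "rprod \<delta>s = rprod \<gamma>s" by blast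
  have "length \<gamma>s \<le> card (set \<delta>s)"
    using rprod_span_mono[OF assms \<delta>s(1,3)] assms(2) by (intro lin_indep_length_le)
  also have "\<dots> \<le> rlen (rprod \<gamma>s)" using card_length[of \<delta>s] \<delta>s(2) by simp
  finally show "length \<gamma>s \<le> rlen (rprod \<gamma>s)" .
qed (rule rlen_le[OF assms(1)])

definition red_roots :: "'a vect list \<Rightarrow> bool" where "red_roots \<gamma>s \<longleftrightarrow> set \<gamma>s \<subseteq> roots \<and> lin_indep \<gamma>s"

text \<open>The image of 1 - g is contained in the span of the roots of every factorisation of g, and it is
  spanned by the roots of an independent one. So an independent factorisation has minimal length, and
  one of minimal length has too few roots to be dependent.\<close>
theorem carter: assumes "set \<delta>s \<subseteq> roots" shows "rlen (rprod \<delta>s) = length \<delta>s \<longleftrightarrow> lin_indep \<delta>s"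
proof
  assume len: "rlen (rprod \<delta>s) = length \<delta>s"
  obtain \<gamma>s where \<gamma>s: "set \<gamma>s \<subseteq> roots" "lin_indep \<gamma>s" "rprod \<gamma>s = rprod \<delta>s"
    using independent_decomposition rprod_closed[OF assms] by metis
  have l: "length \<gamma>s = length \<delta>s" using rlen_lin_indep[OF \<gamma>s(1,2)] \<gamma>s(3) len by simp
  have sp: "set \<gamma>s \<subseteq> span (set \<delta>s)" using rprod_span_mono[OF \<gamma>s(1,2) assms] \<gamma>s(3) by simp
  have "length \<delta>s \<le> card (set \<delta>s)" using lin_indep_length_le[OF \<gamma>s(2) sp] l by simp
  then have d: "distinct \<delta>s" using card_length[of \<delta>s] by (simp add: card_distinct)
  have "independent (set \<delta>s)"
  proof (rule ccontr)
    assume "\<not> ?thesis"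
    then obtain \<delta> where \<delta>: "\<delta> \<in> set \<delta>s" "\<delta> \<in> span (set \<delta>s - {\<delta>})" by (auto simp: dependent_def)
    have "span (set \<delta>s) = span (set \<delta>s - {\<delta>})"
      using \<delta> by (metis insert_Diff span_redundant)
    then have "set \<gamma>s \<subseteq> span (set \<delta>s - {\<delta>})" using sp by simp
    then have "length \<gamma>s \<le> card (set \<delta>s - {\<delta>})"
      using independent_span_bound[of "set \<delta>s - {\<delta>}" "set \<gamma>s"] \<gamma>s(2) by (simp add: lin_indep_def distinct_card)
    also have "\<dots> < card (set \<delta>s)" using \<delta>(1) by (intro card_Diff1_less) auto
    finally show False using l d by (simp add: distinct_card)
  qed
  then show "lin_indep \<delta>s" using d by (simp add: lin_indep_def)
qed (rule rlen_lin_indep[OF assms])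

lemma red_roots_span_eq:
  assumes "red_roots \<gamma>s" "red_roots \<delta>s" "rprod \<gamma>s = rprod \<delta>s" shows "span (set \<gamma>s) = span (set \<delta>s)"
proof (rule antisym)
  show "span (set \<gamma>s) \<subseteq> span (set \<delta>s)"
    using rprod_span_mono[of \<gamma>s \<delta>s] assms by (intro span_minimal) (auto simp: red_roots_def)
  show "span (set \<delta>s) \<subseteq> span (set \<gamma>s)"
    using rprod_span_mono[of \<delta>s \<gamma>s] assms by (intro span_minimal) (auto simp: red_roots_def)
qed

lemma ex_red_roots: "g \<in> carrier W \<Longrightarrow> \<exists>\<gamma>s. red_roots \<gamma>s \<and> rprod \<gamma>s = g \<and> length \<gamma>s = rlen g"
  using independent_decomposition rlen_lin_indep unfolding red_roots_def by metis

lemma reduced_decomp_iff: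
  "reduced_decomp W R g ts \<longleftrightarrow> (\<exists>\<gamma>s. red_roots \<gamma>s \<and> ts = map reflection \<gamma>s \<and> rprod \<gamma>s = g)"
  unfolding reduced_decomp_def lists_reflections red_roots_def
  using carter by (auto simp: rprod_def) (metis length_map carter rprod_def)+

lemma rlen_mult: assumes "g \<in> carrier W" "h \<in> carrier W" shows "rlen (g \<otimes> h) \<le> rlen g + rlen h"
proof -
  obtain \<gamma>s \<delta>s where "red_roots \<gamma>s" "rprod \<gamma>s = g" "length \<gamma>s = rlen g" "red_roots \<delta>s" "rprod \<delta>s = h" "length \<delta>s = rlen h"
    using ex_red_roots assms by metis
  then show ?thesis using rlen_le[of "\<gamma>s @ \<delta>s"] by (simp add: red_roots_def rprod_append)
qed

end

section \<open>Lattices of roots\<close>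

text \<open>From cos(3t) = - cos(2t) for t = pi / 5, after removing the factor belonging to t = pi.\<close>
lemma cos_pi_5: "2 * cos (pi / 5) = golden"
proof -
  define c where "c = cos (pi / 5)"
  have c0: "c > 0" unfolding c_def by (rule cos_gt_zero) (use pi_gt_zero in auto)
  have "cos (3 * (pi / 5)) = cos (pi - 2 * (pi / 5))" by (rule arg_cong[where f = cos]) simp
  also have "\<dots> = - cos (2 * (pi / 5))" by (rule cos_pi_minus)
  finally have "4 * c ^ 3 - 3 * c = - (2 * c\<^sup>2 - 1)"
    unfolding cos_treble_cos cos_double_cos c_def .
  then have "(c + 1) * (4 * c^2 - 2 * c - 1) = 0" by (simp add: algebra_simps power3_eq_cube power2_eq_square)
  then have c1: "4 * c^2 - 2 * c - 1 = 0" using c0 by auto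
  have "(2 * c - golden) * (2 * c + golden - 1) = 4 * c^2 - 2 * c - (golden * golden - golden)"
    by (simp add: algebra_simps power2_eq_square)
  also have "\<dots> = 0" using c1 unfolding golden_sq by simp
  finally have "2 * c = golden \<or> 2 * c + golden = 1" by simp
  then show ?thesis using c0 golden_bounds unfolding c_def by auto
qed

text \<open>The basis of the ring over the integers.\<close>
definition units4 :: "real set" where
  "units4 = {1, sqrt 2, golden, sqrt 2 * golden}"

lemma basis_as_bas: "1 = bas 1 0 0 0" "sqrt 2 = bas 0 1 0 0" "golden = bas 0 0 1 0" "sqrt 2 * golden = bas 0 0 0 1"
  by (simp_all add: bas_def quad_def)

lemma small_as_bas: "0 = bas 0 0 0 0" "-1 = bas (-1) 0 0 0" "2 = bas 2 0 0 0" "-2 = bas (-2) 0 0 0"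
  "- sqrt 2 = bas 0 (-1) 0 0" "- golden = bas 0 0 (-1) 0" "golden - 1 = bas (-1) 0 1 0" "1 - golden = bas 1 0 (-1) 0"
  by (simp_all add: bas_def quad_def)

lemma units4_ring4: "u \<in> units4 \<Longrightarrow> u \<in> ring4" by (auto simp: units4_def)

lemma tau_units4_sq: assumes "u \<in> units4" shows "tau (u * u * 2) \<ge> 2"
proof -
  consider "u = bas 1 0 0 0" | "u = bas 0 1 0 0" | "u = bas 0 0 1 0" | "u = bas 0 0 0 1"
    using assms unfolding units4_def basis_as_bas(4) unfolding basis_as_bas(1-3) by blast
  then show ?thesis unfolding small_as_bas(3) by cases (simp_all add: bas_mult)
qed

text \<open>A finite computation: a product is negative only in situations in which the sum of the two
  multiples u and uu of roots with inner product b is zero or again such a multiple of a root.\<close>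
lemma negative_tau_cases:
  assumes "u \<in> units4" "uu \<in> units4" "b \<in> small_values" "tau (u * uu * b) < 0"
  shows "(b = -1 \<or> b = -2) \<and> u = uu
    \<or> b = golden - 1 \<and> u = uu \<and> (u = 1 \<or> u = sqrt 2)
    \<or> b = 1 - golden \<and> (uu = u * golden \<or> u = uu * golden)
    \<or> b = - golden \<and> (uu = u * golden \<or> u = uu * golden \<or> u = uu \<and> (u = golden \<or> u = sqrt 2 * golden))
    \<or> b = - sqrt 2 \<and> (uu = u * sqrt 2 \<or> u = uu * sqrt 2)"
proof -
  have u: "u = bas 1 0 0 0 \<or> u = bas 0 1 0 0 \<or> u = bas 0 0 1 0 \<or> u = bas 0 0 0 1"
    using assms(1) unfolding units4_def basis_as_bas(4) unfolding basis_as_bas(1-3) by blast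
  have uu: "uu = bas 1 0 0 0 \<or> uu = bas 0 1 0 0 \<or> uu = bas 0 0 1 0 \<or> uu = bas 0 0 0 1"
    using assms(2) unfolding units4_def basis_as_bas(4) unfolding basis_as_bas(1-3) by blast
  have b: "b = bas 0 0 0 0 \<or> b = bas 1 0 0 0 \<or> b = bas (-1) 0 0 0 \<or> b = bas 2 0 0 0 \<or> b = bas (-2) 0 0 0
     \<or> b = bas 0 1 0 0 \<or> b = bas 0 (-1) 0 0 \<or> b = bas 0 0 1 0 \<or> b = bas 0 0 (-1) 0
     \<or> b = bas (-1) 0 1 0 \<or> b = bas 1 0 (-1) 0"
    using assms(3) unfolding small_values_def small_as_bas[symmetric] basis_as_bas[symmetric] by blast
  have *: "(b = bas (-1) 0 0 0 \<or> b = bas (-2) 0 0 0) \<and> u = uu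
    \<or> b = bas (-1) 0 1 0 \<and> u = uu \<and> (u = bas 1 0 0 0 \<or> u = bas 0 1 0 0)
    \<or> b = bas 1 0 (-1) 0 \<and> (uu = u * bas 0 0 1 0 \<or> u = uu * bas 0 0 1 0)
    \<or> b = bas 0 0 (-1) 0 \<and> (uu = u * bas 0 0 1 0 \<or> u = uu * bas 0 0 1 0 \<or> u = uu \<and> (u = bas 0 0 1 0 \<or> u = bas 0 0 0 1))
    \<or> b = bas 0 (-1) 0 0 \<and> (uu = u * bas 0 1 0 0 \<or> u = uu * bas 0 1 0 0)"
    using u
  proof (elim disjE)
    assume u: "u = bas 1 0 0 0" show ?thesis using assms(4) uu b unfolding u
      by (elim disjE) (simp_all only: bas_mult tau_bas bas_inject, simp_all)
  next
    assume u: "u = bas 0 1 0 0" show ?thesis using assms(4) uu b unfolding u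
      by (elim disjE) (simp_all only: bas_mult tau_bas bas_inject, simp_all)
  next
    assume u: "u = bas 0 0 1 0" show ?thesis using assms(4) uu b unfolding u
      by (elim disjE) (simp_all only: bas_mult tau_bas bas_inject, simp_all)
  next
    assume u: "u = bas 0 0 0 1" show ?thesis using assms(4) uu b unfolding u
      by (elim disjE) (simp_all only: bas_mult tau_bas bas_inject, simp_all)
  qed
  then show ?thesis unfolding small_as_bas[symmetric] basis_as_bas[symmetric] .
qed

text \<open>Two entries violating the relation, to be merged in \<open>root_in_lattice\<close>.\<close>
lemma not_sorted_wrt:
  "\<not> sorted_wrt P xs \<Longrightarrow> \<exists>as x bs y cs. xs = as @ x # bs @ y # cs \<and> \<not> P x y"
proof (induction xs)
  case (Cons x xs)
  show ?case
  proof (cases "sorted_wrt P xs")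
    case True
    then obtain y where "y \<in> set xs" "\<not> P x y" using Cons.prems by auto
    then show ?thesis by (metis append_Nil split_list)
  next
    case False
    then obtain as z bs y cs where "xs = as @ z # bs @ y # cs" "\<not> P z y" using Cons.IH by blast
    then show ?thesis by (metis append_Cons)
  qed
qed simp

context finite_coxeter
begin

lemma gram_values: assumes "r \<in> R" "s \<in> R" "m r s < 6" shows "gram r s \<in> ring4"
proof -
  have "0 < m r s" using m_pos assms by blast
  then have "m r s = 1 \<or> m r s = 2 \<or> m r s = 3 \<or> m r s = 4 \<or> m r s = 5" using assms(3) by auto
  moreover have "- 2 * cos (pi / 5) = - golden" using cos_pi_5 by simp
  ultimately have "gram r s = 2 \<or> gram r s = 0 \<or> gram r s = -1 \<or> gram r s = - sqrt 2 \<or> gram r s = - golden"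
    unfolding gram_def by (auto simp: cos_60 cos_45)
  then show ?thesis using ring4_of_int[of "-1"] by (auto simp: ring4_minus)
qed

lemma gram_cases: assumes "r \<in> R" "s \<in> R" "r \<noteq> s" shows "gram r s = 0 \<or> gram r s \<le> -1"
proof (cases "m r s = 2")
  case True
  then show ?thesis by (simp add: gram_def)
next
  case False
  then have "m r s \<ge> 3" using angle[OF assms m_pos] assms by simp
  then have "cos (pi / 3) \<le> cos (pi / real (m r s))"
    by (intro cos_monotone_0_pi_le) (auto simp: field_simps)
  then show ?thesis using m_pos[of r s] assms by (simp add: gram_def cos_60)
qed

text \<open>An edge of the Coxeter graph with label at least 6 is a connected component: otherwise the
  vector with coordinates 2, sqrt 3, 1 would not have positive norm.\<close>
lemma large_label_isolated:
  assumes r: "r \<in> R" and s: "s \<in> R" and u: "u \<in> R" and "6 \<le> m r s" and ne: "u \<noteq> r" "u \<noteq> s"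
  shows "gram u r = 0"
proof (rule ccontr)
  assume n: "gram u r \<noteq> 0"
  have rs: "r \<noteq> s" using m_one[OF r s] assms(4) by auto
  have ur: "gram u r \<le> -1" using gram_cases[OF u r] n ne by auto
  have us: "gram u s \<le> 0" using gram_cases[OF u s] ne by auto
  have "cos (pi / 6) \<le> cos (pi / real (m r s))"
    using assms(4) by (intro cos_monotone_0_pi_le) (auto simp: field_simps)
  then have c: "gram r s \<le> - sqrt 3" using assms(4) by (simp add: gram_def cos_30)
  define v where "v = 2 *\<^sub>R sroot r + sqrt 3 *\<^sub>R sroot s + sroot u"
  have "v \<in> root_space" unfolding v_def
    using r s u by (intro subspace_add[OF subspace_root_space] subspace_scale[OF subspace_root_space] sroot_root_space)
  moreover have "coef v u = 1" using ne by (simp add: v_def sroot_def)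
  then have "v \<noteq> 0" by auto
  ultimately have "B v v > 0" by (rule B_pos)
  moreover have "B v v = 16 + 4 * (sqrt 3 * gram r s) + 4 * gram u r + 2 * (sqrt 3 * gram u s)"
    using r s u gram_sym[OF s r] gram_sym[OF r u] gram_sym[OF s u]
    by (simp add: v_def B_simps B_sroot gram_diag algebra_simps)
  moreover have "sqrt 3 * gram r s \<le> sqrt 3 * (- sqrt 3)" using c by (intro mult_left_mono) auto
  moreover have "sqrt 3 * gram u s \<le> 0" using us by (simp add: mult_nonneg_nonpos)
  ultimately show False using ur by simp
qed

lemma large_plane_orth:
  assumes r: "r \<in> R" and s: "s \<in> R" and large: "6 \<le> m r s"
    and u: "u \<in> R" "u \<noteq> r" "u \<noteq> s" and x: "x \<in> span {sroot r, sroot s}"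
  shows "B x (sroot u) = 0"
proof -
  have large': "6 \<le> m s r" using large m_sym[OF r s] by simp
  have "B (sroot u) (sroot r) = 0" "B (sroot u) (sroot s) = 0"
    using large_label_isolated[OF r s u(1) large u(2,3)]
      large_label_isolated[OF s r u(1) large' u(3,2)] u(1) r s by (simp_all add: B_sroot)
  then have "B (sroot u) x = 0" by (intro span_orth[OF _ x]) auto
  then show ?thesis by (simp add: B_sym)
qed

lemma act_large_plane:
  assumes r: "r \<in> R" and s: "s \<in> R" and large: "6 \<le> m r s"
    and "g \<in> carrier W" "x \<in> span {sroot r, sroot s}"
  shows "act g x \<in> span {sroot r, sroot s}"
  using assms(4,5)
proof (induction rule: W_induct)
  case (mult u g)
  have g: "act g x \<in> span {sroot r, sroot s}" using mult by simp
  have "srefl u (act g x) \<in> span {sroot r, sroot s}"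
  proof (cases "u = r \<or> u = s")
    case True
    then have "sroot u \<in> span {sroot r, sroot s}" by (auto intro: span_base)
    then show ?thesis unfolding srefl_def using g by (intro span_diff span_scale)
  next
    case False
    then show ?thesis using g large_plane_orth[OF r s large mult.hyps(1)] by (simp add: srefl_def)
  qed
  then show ?case using mult by (simp add: act_mult act_R)
qed simp

text \<open>The generators outside the dihedral components with large labels. Both subsets of the roots below
  are unions of components of the root system.\<close>
definition small_gens :: "'a set" where "small_gens = {r \<in> R. \<forall>s\<in>R. m r s < 6}"

lemma small_gens_R: "r \<in> small_gens \<Longrightarrow> r \<in> R" by (simp add: small_gens_def)

lemma good_bad_orth: assumes "r \<in> small_gens" "s \<in> R" "s \<notin> small_gens" shows "gram r s = 0"
proof -
  obtain t where t: "t \<in> R" "6 \<le> m s t" using assms by (auto simp: small_gens_def not_less)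
  then have tb: "t \<notin> small_gens" using assms(2) m_sym[of s t] by (force simp: small_gens_def)
  then show ?thesis using large_label_isolated[OF assms(2) t(1) small_gens_R[OF assms(1)] t(2)] assms by auto
qed

definition small_roots :: "'a vect set" where
  "small_roots = {act g (sroot r) | g r. g \<in> carrier W \<and> r \<in> small_gens}"

definition large_roots :: "'a vect set" where
  "large_roots = {act g (sroot r) | g r. g \<in> carrier W \<and> r \<in> R - small_gens}"

lemma roots_split: "roots = small_roots \<union> large_roots"
  unfolding roots_def small_roots_def large_roots_def using small_gens_R by blast

lemma small_roots_roots: "\<alpha> \<in> small_roots \<Longrightarrow> \<alpha> \<in> roots" by (simp add: roots_split)

lemma act_small_roots: "g \<in> carrier W \<Longrightarrow> \<alpha> \<in> small_roots \<Longrightarrow> act g \<alpha> \<in> small_roots"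
proof -
  assume g: "g \<in> carrier W" and "\<alpha> \<in> small_roots"
  then obtain h r where h: "h \<in> carrier W" "r \<in> small_gens" "\<alpha> = act h (sroot r)" by (auto simp: small_roots_def)
  then have "act g \<alpha> = act (g \<otimes> h) (sroot r)" using g by (simp add: act_mult)
  then show ?thesis unfolding small_roots_def using g h by blast
qed

lemma small_roots_closed: "\<alpha> \<in> roots \<Longrightarrow> \<beta> \<in> small_roots \<Longrightarrow> \<beta> - B \<beta> \<alpha> *\<^sub>R \<alpha> \<in> small_roots"
  using act_small_roots[of "reflection \<alpha>" \<beta>] by (simp add: act_refl)

text \<open>The lattice spanned over the ring by the roots of the components with small labels, described by
  coordinates; the space belonging to the other components is its orthogonal complement.\<close>
definition small_lattice :: "'a vect set" where
  "small_lattice = {f \<in> root_space. (\<forall>x. coef f x \<in> ring4) \<and> (\<forall>x. x \<notin> small_gens \<longrightarrow> coef f x = 0)}"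

definition large_space :: "'a vect set" where "large_space = {f \<in> root_space. \<forall>x\<in>small_gens. coef f x = 0}"

lemma B_right_sroot: assumes "s \<in> R" shows "B f (sroot s) = (\<Sum>r\<in>R. coef f r * gram r s)"
  unfolding B_def
proof (rule sum.cong[OF HOL.refl])
  fix r assume "r \<in> R"
  have "(\<Sum>x\<in>R. coef f r * coef (sroot s) x * gram r x) = (\<Sum>x\<in>R. if x = s then coef f r * gram r x else 0)"
    by (intro sum.cong) (auto simp: sroot_def)
  then show "(\<Sum>x\<in>R. coef f r * coef (sroot s) x * gram r x) = coef f r * gram r s"
    using assms by (simp add: sum.delta)
qed

lemma small_lattice_add: "f \<in> small_lattice \<Longrightarrow> g \<in> small_lattice \<Longrightarrow> f + g \<in> small_lattice"
  unfolding small_lattice_def using subspace_add[OF subspace_root_space] by auto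

lemma small_lattice_scale: "f \<in> small_lattice \<Longrightarrow> c \<in> ring4 \<Longrightarrow> c *\<^sub>R f \<in> small_lattice"
  unfolding small_lattice_def using subspace_scale[OF subspace_root_space] by auto

lemma small_lattice_0: "0 \<in> small_lattice" unfolding small_lattice_def using subspace_0[OF subspace_root_space] by auto

lemma small_lattice_sroot: "r \<in> small_gens \<Longrightarrow> sroot r \<in> small_lattice"
  unfolding small_lattice_def using sroot_root_space[of r] small_gens_R[of r] by (auto simp: sroot_def)

lemma subspace_large_space: "subspace large_space"
  using subspace_root_space unfolding large_space_def subspace_def by auto

lemma small_lattice_large_space_0: "f \<in> small_lattice \<Longrightarrow> f \<in> large_space \<Longrightarrow> f = 0"
  by (auto simp: small_lattice_def large_space_def vect_eq_iff)

lemma B_small_lattice_good: assumes "f \<in> small_lattice" "s \<in> small_gens" shows "B f (sroot s) \<in> ring4"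
  unfolding B_right_sroot[OF small_gens_R[OF assms(2)]]
proof (rule ring4_sum)
  fix r assume r: "r \<in> R"
  show "coef f r * gram r s \<in> ring4"
  proof (cases "r \<in> small_gens")
    case True
    then have "gram r s \<in> ring4" using assms(2) by (intro gram_values) (auto simp: small_gens_def)
    then show ?thesis using assms(1) by (auto simp: small_lattice_def)
  next
    case False
    then show ?thesis using assms(1) by (simp add: small_lattice_def)
  qed
qed

lemma B_small_lattice_bad: assumes "f \<in> small_lattice" "s \<in> R" "s \<notin> small_gens" shows "B f (sroot s) = 0"
  unfolding B_right_sroot[OF assms(2)]
  by (rule sum.neutral) (use assms good_bad_orth in \<open>auto simp: small_lattice_def\<close>)

lemma B_large_space_good: assumes "f \<in> large_space" "s \<in> small_gens" shows "B f (sroot s) = 0"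
  unfolding B_right_sroot[OF small_gens_R[OF assms(2)]]
proof (rule sum.neutral, rule ballI)
  fix r assume r: "r \<in> R"
  show "coef f r * gram r s = 0"
  proof (cases "r \<in> small_gens")
    case True
    then show ?thesis using assms(1) by (simp add: large_space_def)
  next
    case False
    then show ?thesis
      using good_bad_orth[OF assms(2) r] gram_sym[OF r small_gens_R[OF assms(2)]] by simp
  qed
qed

lemma act_small_lattice: assumes "g \<in> carrier W" "f \<in> small_lattice" shows "act g f \<in> small_lattice"
  using assms
proof (induction rule: W_induct)
  case (mult r g)
  let ?f = "act g f"
  have f: "?f \<in> small_lattice" using mult by simp
  have "srefl r ?f \<in> small_lattice"
  proof (cases "r \<in> small_gens")
    case True
    have "?f + (- B ?f (sroot r)) *\<^sub>R sroot r \<in> small_lattice"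
      using f True by (intro small_lattice_add small_lattice_scale small_lattice_sroot ring4_minus B_small_lattice_good)
    then show ?thesis by (simp add: srefl_def)
  next
    case False
    then show ?thesis using f mult.hyps B_small_lattice_bad[OF f] by (simp add: srefl_def)
  qed
  then show ?case using mult by (simp add: act_mult act_R)
qed simp

lemma act_large_space: assumes "g \<in> carrier W" "f \<in> large_space" shows "act g f \<in> large_space"
  using assms
proof (induction rule: W_induct)
  case (mult r g)
  let ?f = "act g f"
  have f: "?f \<in> large_space" using mult by simp
  have "srefl r ?f \<in> large_space"
  proof (cases "r \<in> small_gens")
    case True
    then show ?thesis using f B_large_space_good[OF f] by (simp add: srefl_def)
  next
    case False
    then have "sroot r \<in> large_space" using sroot_root_space mult.hyps by (auto simp: large_space_def sroot_def)
    then show ?thesis unfolding srefl_def using f by (intro subspace_diff[OF subspace_large_space] subspace_scale[OF subspace_large_space])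
  qed
  then show ?case using mult by (simp add: act_mult act_R)
qed simp

lemma small_roots_small_lattice: "\<alpha> \<in> small_roots \<Longrightarrow> \<alpha> \<in> small_lattice"
  unfolding small_roots_def using act_small_lattice small_lattice_sroot by auto

lemma large_roots_large_space: "\<alpha> \<in> large_roots \<Longrightarrow> \<alpha> \<in> large_space"
proof -
  assume "\<alpha> \<in> large_roots"
  then obtain g r where g: "g \<in> carrier W" "r \<in> R" "r \<notin> small_gens" "\<alpha> = act g (sroot r)" by (auto simp: large_roots_def)
  have "sroot r \<in> large_space" using g sroot_root_space[of r] by (auto simp: large_space_def sroot_def)
  then show ?thesis using act_large_space g by simp
qed

lemma B_small_lattice_small_lattice: assumes "f \<in> small_lattice" "h \<in> small_lattice" shows "B f h \<in> ring4"
proof -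
  have "h \<in> root_space" using assms by (simp add: small_lattice_def)
  have "B f h = (\<Sum>r\<in>R. coef h r * B f (sroot r))"
    by (subst root_space_expand[OF \<open>h \<in> root_space\<close>]) (simp add: B_sum_right B_simps)
  also have "\<dots> \<in> ring4"
  proof (rule ring4_sum)
    fix r assume "r \<in> R"
    show "coef h r * B f (sroot r) \<in> ring4"
      using assms B_small_lattice_good[OF assms(1), of r] by (cases "r \<in> small_gens") (auto simp: small_lattice_def)
  qed
  finally show ?thesis .
qed

lemma B_large_space_small_lattice: assumes "f \<in> large_space" "h \<in> small_lattice" shows "B f h = 0"
proof -
  have "h \<in> root_space" using assms by (simp add: small_lattice_def)
  have "B f h = (\<Sum>r\<in>R. coef h r * B f (sroot r))"
    by (subst root_space_expand[OF \<open>h \<in> root_space\<close>]) (simp add: B_sum_right B_simps)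
  also have "\<dots> = 0"
    by (rule sum.neutral) (use assms B_large_space_good in \<open>auto simp: small_lattice_def\<close>)
  finally show ?thesis .
qed

definition ring_span :: "'a vect set \<Rightarrow> 'a vect set" where
  "ring_span S = {x. \<exists>c. (\<forall>\<gamma>. c \<gamma> \<in> ring4) \<and> x = (\<Sum>\<gamma>\<in>S. c \<gamma> *\<^sub>R \<gamma>)}"

lemma ring_span_0: "0 \<in> ring_span S" unfolding ring_span_def by (auto intro!: exI[of _ "\<lambda>_. 0"])

lemma ring_span_add: "x \<in> ring_span S \<Longrightarrow> y \<in> ring_span S \<Longrightarrow> x + y \<in> ring_span S"
proof -
  assume "x \<in> ring_span S" "y \<in> ring_span S"
  then obtain c d where "\<forall>\<gamma>. c \<gamma> \<in> ring4" "x = (\<Sum>\<gamma>\<in>S. c \<gamma> *\<^sub>R \<gamma>)"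
    "\<forall>\<gamma>. d \<gamma> \<in> ring4" "y = (\<Sum>\<gamma>\<in>S. d \<gamma> *\<^sub>R \<gamma>)" by (auto simp: ring_span_def)
  then show ?thesis unfolding ring_span_def
    by (auto simp: sum.distrib scaleR_add_left intro!: exI[of _ "\<lambda>\<gamma>. c \<gamma> + d \<gamma>"])
qed

lemma ring_span_base: assumes "finite S" "\<gamma> \<in> S" "c \<in> ring4" shows "c *\<^sub>R \<gamma> \<in> ring_span S"
  unfolding ring_span_def
proof (intro CollectI exI[of _ "\<lambda>\<delta>. if \<delta> = \<gamma> then c else 0"] conjI allI)
  show "c *\<^sub>R \<gamma> = (\<Sum>\<delta>\<in>S. (if \<delta> = \<gamma> then c else 0) *\<^sub>R \<delta>)"
    using assms by (simp add: if_distrib[of "\<lambda>c. c *\<^sub>R _"] sum.delta cong: if_cong)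
qed (use assms in auto)

lemma ring_span_small_lattice: assumes "S \<subseteq> small_roots" "x \<in> ring_span S" shows "x \<in> small_lattice"
proof -
  obtain c where c: "\<forall>\<gamma>. c \<gamma> \<in> ring4" "x = (\<Sum>\<gamma>\<in>S. c \<gamma> *\<^sub>R \<gamma>)" using assms by (auto simp: ring_span_def)
  have "(\<Sum>\<gamma>\<in>A. c \<gamma> *\<^sub>R \<gamma>) \<in> small_lattice" if "A \<subseteq> small_roots" for A
    using that
  proof (induction A rule: infinite_finite_induct)
    case (insert \<gamma> A)
    then show ?case using c(1) by (auto intro!: small_lattice_add small_lattice_scale intro: small_roots_small_lattice)
  qed (simp_all add: small_lattice_0)
  then show ?thesis using assms c by simp
qed

text \<open>Inner products with the roots of the large components are left free, which is why the following
  statements hold modulo \<open>large_space\<close>.\<close>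
definition dual_lattice :: "'a vect set" where "dual_lattice = {v \<in> root_space. \<forall>\<alpha>\<in>small_roots. B v \<alpha> \<in> ring4}"

text \<open>Up to the components with large labels, 1 - w maps the dual of the root lattice into the
  lattice spanned by the roots of any reflection factorisation of w.\<close>
lemma dual_lattice_moves:
  assumes "set \<gamma>s \<subseteq> S" "S \<subseteq> roots" "v \<in> dual_lattice" "finite S"
  shows "\<exists>x\<in>ring_span (S \<inter> small_roots). v - act (rprod \<gamma>s) v - x \<in> large_space"
  using assms(1)
proof (induction \<gamma>s)
  case Nil
  show ?case by (intro bexI[of _ 0]) (auto simp: ring_span_0 subspace_0[OF subspace_large_space])
next
  case (Cons \<gamma> \<gamma>s)
  have \<gamma>: "\<gamma> \<in> S" "\<gamma> \<in> roots" "set \<gamma>s \<subseteq> S" "set \<gamma>s \<subseteq> roots" using Cons.prems assms(2) by auto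
  let ?u = "act (rprod \<gamma>s) v"
  obtain x where x: "x \<in> ring_span (S \<inter> small_roots)" "v - ?u - x \<in> large_space" using Cons by auto
  have e: "v - act (rprod (\<gamma> # \<gamma>s)) v = (v - ?u) + B ?u \<gamma> *\<^sub>R \<gamma>"
    using \<gamma> by (simp add: act_mult act_refl)
  show ?case
  proof (cases "\<gamma> \<in> small_roots")
    case True
    have xL: "x \<in> small_lattice" using x(1) by (intro ring_span_small_lattice[of "S \<inter> small_roots"]) auto
    have "B (v - ?u - x) \<gamma> = 0" using x(2) small_roots_small_lattice[OF True] by (rule B_large_space_small_lattice)
    then have "B ?u \<gamma> = B v \<gamma> - B x \<gamma>" by (simp add: B_simps)
    then have "B ?u \<gamma> \<in> ring4"
      using assms(3) True B_small_lattice_small_lattice[OF xL small_roots_small_lattice[OF True]] by (auto simp: dual_lattice_def)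
    then have "x + B ?u \<gamma> *\<^sub>R \<gamma> \<in> ring_span (S \<inter> small_roots)"
      using x(1) True \<gamma>(1) assms(4) by (intro ring_span_add ring_span_base) auto
    moreover have "v - act (rprod (\<gamma> # \<gamma>s)) v - (x + B ?u \<gamma> *\<^sub>R \<gamma>) \<in> large_space"
      unfolding e using x(2) by (simp add: algebra_simps)
    ultimately show ?thesis by blast
  next
    case False
    then have "\<gamma> \<in> large_space" using \<gamma>(2) large_roots_large_space by (auto simp: roots_split)
    then have "(v - ?u - x) + B ?u \<gamma> *\<^sub>R \<gamma> \<in> large_space"
      using x(2) by (intro subspace_add[OF subspace_large_space] subspace_scale[OF subspace_large_space])
    then have "v - act (rprod (\<gamma> # \<gamma>s)) v - x \<in> large_space" unfolding e by (simp add: algebra_simps)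
    then show ?thesis using x(1) by blast
  qed
qed

text \<open>Roots of generating reflections span the root lattice. Writing the reflection in alpha as a
  product of the generators and applying it to a vector v of the dual lattice with B(v, alpha) = 1
  gives alpha = v - s v.\<close>
lemma generating_ring_span:
  assumes S: "S \<subseteq> roots" "finite S" and gen: "generate W (reflection ` S) = carrier W"
    and \<alpha>: "\<alpha> \<in> small_roots"
  shows "\<alpha> \<in> ring_span (S \<inter> small_roots)"
proof -
  obtain g r where g: "g \<in> carrier W" "r \<in> small_gens" "\<alpha> = act g (sroot r)" using \<alpha> by (auto simp: small_roots_def)
  obtain v0 where v0: "v0 \<in> root_space" "\<And>s. s \<in> R \<Longrightarrow> B v0 (sroot s) = (if s = r then 1 else 0)"
    using prescribed_simple[of "\<lambda>s. if s = r then 1 else 0"] by auto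
  have v0D: "B v0 f \<in> ring4" if "f \<in> small_lattice" for f
  proof -
    have "f \<in> root_space" using that by (simp add: small_lattice_def)
    then have "B v0 f = (\<Sum>s\<in>R. coef f s * (if s = r then 1 else 0))"
      by (subst root_space_expand[OF \<open>f \<in> root_space\<close>]) (simp add: B_sum_right B_simps v0(2))
    also have "\<dots> \<in> ring4" using that by (intro ring4_sum) (auto simp: small_lattice_def)
    finally show ?thesis .
  qed
  define v where "v = act g v0"
  have "B v \<beta> \<in> ring4" if "\<beta> \<in> small_roots" for \<beta>
    unfolding v_def B_act_inv[OF g(1)] using g(1) that by (intro v0D small_roots_small_lattice act_small_roots) auto
  then have vD: "v \<in> dual_lattice" using v0(1) g(1) by (auto simp: dual_lattice_def v_def act_root_space)
  have v1: "B v \<alpha> = 1" using g v0(2) small_gens_R by (simp add: v_def)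
  have "reflection \<alpha> \<in> generate W (reflection ` S)" unfolding gen using \<alpha> small_roots_roots by simp
  then obtain \<gamma>s where \<gamma>s: "set \<gamma>s \<subseteq> S" "rprod \<gamma>s = reflection \<alpha>" using generate_rprod[OF S(1)] by blast
  obtain x where x: "x \<in> ring_span (S \<inter> small_roots)" "v - act (rprod \<gamma>s) v - x \<in> large_space"
    using dual_lattice_moves[OF \<gamma>s(1) S(1) vD S(2)] by blast
  have "v - act (rprod \<gamma>s) v = \<alpha>" unfolding \<gamma>s(2) using \<alpha> small_roots_roots by (simp add: act_refl v1)
  then have "\<alpha> + (-1) *\<^sub>R x \<in> large_space" using x(2) by simp
  moreover have "x \<in> small_lattice" using x(1) by (intro ring_span_small_lattice[of "S \<inter> small_roots"]) auto
  then have "\<alpha> + (-1) *\<^sub>R x \<in> small_lattice" using small_roots_small_lattice[OF \<alpha>] ring4_of_int[of "-1"] by (intro small_lattice_add small_lattice_scale) auto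
  ultimately have "\<alpha> = x" using small_lattice_large_space_0[of "\<alpha> + (-1) *\<^sub>R x"] by simp
  then show ?thesis using x by simp
qed

text \<open>The lattice does not depend on the factorisation: 1 - w maps the dual of the root lattice
  onto the lattice spanned by one independent generating factorisation, and into the lattice spanned
  by every other one.\<close>
lemma factorisation_ring_span:
  assumes \<beta>: "red_roots \<beta>s" "generate W (reflection ` set \<beta>s) = carrier W"
    and \<gamma>: "red_roots \<gamma>s" "rprod \<gamma>s = rprod \<beta>s" and \<alpha>: "\<alpha> \<in> small_roots"
  shows "\<alpha> \<in> ring_span (set \<gamma>s \<inter> small_roots)"
proof -
  have \<beta>r: "set \<beta>s \<subseteq> roots" "lin_indep \<beta>s" and \<gamma>r: "set \<gamma>s \<subseteq> roots" using \<beta>(1) \<gamma>(1) by (auto simp: red_roots_def)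
  let ?S = "set \<beta>s \<inter> small_roots"
  have gl: "\<alpha>' \<in> ring_span ?S" if "\<alpha>' \<in> small_roots" for \<alpha>'
    using generating_ring_span[OF \<beta>r(1) _ \<beta>(2) that] by simp
  obtain c where c: "\<forall>\<gamma>. c \<gamma> \<in> ring4" "\<alpha> = (\<Sum>\<gamma>\<in>?S. c \<gamma> *\<^sub>R \<gamma>)" using gl[OF \<alpha>] by (auto simp: ring_span_def)
  define d where "d \<gamma> = (if \<gamma> \<in> small_roots then c \<gamma> else 0)" for \<gamma>
  have dB: "d \<gamma> * B \<gamma> \<delta> \<in> ring4" if "\<gamma> \<in> set \<beta>s" "\<delta> \<in> set \<beta>s" for \<gamma> \<delta>
  proof (cases "\<gamma> \<in> small_roots")
    case True
    show ?thesis
    proof (cases "\<delta> \<in> small_roots")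
      case True
      then show ?thesis using B_small_lattice_small_lattice[OF small_roots_small_lattice small_roots_small_lattice] \<open>\<gamma> \<in> small_roots\<close> c(1) by (auto simp: d_def)
    next
      case False
      then have "\<delta> \<in> large_space" using that \<beta>r(1) large_roots_large_space by (auto simp: roots_split)
      then have "B \<delta> \<gamma> = 0" using small_roots_small_lattice[OF \<open>\<gamma> \<in> small_roots\<close>] by (rule B_large_space_small_lattice)
      then show ?thesis by (simp add: B_sym[of \<gamma> \<delta>])
    qed
  qed (simp add: d_def)
  have "\<exists>a\<in>root_space. a - act (rprod \<beta>s) a = (\<Sum>\<gamma>\<in>set \<beta>s. d \<gamma> *\<^sub>R \<gamma>) \<and> (\<forall>\<gamma>\<in>set \<beta>s. B a \<gamma> \<in> ring4)"
    by (rule rprod_solve[OF \<beta>r]) (use c(1) dB in \<open>auto simp: d_def\<close>)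
  then obtain a where a: "a \<in> root_space" "a - act (rprod \<beta>s) a = (\<Sum>\<gamma>\<in>set \<beta>s. d \<gamma> *\<^sub>R \<gamma>)"
    "\<And>\<gamma>. \<gamma> \<in> set \<beta>s \<Longrightarrow> B a \<gamma> \<in> ring4" by blast
  have "(\<Sum>\<gamma>\<in>set \<beta>s. d \<gamma> *\<^sub>R \<gamma>) = \<alpha>" unfolding c(2)
    by (rule sum.mono_neutral_cong_right) (auto simp: d_def)
  then have a\<alpha>: "a - act (rprod \<gamma>s) a = \<alpha>" using a(2) \<gamma>(2) by simp
  have "B a \<alpha>' \<in> ring4" if \<alpha>': "\<alpha>' \<in> small_roots" for \<alpha>'
  proof -
    obtain c' where c': "\<forall>\<gamma>. c' \<gamma> \<in> ring4" "\<alpha>' = (\<Sum>\<gamma>\<in>?S. c' \<gamma> *\<^sub>R \<gamma>)" using gl[OF \<alpha>'] by (auto simp: ring_span_def)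
    show ?thesis unfolding c'(2) B_sum_right B_simps using c'(1) a(3) by (intro ring4_sum) auto
  qed
  then have "a \<in> dual_lattice" using a(1) by (simp add: dual_lattice_def)
  then obtain x where x: "x \<in> ring_span (set \<gamma>s \<inter> small_roots)" "a - act (rprod \<gamma>s) a - x \<in> large_space"
    using dual_lattice_moves[of \<gamma>s "set \<gamma>s" a] \<gamma>r by auto
  then have "\<alpha> + (-1) *\<^sub>R x \<in> large_space" unfolding a\<alpha> by simp
  moreover have "x \<in> small_lattice" using x(1) by (intro ring_span_small_lattice[of "set \<gamma>s \<inter> small_roots"]) auto
  then have "\<alpha> + (-1) *\<^sub>R x \<in> small_lattice" using small_roots_small_lattice[OF \<alpha>] ring4_of_int[of "-1"] by (intro small_lattice_add small_lattice_scale) auto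
  ultimately have "\<alpha> = x" using small_lattice_large_space_0[of "\<alpha> + (-1) *\<^sub>R x"] by simp
  then show ?thesis using x by simp
qed

text \<open>Inner products with a dual basis of the whole list extract the coefficients.\<close>
lemma ring_span_prefix:
  assumes "red_roots (\<gamma>s @ \<delta>s)" "\<alpha> \<in> ring_span (set (\<gamma>s @ \<delta>s) \<inter> small_roots)" "\<alpha> \<in> span (set \<gamma>s)"
  shows "\<alpha> \<in> ring_span (set \<gamma>s \<inter> small_roots)"
proof -
  let ?S = "set (\<gamma>s @ \<delta>s)"
  have S: "?S \<subseteq> root_space" "independent ?S" "set \<gamma>s \<inter> set \<delta>s = {}"
    using assms(1) roots_root_space by (auto simp: red_roots_def lin_indep_def)
  obtain c where c: "\<forall>\<gamma>. c \<gamma> \<in> ring4" "\<alpha> = (\<Sum>\<gamma>\<in>?S \<inter> small_roots. c \<gamma> *\<^sub>R \<gamma>)" using assms(2) by (auto simp: ring_span_def)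
  have c0: "c \<delta> = 0" if \<delta>: "\<delta> \<in> set \<delta>s" "\<delta> \<in> small_roots" for \<delta>
  proof -
    obtain d where d: "\<And>s. s \<in> ?S \<Longrightarrow> B d s = (if s = \<delta> then 1 else 0)"
      using dual_vector[of ?S "\<lambda>s. if s = \<delta> then 1 else 0"] S by auto
    have "B d \<alpha> = 0" using S(3) \<delta> by (intro span_orth[OF _ assms(3)]) (auto simp: d)
    moreover have "B d \<alpha> = (\<Sum>\<gamma>\<in>?S \<inter> small_roots. if \<gamma> = \<delta> then c \<gamma> else 0)"
      unfolding c(2) B_sum_right by (intro sum.cong) (auto simp: B_simps d)
    ultimately show ?thesis using \<delta> by (simp add: sum.delta)
  qed
  have "\<alpha> = (\<Sum>\<gamma>\<in>set \<gamma>s \<inter> small_roots. c \<gamma> *\<^sub>R \<gamma>)"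
    unfolding c(2) by (rule sum.mono_neutral_right) (auto simp: c0)
  then show ?thesis using c(1) by (auto simp: ring_span_def)
qed

text \<open>The set of inner products of roots is finite and stable under y \<mapsto> 2 - y^2, hence so are its
  conjugates; a conjugate of absolute value larger than 2 would grow forever.\<close>
lemma small_roots_inner_products:
  assumes "\<alpha> \<in> small_roots" "\<beta> \<in> small_roots" shows "B \<alpha> \<beta> \<in> small_values"
proof (rule small_conjugates)
  show "B \<alpha> \<beta> \<in> ring4" using assms by (intro B_small_lattice_small_lattice small_roots_small_lattice)
  fix e f assume ef: "e = sqrt 2 \<or> e = - sqrt 2" "f = golden \<or> f = golden'"
  have sq: "e * e = 2" "f * f = f + 1" using ef golden_sq golden'_sq by auto
  let ?h = "conj_of e f"
  define N where "N = (\<lambda>(\<alpha>, \<beta>). \<bar>?h (B \<alpha> \<beta>)\<bar>) ` (small_roots \<times> small_roots)"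
  have "finite small_roots" using finite_roots by (rule finite_subset[rotated]) (auto simp: roots_split)
  then have finN: "finite N" by (simp add: N_def)
  have NI: "\<bar>?h (B \<gamma> \<delta>)\<bar> \<in> N" if "\<gamma> \<in> small_roots" "\<delta> \<in> small_roots" for \<gamma> \<delta>
    unfolding N_def using that by force
  then have "N \<noteq> {}" using assms by auto
  then have "Max N \<in> N" using finN by simp
  then obtain \<gamma> \<delta> where \<gamma>: "\<gamma> \<in> small_roots" "\<delta> \<in> small_roots" "\<bar>?h (B \<gamma> \<delta>)\<bar> = Max N" by (auto simp: N_def)
  let ?y = "B \<gamma> \<delta>"
  have y: "?y \<in> ring4" using \<gamma> by (intro B_small_lattice_small_lattice small_roots_small_lattice)
  have "Max N \<le> 2"
  proof (rule ccontr)
    assume "\<not> ?thesis"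
    then have big: "\<bar>?h ?y\<bar> > 2" using \<gamma>(3) by simp
    have d': "\<delta> - B \<delta> \<gamma> *\<^sub>R \<gamma> \<in> small_roots" using \<gamma> small_roots_roots by (intro small_roots_closed)
    have "B (\<delta> - B \<delta> \<gamma> *\<^sub>R \<gamma>) \<delta> = 2 + - (?y * ?y)"
      using \<gamma> small_roots_roots by (simp add: B_simps B_sym[of \<delta> \<gamma>])
    then have "\<bar>?h (2 + (-1) * (?y * ?y))\<bar> \<in> N" using NI[OF d' \<gamma>(2)] by simp
    moreover have "?h (2 + (-1) * (?y * ?y)) = 2 - ?h ?y * ?h ?y"
    proof -
      have 1: "-1 \<in> ring4" using ring4_of_int[of "-1"] by simp
      have 2: "?h 2 = 2" "?h (-1) = -1" using conj_of_int[of e f 2] conj_of_int[of e f "-1"] by simp_all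
      have "?h (2 + (-1) * (?y * ?y)) = ?h 2 + ?h ((-1) * (?y * ?y))"
        using y 1 by (intro conj_of_hom[OF _ _ sq] ring4_mult) auto
      also have "?h ((-1) * (?y * ?y)) = ?h (-1) * ?h (?y * ?y)"
        using y 1 by (intro conj_of_hom[OF _ _ sq] ring4_mult) auto
      also have "?h (?y * ?y) = ?h ?y * ?h ?y" using y by (intro conj_of_hom[OF _ _ sq])
      finally show ?thesis unfolding 2 by simp
    qed
    ultimately have "\<bar>2 - ?h ?y * ?h ?y\<bar> \<le> \<bar>?h ?y\<bar>" using finN \<gamma>(3) by simp
    moreover have "\<bar>?h ?y\<bar> * 2 \<le> \<bar>?h ?y\<bar> * \<bar>?h ?y\<bar>" using big by (intro mult_left_mono) auto
    moreover have "\<bar>?h ?y\<bar> * \<bar>?h ?y\<bar> = ?h ?y * ?h ?y" by simp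
    ultimately show False using big by linarith
  qed
  moreover have "\<bar>?h (B \<alpha> \<beta>)\<bar> \<le> Max N" using finN NI[OF assms] by simp
  ultimately show "\<bar>?h (B \<alpha> \<beta>)\<bar> \<le> 2" by simp
qed

end

section \<open>From lattices to reflection subgroups\<close>

text \<open>Conjugation by one reflection inverts the rotations of a dihedral group.\<close>
lemma (in group) dihedral_normal_form:
  assumes a: "a \<in> carrier G" "a \<otimes> a = \<one>" and b: "b \<in> carrier G" "b \<otimes> b = \<one>"
    and fin: "finite (carrier G)"
  shows "c \<in> generate G {a \<otimes> b} \<Longrightarrow> a \<otimes> c \<otimes> a = inv c"
    and "g \<in> generate G {a, b} \<Longrightarrow> \<exists>c\<in>generate G {a \<otimes> b}. g = c \<or> g = c \<otimes> a"
proof -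
  let ?p = "a \<otimes> b" and ?C = "generate G {a \<otimes> b}"
  have p: "?p \<in> carrier G" using a b by simp
  have ia: "inv a = a" and ib: "inv b = b" using a b by (simp_all add: inv_equality)
  have C: "c \<in> carrier G" if "c \<in> ?C" for c
    by (rule generate_in_carrier[OF _ that]) (use p in simp)
  have pow: "a \<otimes> ?p [^] (k::nat) \<otimes> a = inv (?p [^] k)" for k
  proof (induction k)
    case (Suc k)
    let ?q = "?p [^] k"
    have q: "?q \<in> carrier G" using p by simp
    have "a \<otimes> ?p [^] Suc k \<otimes> a = a \<otimes> ?q \<otimes> (a \<otimes> a) \<otimes> (a \<otimes> b \<otimes> a)"
      unfolding a(2) using q a(1) b(1) by (simp add: m_assoc)
    also have "\<dots> = (a \<otimes> ?q \<otimes> a) \<otimes> ((a \<otimes> a) \<otimes> b \<otimes> a)" using q a(1) b(1) by (simp add: m_assoc)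
    also have "\<dots> = inv ?q \<otimes> inv ?p" unfolding Suc a(2) using a(1) b(1) by (simp add: inv_mult_group ia ib)
    also have "\<dots> = inv (?p \<otimes> ?q)" using p q by (simp add: inv_mult_group)
    also have "?p \<otimes> ?q = ?p [^] Suc k" using nat_pow_Suc2[OF p] by simp
    finally show ?case .
  qed (use a in simp)
  show inv: "a \<otimes> c \<otimes> a = inv c" if c: "c \<in> ?C" for c
  proof -
    obtain k :: nat where "c = ?p [^] k" using c generate_pow_on_finite_carrier[OF fin p] by auto
    then show ?thesis using pow by simp
  qed
  have sub: "subgroup ?C G" using p by (intro generate_is_subgroup) auto
  have pC: "?p \<in> ?C" by (rule generate.incl) simp
  have left_a: "\<exists>c'\<in>?C. a \<otimes> g = c' \<or> a \<otimes> g = c' \<otimes> a" if "c \<in> ?C" "g = c \<or> g = c \<otimes> a" for c g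
  proof -
    have ic: "inv c \<in> ?C" using sub that(1) by (rule subgroup.m_inv_closed)
    have "a \<otimes> c = inv c \<otimes> a"
    proof -
      have "a \<otimes> c = (a \<otimes> c \<otimes> a) \<otimes> a" using C[OF that(1)] a by (simp add: m_assoc)
      then show ?thesis unfolding inv[OF that(1)] .
    qed
    moreover have "a \<otimes> (c \<otimes> a) = inv c" using inv[OF that(1)] C[OF that(1)] a by (simp add: m_assoc)
    ultimately show ?thesis using that(2) ic by auto
  qed
  have left_b: "\<exists>c'\<in>?C. b \<otimes> g = c' \<or> b \<otimes> g = c' \<otimes> a" if c: "c \<in> ?C" "g = c \<or> g = c \<otimes> a" for c g
  proof -
    have pc: "?p \<otimes> c \<in> ?C" using sub pC c(1) by (rule subgroup.m_closed)
    have cG: "c \<in> carrier G" "g \<in> carrier G" using c C a by auto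
    have "b \<otimes> g = a \<otimes> (?p \<otimes> g)" using a b cG by (simp add: m_assoc[symmetric])
    moreover have "?p \<otimes> g = ?p \<otimes> c \<or> ?p \<otimes> g = (?p \<otimes> c) \<otimes> a" using c(2) cG p a by (auto simp: m_assoc)
    ultimately show ?thesis using left_a[OF pc] by metis
  qed
  show "\<exists>c\<in>?C. g = c \<or> g = c \<otimes> a" if "g \<in> generate G {a, b}"
  proof -
    let ?Q = "\<lambda>g. \<exists>c\<in>?C. g = c \<or> g = c \<otimes> a"
    have ab: "{a, b} \<subseteq> carrier G" using a b by simp
    have "h \<in> carrier G \<Longrightarrow> ?Q h \<Longrightarrow> ?Q (g \<otimes> h)" for h
      using that
    proof (induction g arbitrary: h)
      case one
      then show ?case by simp
    next
      case (incl x)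
      then show ?case using left_a left_b by blast
    next
      case (inv x)
      then have "inv x = a \<or> inv x = b" using ia ib by auto
      then show ?case using left_a left_b inv.prems by metis
    next
      case (eng g1 g2)
      have c: "g1 \<in> carrier G" "g2 \<in> carrier G" using eng.hyps generate_in_carrier[OF ab] by auto
      have "?Q (g1 \<otimes> (g2 \<otimes> h))" using eng c by simp
      then show ?case using c eng.prems(1) by (simp add: m_assoc)
    qed
    from this[of \<one>] have "?Q (g \<otimes> \<one>)" using generate.one[of G "{?p}"] by auto
    then show ?thesis using generate_in_carrier[OF ab that] by simp
  qed
qed

context finite_coxeter
begin

text \<open>The lattice over the ring is regarded as a lattice over the integers, generated by the multiples
  of the roots by the four basis elements of the ring, with the constant coefficient of B as integral
  bilinear form. In a shortest expression of a root as a sum of such generators no two summands have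
  a negative product, since their sum would be zero or again a generator. But then the square of the
  sum is at least the sum of the squares, so there is only one summand.\<close>
lemma root_in_lattice:
  assumes S: "S \<subseteq> roots" "finite S" and \<alpha>: "\<alpha> \<in> small_roots" "\<alpha> \<in> ring_span (S \<inter> small_roots)"
  shows "reflection \<alpha> \<in> generate W (reflection ` S)"
proof -
  let ?H = "generate W (reflection ` S)"
  have SW: "reflection ` S \<subseteq> carrier W" using S by auto
  have sub: "subgroup ?H W" using SW by (rule generate_is_subgroup)
  define \<Phi> where "\<Phi> = {\<beta> \<in> small_roots. reflection \<beta> \<in> ?H}"
  have \<Phi>g: "\<beta> \<in> small_roots" "\<beta> \<in> roots" if "\<beta> \<in> \<Phi>" for \<beta> using that small_roots_roots by (auto simp: \<Phi>_def)
  have \<Phi>refl: "\<delta> - B \<delta> \<beta> *\<^sub>R \<beta> \<in> \<Phi>" if "\<beta> \<in> \<Phi>" "\<delta> \<in> \<Phi>" for \<beta> \<delta>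
  proof -
    have e: "\<delta> - B \<delta> \<beta> *\<^sub>R \<beta> = act (reflection \<beta>) \<delta>" using that \<Phi>g by (simp add: act_refl)
    have "reflection (act (reflection \<beta>) \<delta>) = reflection \<beta> \<otimes> reflection \<delta> \<otimes> inv (reflection \<beta>)"
      using that \<Phi>g by (intro refl_conj) auto
    also have "\<dots> \<in> ?H" using that sub unfolding \<Phi>_def
      by (auto intro!: subgroup.m_closed[OF sub] subgroup.m_inv_closed[OF sub])
    finally show ?thesis unfolding e \<Phi>_def using that \<Phi>g by (auto intro: act_small_roots)
  qed
  have \<Phi>minus: "- \<beta> \<in> \<Phi>" if "\<beta> \<in> \<Phi>" for \<beta>
    using \<Phi>refl[OF that that] \<Phi>g(2)[OF that] by (simp add: scaleR_2)
  define \<Psi> where "\<Psi> = {u *\<^sub>R \<beta> | u \<beta>. u \<in> units4 \<and> \<beta> \<in> \<Phi>}"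
  have \<Psi>I: "u *\<^sub>R \<beta> \<in> \<Psi>" if "u \<in> units4" "\<beta> \<in> \<Phi>" for u \<beta> using that by (auto simp: \<Psi>_def)
  have \<Psi>minus: "- x \<in> \<Psi>" if x: "x \<in> \<Psi>" for x
  proof -
    obtain u \<beta> where u: "u \<in> units4" "\<beta> \<in> \<Phi>" "x = u *\<^sub>R \<beta>" using x by (auto simp: \<Psi>_def)
    then have "- x = u *\<^sub>R (- \<beta>)" by simp
    then show ?thesis using \<Psi>I[OF u(1) \<Phi>minus[OF u(2)]] by simp
  qed
  define K where "K = {sum_list xs | xs. set xs \<subseteq> \<Psi>}"
  have K0: "0 \<in> K" unfolding K_def by (auto intro!: exI[of _ "[]"])
  have Kadd: "x + y \<in> K" if xy: "x \<in> K" "y \<in> K" for x y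
  proof -
    obtain xs ys where "set xs \<subseteq> \<Psi>" "x = sum_list xs" "set ys \<subseteq> \<Psi>" "y = sum_list ys"
      using xy by (auto simp: K_def)
    then show ?thesis unfolding K_def by (auto intro!: exI[of _ "xs @ ys"])
  qed
  have K\<Psi>: "x \<in> K" if "x \<in> \<Psi>" for x unfolding K_def using that by (auto intro!: exI[of _ "[x]"])
  have Knat: "real n *\<^sub>R x \<in> K" if "x \<in> \<Psi>" for n x
    by (induction n) (use that in \<open>auto simp: scaleR_add_left intro: K0 Kadd K\<Psi>\<close>)
  have Kint: "of_int k *\<^sub>R x \<in> K" if "x \<in> \<Psi>" for k x
  proof (cases "k \<ge> 0")
    case True
    then show ?thesis using Knat[OF that, of "nat k"] by simp
  next
    case False
    then have "of_int k *\<^sub>R x = real (nat (-k)) *\<^sub>R (- x)" by simp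
    then show ?thesis using Knat[OF \<Psi>minus[OF that], of "nat (-k)"] by simp
  qed
  have Kring: "c *\<^sub>R \<beta> \<in> K" if cO: "c \<in> ring4" and "\<beta> \<in> \<Phi>" for c \<beta>
  proof -
    obtain i j k l where c: "c = bas i j k l" using cO by (rule ring4_cases)
    have e: "c *\<^sub>R \<beta> = of_int i *\<^sub>R (1 *\<^sub>R \<beta>) + of_int j *\<^sub>R (sqrt 2 *\<^sub>R \<beta>) + of_int k *\<^sub>R (golden *\<^sub>R \<beta>)
        + of_int l *\<^sub>R ((sqrt 2 * golden) *\<^sub>R \<beta>)"
      by (simp add: c bas_def quad_def scaleR_add_left)
    have "1 *\<^sub>R \<beta> \<in> \<Psi>" "sqrt 2 *\<^sub>R \<beta> \<in> \<Psi>" "golden *\<^sub>R \<beta> \<in> \<Psi>" "(sqrt 2 * golden) *\<^sub>R \<beta> \<in> \<Psi>"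
      by (rule \<Psi>I[OF _ \<open>\<beta> \<in> \<Phi>\<close>]; simp add: units4_def)+
    then show ?thesis unfolding e by (intro Kadd Kint)
  qed
  have "\<alpha> \<in> K"
  proof -
    obtain c where c: "\<forall>\<gamma>. c \<gamma> \<in> ring4" "\<alpha> = (\<Sum>\<gamma>\<in>S \<inter> small_roots. c \<gamma> *\<^sub>R \<gamma>)" using \<alpha>(2) by (auto simp: ring_span_def)
    have "(\<Sum>\<gamma>\<in>A. c \<gamma> *\<^sub>R \<gamma>) \<in> K" if "A \<subseteq> \<Phi>" for A using that
    proof (induction A rule: infinite_finite_induct)
      case (insert x A)
      then show ?case using c(1) by (auto intro!: Kadd Kring)
    qed (simp_all add: K0)
    moreover have "S \<inter> small_roots \<subseteq> \<Phi>" by (auto simp: \<Phi>_def intro: generate.incl)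
    ultimately show ?thesis using c(2) by simp
  qed
  then obtain xs0 where "set xs0 \<subseteq> \<Psi> \<and> sum_list xs0 = \<alpha>" by (auto simp: K_def)
  then obtain xs where xs: "set xs \<subseteq> \<Psi>" "sum_list xs = \<alpha>"
    and least: "\<And>ys. set ys \<subseteq> \<Psi> \<Longrightarrow> sum_list ys = \<alpha> \<Longrightarrow> length xs \<le> length ys"
    using ex_has_least_nat[of "\<lambda>xs. set xs \<subseteq> \<Psi> \<and> sum_list xs = \<alpha>" xs0 length] by blast
  have B\<Psi>: "B x y \<in> ring4" if "x \<in> \<Psi>" "y \<in> \<Psi>" for x y
    using that B_small_lattice_small_lattice[OF small_roots_small_lattice small_roots_small_lattice] \<Phi>g units4_ring4 unfolding \<Psi>_def
    by (auto simp: B_simps intro!: ring4_mult)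
  have merge: "x + y \<in> \<Psi> \<or> x + y = 0" if xy: "x \<in> \<Psi>" "y \<in> \<Psi>" "tau (B x y) < 0" for x y
  proof -
    obtain u \<beta> where u: "u \<in> units4" "\<beta> \<in> \<Phi>" "x = u *\<^sub>R \<beta>" using xy(1) by (auto simp: \<Psi>_def)
    obtain v \<delta> where v: "v \<in> units4" "\<delta> \<in> \<Phi>" "y = v *\<^sub>R \<delta>" using xy(2) by (auto simp: \<Psi>_def)
    define b where "b = B \<beta> \<delta>"
    have b': "B \<delta> \<beta> = b" by (simp add: b_def B_sym)
    have bs: "b \<in> small_values" unfolding b_def using u v \<Phi>g by (intro small_roots_inner_products)
    have neg: "tau (u * v * b) < 0" using xy(3) by (simp add: u v b_def B_simps mult.assoc mult.left_commute)
    have r1: "\<delta> - b *\<^sub>R \<beta> \<in> \<Phi>" using \<Phi>refl[OF u(2) v(2)] b' by simp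
    have r2: "\<beta> - b *\<^sub>R \<delta> \<in> \<Phi>" using \<Phi>refl[OF v(2) u(2)] by (simp add: b_def)
    have nn: "B \<beta> \<beta> = 2" "B \<delta> \<delta> = 2" using u v \<Phi>g by auto
    have gg: "golden *\<^sub>R (golden *\<^sub>R z) = golden *\<^sub>R z + z" for z :: "'a vect"
      by (simp add: golden_sq scaleR_add_left)
    have gm: "golden * (golden * z) = golden * z + z" for z
      using golden_sq by (simp add: mult.assoc[symmetric] distrib_right)
    consider "b = -1" "u = v" | "b = -2" "u = v"
      | "b = golden - 1" "u = v" "u = 1 \<or> u = sqrt 2"
      | "b = 1 - golden" "v = u * golden" | "b = 1 - golden" "u = v * golden"
      | "b = - golden" "v = u * golden" | "b = - golden" "u = v * golden"
      | "b = - golden" "u = v" "u = golden \<or> u = sqrt 2 * golden"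
      | "b = - sqrt 2" "v = u * sqrt 2" | "b = - sqrt 2" "u = v * sqrt 2"
      using negative_tau_cases[OF u(1) v(1) bs neg] by (elim disjE conjE) metis+
    then show ?thesis
    proof cases
      case 1
      then have "x + y = u *\<^sub>R (\<delta> - b *\<^sub>R \<beta>)" by (simp add: u v scaleR_add_right add.commute)
      then show ?thesis using \<Psi>I[OF u(1) r1] by simp
    next
      case 2
      have "\<beta> + \<delta> \<in> root_space" using u v \<Phi>g roots_root_space by (intro subspace_add[OF subspace_root_space]) auto
      moreover have "B (\<beta> + \<delta>) (\<beta> + \<delta>) = 0" using 2 nn b' by (simp add: B_simps b_def[symmetric])
      ultimately have "\<beta> + \<delta> = 0" using B_pos[of "\<beta> + \<delta>"] by force
      then show ?thesis using 2 by (simp add: u v scaleR_add_right[symmetric])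
    next
      case 3
      \<comment> \<open>The two roots enclose an angle of 72 degrees; their sum is the golden multiple of the root
        that bisects it, and this root is an iterated reflection of the given ones.\<close>
      let ?z = "(golden - 1) *\<^sub>R (\<beta> + \<delta>)"
      let ?r = "\<delta> - b *\<^sub>R \<beta>"
      have "B ?r \<delta> = 2 - b * b" using nn by (simp add: B_simps b_def)
      also have "\<dots> = golden" unfolding 3(1) using golden_sq by (simp add: algebra_simps)
      finally have "?r - golden *\<^sub>R \<delta> \<in> \<Phi>" using \<Phi>refl[OF v(2) r1] by simp
      then have "- (?r - golden *\<^sub>R \<delta>) \<in> \<Phi>" by (rule \<Phi>minus)
      also have "- (?r - golden *\<^sub>R \<delta>) = ?z" unfolding 3(1) by (simp add: algebra_simps)
      finally have z: "?z \<in> \<Phi>" .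
      have "golden *\<^sub>R ?z = \<beta> + \<delta>" by (simp add: golden_sq algebra_simps)
      then have "x + y = (u * golden) *\<^sub>R ?z" using 3 unfolding u v by (metis scaleR_add_right scaleR_scaleR)
      moreover have "u * golden \<in> units4" using 3 by (auto simp: units4_def)
      ultimately show ?thesis using \<Psi>I[OF _ z] by simp
    next
      case 4
      have "x + y = v *\<^sub>R (\<delta> - b *\<^sub>R \<beta>)" unfolding u(3) v(3) 4 by (simp add: algebra_simps gg gm)
      then show ?thesis using \<Psi>I[OF v(1) r1] by simp
    next
      case 5
      have "x + y = u *\<^sub>R (\<beta> - b *\<^sub>R \<delta>)" unfolding u(3) v(3) 5 by (simp add: algebra_simps gg gm)
      then show ?thesis using \<Psi>I[OF u(1) r2] by simp
    next
      case 6
      have "x + y = u *\<^sub>R (\<beta> - b *\<^sub>R \<delta>)" unfolding u(3) v(3) 6 by (simp add: algebra_simps gg gm)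
      then show ?thesis using \<Psi>I[OF u(1) r2] by simp
    next
      case 7
      have "x + y = v *\<^sub>R (\<delta> - b *\<^sub>R \<beta>)" unfolding u(3) v(3) 7 by (simp add: algebra_simps gg gm)
      then show ?thesis using \<Psi>I[OF v(1) r1] by simp
    next
      case 8
      let ?r = "\<delta> - b *\<^sub>R \<beta>"
      have "B ?r \<delta> = 2 - b * b" using nn by (simp add: B_simps b_def)
      also have "\<dots> = 1 - golden" using 8 golden_sq by simp
      finally have "?r - (1 - golden) *\<^sub>R \<delta> \<in> \<Phi>" using \<Phi>refl[OF v(2) r1] by simp
      also have "?r - (1 - golden) *\<^sub>R \<delta> = golden *\<^sub>R (\<beta> + \<delta>)" unfolding 8(1) by (simp add: algebra_simps)
      finally have z: "golden *\<^sub>R (\<beta> + \<delta>) \<in> \<Phi>" .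
      have "x + y = u *\<^sub>R (\<beta> + \<delta>)" using 8 by (simp add: u v scaleR_add_right)
      also have "\<dots> \<in> \<Psi>" using 8(3)
      proof
        assume "u = golden"
        then show ?thesis using \<Psi>I[OF _ z, of 1] by (simp add: units4_def)
      next
        assume u2: "u = sqrt 2 * golden"
        have "sqrt 2 *\<^sub>R (golden *\<^sub>R (\<beta> + \<delta>)) \<in> \<Psi>" by (rule \<Psi>I[OF _ z]) (simp add: units4_def)
        then show ?thesis unfolding u2 scaleR_scaleR .
      qed
      finally show ?thesis by simp
    next
      case 9
      have "x + y = u *\<^sub>R (\<beta> - b *\<^sub>R \<delta>)" unfolding u(3) v(3) 9 by (simp add: algebra_simps gg gm)
      then show ?thesis using \<Psi>I[OF u(1) r2] by simp
    next
      case 10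
      have "x + y = v *\<^sub>R (\<delta> - b *\<^sub>R \<beta>)" unfolding u(3) v(3) 10 by (simp add: algebra_simps gg gm)
      then show ?thesis using \<Psi>I[OF v(1) r1] by simp
    qed
  qed
  have sorted: "sorted_wrt (\<lambda>x y. 0 \<le> tau (B x y)) xs"
  proof (rule ccontr)
    assume "\<not> ?thesis"
    then obtain as x bs y cs where e: "xs = as @ x # bs @ y # cs" "\<not> 0 \<le> tau (B x y)"
      using not_sorted_wrt by blast
    have "x + y \<in> \<Psi> \<or> x + y = 0" using merge xs(1) e by auto
    then show False
    proof
      assume "x + y \<in> \<Psi>"
      then show False using least[of "as @ (x + y) # bs @ cs"] xs e(1) by (auto simp: algebra_simps)
    next
      assume 0: "x + y = 0"
      have "sum_list (as @ bs @ cs) = sum_list xs"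
        using arg_cong[OF 0, of "\<lambda>z. z + sum_list as + sum_list bs + sum_list cs"] e(1) by (simp add: algebra_simps)
      then show False using least[of "as @ bs @ cs"] xs e(1) by auto
    qed
  qed
  have sq2: "2 \<le> tau (B x x)" if x: "x \<in> \<Psi>" for x
  proof -
    obtain u \<beta> where u: "u \<in> units4" "\<beta> \<in> \<Phi>" "x = u *\<^sub>R \<beta>" using x by (auto simp: \<Psi>_def)
    then have "B x x = u * u * 2" using \<Phi>g by (simp add: B_simps)
    then show ?thesis using tau_units4_sq[OF u(1)] by simp
  qed
  have tau0: "tau 0 = 0" using tau_bas[of 0 0 0 0] by (simp add: bas_def quad_def)
  have sums: "B (sum_list ys) (sum_list ys) \<in> ring4 \<and> 2 * int (length ys) \<le> tau (B (sum_list ys) (sum_list ys))"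
    if "set ys \<subseteq> \<Psi>" "sorted_wrt (\<lambda>x y. 0 \<le> tau (B x y)) ys" for ys
    using that
  proof (induction ys)
    case (Cons x ys)
    let ?s = "sum_list ys"
    have IH: "B ?s ?s \<in> ring4" "2 * int (length ys) \<le> tau (B ?s ?s)" using Cons by auto
    have xs: "B x (sum_list zs) \<in> ring4 \<and> 0 \<le> tau (B x (sum_list zs))" if "set zs \<subseteq> set ys" for zs
      using that
    proof (induction zs)
      case (Cons z zs)
      have z: "B x z \<in> ring4" "0 \<le> tau (B x z)" using Cons.prems \<open>set (x # ys) \<subseteq> \<Psi>\<close>
          \<open>sorted_wrt _ (x # ys)\<close> B\<Psi>[of x z] by auto
      then show ?case using Cons by (auto simp: B_simps tau_add)
    qed (simp add: tau0)
    have x: "x \<in> \<Psi>" using Cons.prems by simp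
    have e: "B (sum_list (x # ys)) (sum_list (x # ys)) = B x x + (B x ?s + (B x ?s + B ?s ?s))"
      by (simp add: B_simps B_sym[of ?s x])
    have q: "B x ?s \<in> ring4" "0 \<le> tau (B x ?s)" using xs[of ys] by auto
    have s1: "B x ?s + B ?s ?s \<in> ring4" using q(1) IH(1) by (rule ring4_add)
    have s2: "B x ?s + (B x ?s + B ?s ?s) \<in> ring4" using q(1) s1 by (rule ring4_add)
    have "tau (B x x + (B x ?s + (B x ?s + B ?s ?s))) = tau (B x x) + (tau (B x ?s) + (tau (B x ?s) + tau (B ?s ?s)))"
      by (simp only: tau_add[OF B\<Psi>[OF x x] s2] tau_add[OF q(1) s1] tau_add[OF q(1) IH(1)])
    then show ?case unfolding e using ring4_add[OF B\<Psi>[OF x x] s2] IH(2) q(2) sq2[OF x] by simp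
  qed (simp add: tau0)
  have "tau (2::real) = 2" using tau_bas[of 2 0 0 0] by (simp add: bas_def quad_def)
  then have "length xs \<le> 1" using sums[OF xs(1) sorted] xs(2) \<alpha>(1) small_roots_roots by simp
  moreover have "xs \<noteq> []" using xs(2) root_nz[OF small_roots_roots[OF \<alpha>(1)]] by auto
  ultimately obtain x where "xs = [x]" by (cases xs) auto
  then have "\<alpha> \<in> \<Psi>" using xs by simp
  then obtain u \<beta> where u: "\<beta> \<in> \<Phi>" "\<alpha> = u *\<^sub>R \<beta>" by (auto simp: \<Psi>_def)
  then have "reflection \<alpha> = reflection \<beta>" using \<alpha>(1) small_roots_roots \<Phi>g by (intro parallel_roots) auto
  then show ?thesis using u(1) by (simp add: \<Phi>_def)
qed

section \<open>Dihedral components with large labels\<close>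

text \<open>For rotations by different multiples of the same angle the lattices may coincide although the
  generated groups do not, so these components need an argument of their own: in a plane, the
  product of the two reflections already determines the subgroup that they generate.\<close>
lemma dihedral_factorisation:
  assumes b: "b1 \<in> roots" "b2 \<in> roots" and c: "c1 \<in> roots" "c2 \<in> roots"
    and eq: "reflection b1 \<otimes> reflection b2 = reflection c1 \<otimes> reflection c2"
    and b1: "b1 \<in> span {c1, c2}"
    and c1: "reflection c1 \<in> generate W {reflection b1, reflection b2}"
    and c2: "reflection c2 \<in> generate W {reflection b1, reflection b2}"
  shows "generate W {reflection b1, reflection b2} \<subseteq> generate W {reflection c1, reflection c2}"
proof -
  let ?a = "reflection b1" and ?b = "reflection b2" and ?H = "generate W {reflection c1, reflection c2}"
  let ?C = "generate W {?a \<otimes> ?b}"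
  have cW: "{reflection c1, reflection c2} \<subseteq> carrier W" using c by simp
  have sub: "subgroup ?H W" using cW by (rule generate_is_subgroup)
  have cH: "reflection c1 \<in> ?H" "reflection c2 \<in> ?H" by (auto intro: generate.incl)
  have pH: "?a \<otimes> ?b \<in> ?H" unfolding eq using cH by (intro subgroup.m_closed[OF sub])
  have CH: "?C \<subseteq> ?H" using pH by (intro generate_subgroup_incl sub) auto
  have a2: "?a \<otimes> ?a = \<one>" "?b \<otimes> ?b = \<one>" using b refl_sq by auto
  note nf = dihedral_normal_form[OF refl_closed[OF b(1)] a2(1) refl_closed[OF b(2)] a2(2) finW]
  have aH: "?a \<in> ?H"
  proof (rule ccontr)
    assume na: "?a \<notin> ?H"
    have orth: "B b1 d = 0" if d: "d \<in> roots" "reflection d \<in> ?H" "reflection d \<in> generate W {?a, ?b}" for d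
    proof -
      obtain z where z: "z \<in> ?C" "reflection d = z \<or> reflection d = z \<otimes> ?a" using nf(2)[OF d(3)] by blast
      have zH: "z \<in> ?H" using z CH by auto
      then have zW: "z \<in> carrier W" by (rule subgroup.mem_carrier[OF sub])
      have "reflection d \<noteq> z \<otimes> ?a"
      proof
        assume "reflection d = z \<otimes> ?a"
        then have "?a = inv z \<otimes> reflection d" using zW b by (simp add: inv_cancel)
        then show False using na subgroup.m_closed[OF sub subgroup.m_inv_closed[OF sub zH] d(2)] by simp
      qed
      then have "reflection d \<in> ?C" using z by auto
      then have "?a \<otimes> reflection d \<otimes> ?a = reflection d" using nf(1) refl_inv[OF d(1)] by simp
      then have "reflection (act ?a d) = reflection d" using b d refl_conj[of ?a d] refl_inv[OF b(1)] by simp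
      then have "act (reflection d) (act ?a d) = - act ?a d"
        using act_refl[of "act ?a d" "act ?a d"] act_roots[of ?a d] b d by (simp add: scaleR_2)
      then have 1: "act ?a d - B (act ?a d) d *\<^sub>R d = - act ?a d" using d(1) by (simp add: act_refl)
      have ad: "act ?a d = d - B d b1 *\<^sub>R b1" using b by (simp add: act_refl)
      define k where "k = B (act ?a d) d / 2"
      have "2 *\<^sub>R act ?a d = (2 * k) *\<^sub>R d" using 1 by (simp add: k_def scaleR_2 algebra_simps)
      then have "act ?a d = k *\<^sub>R d" by (metis scaleR_cancel_left scaleR_scaleR zero_neq_numeral)
      then have "B d b1 *\<^sub>R b1 = (1 - k) *\<^sub>R d" unfolding ad by (simp add: algebra_simps)
      then have s: "b1 = ((1 - k) / B d b1) *\<^sub>R d" if "B d b1 \<noteq> 0" using that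
        by (metis (no_types, lifting) divide_inverse_commute scaleR_one scaleR_scaleR left_inverse)
      show "B b1 d = 0"
      proof (rule ccontr)
        assume "B b1 d \<noteq> 0"
        then have "B d b1 \<noteq> 0" by (simp add: B_sym)
        then have "?a = reflection d" using parallel_roots[OF b(1) d(1)] s by blast
        then show False using na d(2) by simp
      qed
    qed
    have "B b1 b1 = 0" using orth[OF c(1) cH(1) c1] orth[OF c(2) cH(2) c2] by (intro span_orth[OF _ b1]) auto
    then show False using b(1) by simp
  qed
  have "?b = ?a \<otimes> (?a \<otimes> ?b)" using b a2 by (simp add: m_assoc[symmetric])
  then have "?b \<in> ?H" using subgroup.m_closed[OF sub aH pH] by simp
  then show ?thesis using aH by (intro generate_subgroup_incl sub) auto
qed

definition spans_roots :: "'a vect list \<Rightarrow> bool" where "spans_roots \<gamma>s \<longleftrightarrow> roots \<subseteq> span (set \<gamma>s)"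

text \<open>Every root lies in the plane or is orthogonal to it, so the restriction of a product of reflections
  to the plane is the product of the reflections with roots in the plane. An independent
  factorisation of w has exactly two such roots; if both belong to the prefix, the two dihedral
  factorisations of w on the plane are compared, and otherwise the span of the prefix meets the plane
  in at most a line, which then contains a root of the prefix.\<close>
lemma reflection_in_plane:
  assumes r: "r \<in> R" and s: "s \<in> R" and large: "6 \<le> m r s"
    and \<beta>: "red_roots \<beta>s" "spans_roots \<beta>s" "generate W (reflection ` set \<beta>s) = carrier W"
    and \<gamma>: "red_roots (\<gamma>s @ \<delta>s)" "spans_roots (\<gamma>s @ \<delta>s)" "rprod (\<gamma>s @ \<delta>s) = rprod \<beta>s"
    and \<alpha>: "\<alpha> \<in> roots" "\<alpha> \<in> span {sroot r, sroot s}" "\<alpha> \<in> span (set \<gamma>s)"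
  shows "reflection \<alpha> \<in> generate W (reflection ` set \<gamma>s)"
proof -
  let ?P = "span {sroot r, sroot s}"
  have rs: "r \<noteq> s" using large m_one[OF r s] by auto
  have PV: "?P \<subseteq> root_space" using r s sroot_root_space by (intro span_minimal subspace_root_space) auto
  have avP: "sroot r \<in> ?P" "sroot s \<in> ?P" by (auto intro: span_base)
  note orth_sroot = large_plane_orth[OF r s large] and actP = act_large_plane[OF r s large]
  define orth where "orth x \<longleftrightarrow> (\<forall>y\<in>?P. B x y = 0)" for x
  have root_cases: "\<delta> \<in> ?P \<or> orth \<delta>" if \<delta>: "\<delta> \<in> roots" for \<delta>
  proof -
    obtain g u where g: "g \<in> carrier W" "u \<in> R" "\<delta> = act g (sroot u)" using \<delta> by (rule rootsE)
    show ?thesis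
    proof (cases "u = r \<or> u = s")
      case True
      then show ?thesis using g actP avP by auto
    next
      case False
      have "B \<delta> y = 0" if "y \<in> ?P" for y
      proof -
        have "B (act (inv g) y) (sroot u) = 0" using orth_sroot[OF g(2) _ _ actP[OF inv_closed[OF g(1)] that]] False by simp
        then show ?thesis unfolding g(3) B_act_inv[OF g(1)] by (simp add: B_sym[of "sroot u"])
      qed
      then show ?thesis by (simp add: orth_def)
    qed
  qed
  define inP where "inP = filter (\<lambda>\<delta>. \<delta> \<in> ?P)"
  have inP_iff: "z \<in> set (inP zs) \<longleftrightarrow> z \<in> set zs \<and> z \<in> ?P" for z zs by (auto simp: inP_def)
  have inP_sub: "set (inP zs) \<subseteq> set zs" "set (inP zs) \<subseteq> ?P" for zs by (auto simp: inP_def)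
  have act_inP: "act (rprod zs) x = act (rprod (inP zs)) x" if "set zs \<subseteq> roots" "x \<in> ?P" for zs x
    using that(1)
  proof (induction zs)
    case (Cons z zs)
    have z: "z \<in> roots" "set zs \<subseteq> roots" "set (inP zs) \<subseteq> roots"
      using Cons.prems subset_trans[OF inP_sub(1)[of zs], of roots] by simp_all
    have xP: "act (rprod zs) x \<in> ?P" using z that(2) by (intro actP) auto
    have e: "act (rprod (z # zs)) x = act (reflection z) (act (rprod zs) x)" using z by (simp add: act_mult)
    show ?case
    proof (cases "z \<in> ?P")
      case True
      then show ?thesis using e Cons.IH z by (simp add: inP_def act_mult)
    next
      case False
      then have "B (act (rprod zs) x) z = 0" using root_cases[OF z(1)] xP by (auto simp: orth_def B_sym)
      then show ?thesis using e Cons.IH z False by (simp add: inP_def act_refl)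
    qed
  qed (simp add: inP_def)
  have act_orth: "act (rprod (inP zs)) x = x" if "set zs \<subseteq> roots" "orth x" for zs x
    using that by (intro rprod_fixes) (auto simp: orth_def inP_iff)
  have agree: "g = h" if "g \<in> carrier W" "h \<in> carrier W"
    "\<And>x. x \<in> ?P \<Longrightarrow> act g x = act h x" "\<And>x. orth x \<Longrightarrow> act g x = act h x" for g h
  proof (rule act_eqD[OF that(1,2)])
    fix v assume "v \<in> root_space"
    have "independent {sroot r, sroot s}" using r s by (intro independent_mono[OF independent_sroot]) auto
    then obtain p where p: "p \<in> ?P" "\<And>x. x \<in> {sroot r, sroot s} \<Longrightarrow> B p x = B v x"
      using dual_vector[of "{sroot r, sroot s}" "B v"] r s sroot_root_space by auto
    have "B (v - p) y = 0" if "y \<in> ?P" for y using p(2) by (intro span_orth[OF _ that]) (auto simp: B_simps)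
    then have "act g (v - p) = act h (v - p)" using that(4) by (auto simp: orth_def)
    then have "act g (p + (v - p)) = act h (p + (v - p))" using that(1,2) that(3)[OF p(1)] by (simp only: act_lin)
    then show "act g v = act h v" by simp
  qed
  have span_inP: "x \<in> span (set (inP zs))" if zs: "set zs \<subseteq> roots" and x: "x \<in> ?P" "x \<in> span (set zs)" for zs x
  proof -
    obtain c where c: "x = (\<Sum>z\<in>set zs. c z *\<^sub>R z)" using x(2) by (auto simp: span_finite)
    let ?p = "\<Sum>z\<in>set (inP zs). c z *\<^sub>R z" and ?q = "\<Sum>z\<in>set zs - set (inP zs). c z *\<^sub>R z"
    have xpq: "x = ?p + ?q" unfolding c using inP_sub(1)[of zs] by (simp add: sum.subset_diff add.commute)
    have pP: "?p \<in> ?P" using inP_sub(2)[of zs] by (intro span_sum span_scale) auto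
    have "?q = x - ?p" unfolding xpq by (rule add_diff_cancel_left'[symmetric])
    then have qP: "?q \<in> ?P" using span_diff[OF x(1) pP] by simp
    have "orth z" if "z \<in> set zs - set (inP zs)" for z
      using that zs root_cases[of z] by (auto simp: inP_def)
    then have "B ?q y = 0" if "y \<in> ?P" for y using that
      by (auto simp: B_sum_left B_simps orth_def intro!: sum.neutral)
    then have "B ?q ?q = 0" using qP by blast
    then have "?q = 0" using B_pos[of ?q] qP PV by force
    then have "x = ?p" using xpq by simp
    then show ?thesis by (simp add: span_sum span_scale span_base)
  qed
  have lin_indep_sroot: "lin_indep [sroot r, sroot s]"
  proof -
    have "sroot r \<noteq> sroot s" using rs by (auto simp: sroot_def fun_eq_iff)
    moreover have "independent {sroot r, sroot s}" using r s by (intro independent_mono[OF independent_sroot]) auto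
    ultimately show ?thesis by (simp add: lin_indep_def)
  qed
  have two: "length (inP zs) = 2" if "red_roots zs" "spans_roots zs" for zs
  proof (rule antisym)
    have zs: "distinct zs" "independent (set zs)" using that(1) by (auto simp: red_roots_def lin_indep_def)
    then have l: "lin_indep (inP zs)"
      using independent_mono[OF zs(2) inP_sub(1)] unfolding lin_indep_def by (simp add: inP_def)
    show "length (inP zs) \<le> 2"
      using lin_indep_length_le[OF l, of "[sroot r, sroot s]"] inP_sub(2)[of zs] card_length[of "[sroot r, sroot s]"] by simp
    have "sroot x \<in> span (set (inP zs))" if "x = r \<or> x = s" for x
      using that \<open>red_roots zs\<close> \<open>spans_roots zs\<close> avP sroot_roots r s by (intro span_inP) (auto simp: red_roots_def spans_roots_def)
    then have "length [sroot r, sroot s] \<le> card (set (inP zs))" by (intro lin_indep_length_le[OF lin_indep_sroot]) auto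
    then show "2 \<le> length (inP zs)" using card_length[of "inP zs"] by simp
  qed
  have \<beta>r: "set \<beta>s \<subseteq> roots" and \<gamma>r: "set (\<gamma>s @ \<delta>s) \<subseteq> roots" using \<beta>(1) \<gamma>(1) by (auto simp: red_roots_def)
  obtain b1 b2 where b: "inP \<beta>s = [b1, b2]"
    using two[OF \<beta>(1,2)] by (metis (no_types, opaque_lifting) One_nat_def Suc_1 length_0_conv length_Suc_conv)
  have app: "inP (\<gamma>s @ \<delta>s) = inP \<gamma>s @ inP \<delta>s" by (simp add: inP_def)
  have len: "length (inP \<gamma>s) + length (inP \<delta>s) = 2" using two[OF \<gamma>(1,2)] app by simp
  have \<alpha>s: "\<alpha> \<in> span (set (inP \<gamma>s))" using \<gamma>r \<alpha> by (intro span_inP) auto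
  consider "inP \<gamma>s = []" | c where "inP \<gamma>s = [c]" | c1 c2 where "inP \<gamma>s = [c1, c2]" "inP \<delta>s = []"
    using len by (cases "inP \<gamma>s" rule: remdups_adj.cases) auto
  then show ?thesis
  proof cases
    case 1
    then show ?thesis using \<alpha>s root_nz[OF \<alpha>(1)] by simp
  next
    case (2 c)
    then have c: "c \<in> set \<gamma>s" using inP_sub(1)[of \<gamma>s] by simp
    obtain k where "\<alpha> = k *\<^sub>R c" using \<alpha>s 2 by (auto simp: span_singleton)
    then have "reflection \<alpha> = reflection c" using \<alpha>(1) c \<gamma>r by (intro parallel_roots) auto
    then show ?thesis using c by (auto intro: generate.incl)
  next
    case (3 c1 c2)
    have br: "b1 \<in> roots" "b2 \<in> roots" "b1 \<in> set \<beta>s" "b2 \<in> set \<beta>s" "b1 \<in> ?P"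
      using inP_iff[of b1 \<beta>s] inP_iff[of b2 \<beta>s] b \<beta>r by auto
    have cr: "c1 \<in> roots" "c2 \<in> roots" "c1 \<in> set \<gamma>s" "c2 \<in> set \<gamma>s" "c1 \<in> ?P" "c2 \<in> ?P"
      using inP_iff[of c1 \<gamma>s] inP_iff[of c2 \<gamma>s] 3 \<gamma>r by auto
    have full: "inP (\<gamma>s @ \<delta>s) = [c1, c2]" using app 3 by simp
    have inPr: "set (inP \<beta>s) \<subseteq> roots" "set (inP (\<gamma>s @ \<delta>s)) \<subseteq> roots" using inP_sub \<beta>r \<gamma>r by blast+
    have "rprod (inP \<beta>s) = rprod (inP (\<gamma>s @ \<delta>s))"
    proof (rule agree)
      show "act (rprod (inP \<beta>s)) x = act (rprod (inP (\<gamma>s @ \<delta>s))) x" if "x \<in> ?P" for x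
        using act_inP[OF \<beta>r that] act_inP[OF \<gamma>r that] \<gamma>(3) by simp
      show "act (rprod (inP \<beta>s)) x = act (rprod (inP (\<gamma>s @ \<delta>s))) x" if "orth x" for x
        using act_orth[OF \<beta>r that] act_orth[OF \<gamma>r that] by simp
    qed (use inPr in auto)
    then have eq: "reflection b1 \<otimes> reflection b2 = reflection c1 \<otimes> reflection c2"
      unfolding b full using br cr by simp
    have gen: "reflection \<delta> \<in> generate W {reflection b1, reflection b2}" if \<delta>: "\<delta> \<in> roots" "\<delta> \<in> ?P" for \<delta>
    proof -
      have "reflection \<delta> \<in> generate W (reflection ` set \<beta>s)" unfolding \<beta>(3) using \<delta> by simp
      then obtain zs where zs: "set zs \<subseteq> set \<beta>s" "rprod zs = reflection \<delta>" using generate_rprod[OF \<beta>r] by blast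
      have zr: "set zs \<subseteq> roots" using zs \<beta>r by auto
      have zsP: "set (inP zs) \<subseteq> {b1, b2}"
        using zs(1) arg_cong[OF b, of set] by (auto simp: inP_def)
      have "reflection \<delta> = rprod (inP zs)"
      proof (rule agree)
        show "rprod (inP zs) \<in> carrier W" using zr inP_sub(1)[of zs] by (intro rprod_closed) auto
        show "act (reflection \<delta>) x = act (rprod (inP zs)) x" if "x \<in> ?P" for x
          using act_inP[OF zr that] zs(2) by simp
        show "act (reflection \<delta>) x = act (rprod (inP zs)) x" if "orth x" for x
          using act_orth[OF zr that] that \<delta> by (simp add: act_refl orth_def)
      qed (use \<delta> in simp)
      then show ?thesis using rprod_generate[OF zsP] by simp
    qed
    have "b1 \<in> span (set (inP (\<gamma>s @ \<delta>s)))"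
      using \<gamma>(2) br by (intro span_inP[OF \<gamma>r]) (auto simp: spans_roots_def)
    then have "b1 \<in> span {c1, c2}" unfolding full by simp
    then have "generate W {reflection b1, reflection b2} \<subseteq> generate W {reflection c1, reflection c2}"
      using br cr gen eq by (intro dihedral_factorisation) auto
    also have "\<dots> \<subseteq> generate W (reflection ` set \<gamma>s)" using cr by (intro mono_generate) auto
    finally show ?thesis using gen[OF \<alpha>(1,2)] by auto
  qed
qed

text \<open>The two kinds of components are treated separately: lattices for small labels, planes for large
  ones.\<close>
theorem prefix_contains_reflections:
  assumes \<beta>: "red_roots \<beta>s" "spans_roots \<beta>s" "generate W (reflection ` set \<beta>s) = carrier W"
    and \<gamma>: "red_roots (\<gamma>s @ \<delta>s)" "spans_roots (\<gamma>s @ \<delta>s)" "rprod (\<gamma>s @ \<delta>s) = rprod \<beta>s"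
    and \<alpha>: "\<alpha> \<in> roots" "\<alpha> \<in> span (set \<gamma>s)"
  shows "reflection \<alpha> \<in> generate W (reflection ` set \<gamma>s)"
proof (cases "\<alpha> \<in> small_roots")
  case True
  have "\<alpha> \<in> ring_span (set (\<gamma>s @ \<delta>s) \<inter> small_roots)" using factorisation_ring_span[OF \<beta>(1,3) \<gamma>(1,3) True] .
  then have "\<alpha> \<in> ring_span (set \<gamma>s \<inter> small_roots)" using ring_span_prefix[OF \<gamma>(1)] \<alpha>(2) by blast
  then show ?thesis using \<gamma>(1) True by (intro root_in_lattice) (auto simp: red_roots_def)
next
  case False
  then obtain g r where g: "g \<in> carrier W" "r \<in> R" "r \<notin> small_gens" "\<alpha> = act g (sroot r)"
    using \<alpha>(1) by (auto simp: roots_split large_roots_def)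
  then obtain s where s: "s \<in> R" "6 \<le> m r s" by (auto simp: small_gens_def not_less)
  have "act g (sroot r) \<in> span {sroot r, sroot s}"
    using g(1) by (intro act_large_plane[OF g(2) s]) (auto intro: span_base)
  then show ?thesis using reflection_in_plane[OF g(2) s \<beta> \<gamma> \<alpha>(1) _ \<alpha>(2)] g(4) by simp
qed

end

section \<open>The interval below a quasi-Coxeter element\<close>

context finite_coxeter
begin

text \<open>The orthogonal projection of v to the span of S differs from v by a vector orthogonal to S, hence
  to v, hence to itself.\<close>
lemma orth_span:
  assumes S: "finite S" "independent S" "S \<subseteq> root_space" and v: "v \<in> root_space"
    and orth: "\<And>d. d \<in> root_space \<Longrightarrow> (\<And>s. s \<in> S \<Longrightarrow> B d s = 0) \<Longrightarrow> B d v = 0"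
  shows "v \<in> span S"
proof -
  obtain p where p: "p \<in> span S" "\<And>s. s \<in> S \<Longrightarrow> B p s = B v s" using dual_vector[OF S, of "B v"] by blast
  have pV: "p \<in> root_space" using p(1) span_minimal[OF S(3) subspace_root_space] by auto
  have d: "v - p \<in> root_space" using v pV by (rule subspace_diff[OF subspace_root_space])
  have 0: "B (v - p) s = 0" if "s \<in> S" for s using p(2)[OF that] by (simp add: B_simps)
  have "B (v - p) v = 0" using d 0 by (rule orth)
  moreover have "B (v - p) p = 0" using 0 p(1) by (rule span_orth)
  ultimately have "B (v - p) (v - p) = 0" by (simp add: B_diff_right)
  then have "v - p = 0" using B_pos[OF d] by force
  then show ?thesis using p(1) by simp
qed

lemma red_roots_span:
  assumes "red_roots \<gamma>s" "v \<in> root_space"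
    and "\<And>d. d \<in> fixed {rprod \<gamma>s} \<Longrightarrow> B d v = 0"
  shows "v \<in> span (set \<gamma>s)"
proof (rule orth_span)
  have \<gamma>: "set \<gamma>s \<subseteq> roots" using assms(1) by (simp add: red_roots_def)
  then show "set \<gamma>s \<subseteq> root_space" using roots_root_space by auto
  show "B d v = 0" if "d \<in> root_space" "\<And>s. s \<in> set \<gamma>s \<Longrightarrow> B d s = 0" for d
    using rprod_fixes[OF \<gamma> that(2)] that(1) by (intro assms(3)) (simp add: fixed_def)
qed (use assms in \<open>auto simp: red_roots_def lin_indep_def\<close>)

lemma fixed_rprod:
  assumes "red_roots \<gamma>s" shows "fixed (generate W (reflection ` set \<gamma>s)) = fixed {rprod \<gamma>s}"
proof -
  have \<gamma>: "set \<gamma>s \<subseteq> roots" "lin_indep \<gamma>s" using assms by (auto simp: red_roots_def)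
  have "act h v = v" if v: "v \<in> fixed {rprod \<gamma>s}" and h: "h \<in> generate W (reflection ` set \<gamma>s)" for v h
  proof -
    have 0: "B v \<gamma> = 0" if "\<gamma> \<in> set \<gamma>s" for \<gamma> using rprod_fixed_orth[OF \<gamma> _ that, of v] v by (simp add: fixed_def)
    obtain zs where "set zs \<subseteq> set \<gamma>s" "rprod zs = h" using generate_rprod[OF \<gamma>(1) h] by blast
    then show ?thesis using rprod_fixes[of zs v] \<gamma>(1) 0 by auto
  qed
  moreover have "rprod \<gamma>s \<in> generate W (reflection ` set \<gamma>s)" by (rule rprod_generate) simp
  ultimately show ?thesis by (auto simp: fixed_def)
qed

text \<open>Uniqueness: every parabolic subgroup generated by a reduced factorisation is the fixator of the
  fixed space of the product.\<close>
lemma assoc_parabolic_eqI: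
  assumes "red_roots \<gamma>s" "parabolic_subgroup W R (generate W (reflection ` set \<gamma>s))"
  shows "assoc_parabolic W R (rprod \<gamma>s) = generate W (reflection ` set \<gamma>s)"
  unfolding assoc_parabolic_def
proof (rule the_equality)
  show "parabolic_subgroup W R (generate W (reflection ` set \<gamma>s)) \<and>
      (\<exists>ts. reduced_decomp W R (rprod \<gamma>s) ts \<and> generate W (reflection ` set \<gamma>s) = generate W (set ts))"
    using assms unfolding reduced_decomp_iff by (auto intro!: exI[of _ "map reflection \<gamma>s"])
  fix P
  assume P: "parabolic_subgroup W R P \<and> (\<exists>ts. reduced_decomp W R (rprod \<gamma>s) ts \<and> P = generate W (set ts))"
  then obtain \<delta>s where \<delta>: "red_roots \<delta>s" "rprod \<delta>s = rprod \<gamma>s" "P = generate W (reflection ` set \<delta>s)"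
    unfolding reduced_decomp_iff by auto
  have "P = fixator (fixed P)" using P parabolic_eq_fixator by blast
  also have "fixed P = fixed (generate W (reflection ` set \<gamma>s))"
    unfolding \<delta>(3) fixed_rprod[OF \<delta>(1)] fixed_rprod[OF assms(1)] \<delta>(2) ..
  also have "fixator \<dots> = generate W (reflection ` set \<gamma>s)" using parabolic_eq_fixator[OF assms(2)] by simp
  finally show "P = generate W (reflection ` set \<gamma>s)" .
qed

lemma red_roots_prefix: assumes "red_roots (\<gamma>s @ \<delta>s)" shows "red_roots \<gamma>s"
  using assms independent_mono[of "set (\<gamma>s @ \<delta>s)" "set \<gamma>s"] by (auto simp: red_roots_def lin_indep_def)

text \<open>A vector f with the inner products of v on the first part and 0 on the second satisfies both
  B(f, v) = B(v, v) and B(f, v) = 0.\<close>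
lemma lin_indep_append_disjoint:
  assumes "lin_indep (as @ bs)" "set (as @ bs) \<subseteq> root_space" "v \<in> span (set as)" "v \<in> span (set bs)" shows "v = 0"
proof -
  have disj: "set as \<inter> set bs = {}" using assms(1) by (auto simp: lin_indep_def)
  obtain f where f: "\<And>s. s \<in> set (as @ bs) \<Longrightarrow> B f s = (if s \<in> set as then B v s else 0)"
    using dual_vector[of "set (as @ bs)" "\<lambda>s. if s \<in> set as then B v s else 0"] assms(1,2) unfolding lin_indep_def by blast
  have "B f v = 0" using disj f by (intro span_orth[OF _ assms(4)]) auto
  moreover have "B (f - v) v = 0" using f by (intro span_orth[OF _ assms(3)]) (auto simp: B_simps)
  ultimately have "B v v = 0" by (simp add: B_simps)
  moreover have "v \<in> root_space" using assms(2) span_minimal[OF _ subspace_root_space, of "set as"] assms(3) by auto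
  ultimately show ?thesis using B_pos by force
qed

lemma lin_indep_appendI:
  assumes "lin_indep as" "lin_indep bs" "\<And>v. v \<in> span (set as) \<Longrightarrow> v \<in> span (set bs) \<Longrightarrow> v = 0"
  shows "lin_indep (as @ bs)"
  using assms
proof (induction as)
  case (Cons a as)
  have a: "a \<notin> span (set as)" "lin_indep as" using Cons.prems(1) by (auto simp: lin_indep_Cons)
  have mono: "span (set as) \<subseteq> span (set (a # as))" by (rule span_mono) auto
  have "lin_indep (as @ bs)" using Cons.IH[OF a(2) Cons.prems(2)] Cons.prems(3) mono by blast
  moreover have "a \<notin> span (set (as @ bs))"
  proof
    assume "a \<in> span (set (as @ bs))"
    then obtain p q where pq: "a = p + q" "p \<in> span (set as)" "q \<in> span (set bs)"
      by (auto simp: span_Un)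
    have "a - p \<in> span (set (a # as))" using pq(2) mono by (intro span_diff) (auto intro: span_base)
    then have "q \<in> span (set (a # as))" using pq(1) by simp
    then have "q = 0" using Cons.prems(3) pq(3) by blast
    then show False using pq a(1) by simp
  qed
  ultimately show ?case by (simp add: lin_indep_Cons)
qed simp

text \<open>If w = xu with adding reflection lengths then also w = (x u inv x) x, so (1 - w) a is the sum
  of (1 - x) a and a vector from a complementary subspace.\<close>
lemma moved_like_prefix:
  assumes "red_roots (\<xi>s @ \<eta>s)" "a - act (rprod (\<xi>s @ \<eta>s)) a \<in> span (set \<xi>s)"
  shows "act (rprod (\<xi>s @ \<eta>s)) a = act (rprod \<xi>s) a"
proof -
  let ?x = "rprod \<xi>s" and ?w = "rprod (\<xi>s @ \<eta>s)"
  have r: "set \<xi>s \<subseteq> roots" "set \<eta>s \<subseteq> roots" using assms(1) by (auto simp: red_roots_def)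
  have x: "?x \<in> carrier W" using r by simp
  define \<kappa>s where "\<kappa>s = map (act ?x) \<eta>s"
  have \<kappa>: "set \<kappa>s \<subseteq> roots" using r x by (auto simp: \<kappa>s_def act_roots)
  have "rprod (map (act ?x) zs) = ?x \<otimes> rprod zs \<otimes> inv ?x" if "set zs \<subseteq> roots" for zs
    using that
  proof (induction zs)
    case (Cons z zs)
    then have "rprod (map (act ?x) (z # zs)) = (?x \<otimes> reflection z \<otimes> inv ?x) \<otimes> (?x \<otimes> rprod zs \<otimes> inv ?x)"
      using x by (simp add: refl_conj)
    also have "\<dots> = ?x \<otimes> rprod (z # zs) \<otimes> inv ?x" using Cons.prems x by (simp add: m_assoc inv_cancel)
    finally show ?case .
  qed (use x in simp)
  then have k: "rprod \<kappa>s = ?x \<otimes> rprod \<eta>s \<otimes> inv ?x" using r by (simp add: \<kappa>s_def)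
  have kx: "rprod (\<kappa>s @ \<xi>s) = ?w" using r \<kappa> x by (simp add: rprod_append k m_assoc)
  have "rlen (rprod (\<kappa>s @ \<xi>s)) = length (\<kappa>s @ \<xi>s)"
    unfolding kx using carter[of "\<xi>s @ \<eta>s"] assms(1) by (simp add: red_roots_def \<kappa>s_def)
  then have l: "lin_indep (\<kappa>s @ \<xi>s)" using carter[of "\<kappa>s @ \<xi>s"] r \<kappa> by simp
  let ?b = "act ?x a"
  have wa: "act ?w a = act (rprod \<kappa>s) ?b" using r \<kappa> x by (simp add: kx[symmetric] rprod_append act_mult)
  have 1: "?b - act (rprod \<kappa>s) ?b \<in> span (set \<kappa>s)" using \<kappa> by (rule rprod_moves)
  have "(a - act ?w a) - (a - ?b) \<in> span (set \<xi>s)" using assms(2) rprod_moves[OF r(1)] by (rule span_diff)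
  then have 2: "?b - act (rprod \<kappa>s) ?b \<in> span (set \<xi>s)" unfolding wa by simp
  have "?b - act (rprod \<kappa>s) ?b = 0"
    using 1 2 roots_root_space r \<kappa> by (intro lin_indep_append_disjoint[OF l]) auto
  then show ?thesis unfolding wa by simp
qed

text \<open>Brady and Watt. Put z = inv x y. The roots of a reduced factorisation of z lie in the image of
  1 - y, as do those of x. A vector v in both spans can be written as (1 - w) a; then x, y and w agree
  on a, so z fixes a and a is orthogonal to v. But 2 B(a, v) = B(v, v) because w is orthogonal, and so
  v = 0. Hence the two sets of roots are independent together, and the reflection lengths of x and z
  add up to at most that of y.\<close>
theorem fixed_subset_imp_le:
  assumes x: "red_roots (\<xi>s @ \<xi>s')" "rprod (\<xi>s @ \<xi>s') = w" and y: "red_roots (\<upsilon>s @ \<upsilon>s')" "rprod (\<upsilon>s @ \<upsilon>s') = w"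
    and fixed: "fixed {rprod \<upsilon>s} \<subseteq> fixed {rprod \<xi>s}"
  shows "abs_le W R (rprod \<xi>s) (rprod \<upsilon>s)"
proof -
  have \<xi>: "red_roots \<xi>s" and \<upsilon>: "red_roots \<upsilon>s"
    using x(1) y(1) red_roots_prefix by blast+
  have r: "set \<xi>s \<subseteq> roots" "set \<upsilon>s \<subseteq> roots" "set (\<xi>s @ \<xi>s') \<subseteq> roots" "lin_indep (\<xi>s @ \<xi>s')"
    using \<xi> \<upsilon> x(1) by (auto simp: red_roots_def)
  have c: "rprod \<xi>s \<in> carrier W" "rprod \<upsilon>s \<in> carrier W" using r by auto
  let ?z = "inv (rprod \<xi>s) \<otimes> rprod \<upsilon>s"
  obtain \<delta>s where \<delta>: "red_roots \<delta>s" "rprod \<delta>s = ?z" "length \<delta>s = rlen ?z" using ex_red_roots[of ?z] c by auto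
  have \<delta>r: "set \<delta>s \<subseteq> roots" "lin_indep \<delta>s" using \<delta>(1) by (auto simp: red_roots_def)
  have sub: "set \<xi>s \<subseteq> span (set \<upsilon>s)"
  proof
    fix \<gamma> assume \<gamma>: "\<gamma> \<in> set \<xi>s"
    show "\<gamma> \<in> span (set \<upsilon>s)"
    proof (rule red_roots_span[OF \<upsilon>])
      show "\<gamma> \<in> root_space" using \<gamma> r roots_root_space by auto
      show "B d \<gamma> = 0" if "d \<in> fixed {rprod \<upsilon>s}" for d
        using that fixed \<xi> \<gamma> by (intro rprod_fixed_orth[of \<xi>s]) (auto simp: red_roots_def fixed_def)
    qed
  qed
  have sub': "set \<delta>s \<subseteq> span (set \<upsilon>s)"
  proof
    fix \<gamma> assume \<gamma>: "\<gamma> \<in> set \<delta>s"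
    show "\<gamma> \<in> span (set \<upsilon>s)"
    proof (rule red_roots_span[OF \<upsilon>])
      show "\<gamma> \<in> root_space" using \<gamma> \<delta>r roots_root_space by auto
      fix d assume d: "d \<in> fixed {rprod \<upsilon>s}"
      then have "act (rprod \<upsilon>s) d = d" "act (rprod \<xi>s) d = d" using fixed by (auto simp: fixed_def)
      then have "act ?z d = d" using c act_inv(1)[of "rprod \<xi>s" d] by (simp add: act_mult)
      then show "B d \<gamma> = 0" using \<gamma> \<delta> \<delta>r by (intro rprod_fixed_orth[of \<delta>s]) auto
    qed
  qed
  have "v = 0" if v: "v \<in> span (set \<xi>s)" "v \<in> span (set \<delta>s)" for v
  proof -
    have "span (set \<xi>s) \<subseteq> span (set (\<xi>s @ \<xi>s'))" by (rule span_mono) auto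
    then have "v \<in> span (set (\<xi>s @ \<xi>s'))" using v(1) by auto
    then obtain a where a: "a \<in> root_space" "a - act w a = v"
      using rprod_moves_onto[OF r(3,4)] x(2) by auto
    have "span (set \<xi>s) \<subseteq> span (set \<upsilon>s)" using sub by (rule span_minimal) (rule subspace_span)
    then have v': "v \<in> span (set \<upsilon>s)" using v(1) by auto
    have "act w a = act (rprod \<xi>s) a" using moved_like_prefix[OF x(1)] a(2) v(1) x(2) by simp
    moreover have "act w a = act (rprod \<upsilon>s) a" using moved_like_prefix[OF y(1)] a(2) v' y(2) by simp
    ultimately have "act ?z a = a" using c act_inv(1)[of "rprod \<xi>s" a] by (simp add: act_mult)
    then have "B a \<gamma> = 0" if "\<gamma> \<in> set \<delta>s" for \<gamma> using \<delta> \<delta>r that by (intro rprod_fixed_orth[of \<delta>s]) auto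
    then have 0: "B a v = 0" using v(2) by (rule span_orth)
    have w: "w \<in> carrier W" using x(2) r(3) by auto
    have wa: "act w a = a - v" unfolding a(2)[symmetric] by simp
    have "B a a = B (a - v) (a - v)" using B_act[OF w, of a a] wa by simp
    then have "B v v = 0" using 0 by (simp add: B_simps B_sym[of v a])
    moreover have "v \<in> root_space" using v(1) span_minimal[OF _ subspace_root_space, of "set \<xi>s"] r(1) roots_root_space by auto
    ultimately show "v = 0" using B_pos by force
  qed
  then have "lin_indep (\<xi>s @ \<delta>s)" using \<xi> \<delta>r by (intro lin_indep_appendI) (auto simp: red_roots_def)
  then have "length (\<xi>s @ \<delta>s) \<le> card (set \<upsilon>s)" using sub sub' by (intro lin_indep_length_le) auto
  also have "\<dots> \<le> length \<upsilon>s" by (rule card_length)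
  finally have "length \<xi>s + length \<delta>s \<le> length \<upsilon>s" by simp
  moreover have "length \<xi>s = rlen (rprod \<xi>s)" "length \<upsilon>s = rlen (rprod \<upsilon>s)"
    using \<xi> \<upsilon> rlen_lin_indep by (auto simp: red_roots_def)
  moreover have "rlen (rprod \<upsilon>s) \<le> rlen (rprod \<xi>s) + rlen ?z"
    using rlen_mult[of "rprod \<xi>s" ?z] c by (simp add: inv_cancel)
  ultimately show ?thesis using \<delta>(3) by (simp add: abs_le_def)
qed

lemma red_roots_append_iff:
  assumes "red_roots \<xi>s" "red_roots \<eta>s"
  shows "red_roots (\<xi>s @ \<eta>s) \<longleftrightarrow> rlen (rprod \<xi>s \<otimes> rprod \<eta>s) = rlen (rprod \<xi>s) + rlen (rprod \<eta>s)"
  using assms carter[of "\<xi>s @ \<eta>s"] rlen_lin_indep[of \<xi>s] rlen_lin_indep[of \<eta>s]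
  by (auto simp: red_roots_def rprod_append)

lemma abs_le_extend:
  assumes "red_roots \<xi>s" "y \<in> carrier W" "abs_le W R (rprod \<xi>s) y"
  shows "\<exists>\<eta>s. red_roots (\<xi>s @ \<eta>s) \<and> rprod (\<xi>s @ \<eta>s) = y"
proof -
  have x: "rprod \<xi>s \<in> carrier W" "set \<xi>s \<subseteq> roots" using assms(1) by (auto simp: red_roots_def)
  obtain \<eta>s where \<eta>: "red_roots \<eta>s" "rprod \<eta>s = inv (rprod \<xi>s) \<otimes> y" using ex_red_roots[of "inv (rprod \<xi>s) \<otimes> y"] x assms(2) by auto
  then have e: "rprod \<xi>s \<otimes> rprod \<eta>s = y" using x assms(2) by (simp add: inv_cancel)
  have "red_roots (\<xi>s @ \<eta>s)" using assms \<eta> e by (simp add: red_roots_append_iff abs_le_def)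
  then show ?thesis using e x \<eta>(1) by (auto simp: rprod_append red_roots_def)
qed

context
  fixes w :: 'a and \<beta>s :: "'a vect list"
  assumes \<beta>: "red_roots \<beta>s" "rprod \<beta>s = w" "generate W (reflection ` set \<beta>s) = carrier W"
begin

lemma w_closed: "w \<in> carrier W" using \<beta> by (auto simp: red_roots_def)

text \<open>A vector orthogonal to the roots of a generating factorisation is fixed by the whole group, hence
  orthogonal to all roots; and all reduced factorisations of w have the same span.\<close>
lemma quasi_coxeter_spans: assumes "red_roots \<gamma>s" "rprod \<gamma>s = w" shows "spans_roots \<gamma>s"
proof -
  have "\<alpha> \<in> span (set \<beta>s)" if \<alpha>: "\<alpha> \<in> roots" for \<alpha>
  proof (rule red_roots_span[OF \<beta>(1) roots_root_space[OF \<alpha>]])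
    fix d assume "d \<in> fixed {rprod \<beta>s}"
    then have "d \<in> fixed (carrier W)" using fixed_rprod[OF \<beta>(1)] \<beta>(3) by simp
    then have "act (reflection \<alpha>) d = d" using \<alpha> by (simp add: fixed_def)
    then show "B d \<alpha> = 0" using \<alpha> root_nz[OF \<alpha>] by (simp add: act_refl)
  qed
  then show ?thesis using red_roots_span_eq[OF assms(1) \<beta>(1)] assms(2) \<beta>(2) by (auto simp: spans_roots_def)
qed

text \<open>The fixator of the fixed space of a prefix is parabolic, hence generated by reflections. The roots of
  these reflections are orthogonal to the fixed space, that is, they lie in the span of the prefix,
  and so the reflections belong to the subgroup generated by the prefix.\<close>
theorem prefix_parabolic:
  assumes "red_roots (\<gamma>s @ \<delta>s)" "rprod (\<gamma>s @ \<delta>s) = w"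
  shows "parabolic_subgroup W R (generate W (reflection ` set \<gamma>s))"
proof -
  let ?H = "generate W (reflection ` set \<gamma>s)" and ?F = "fixator (fixed {rprod \<gamma>s})"
  have \<gamma>: "red_roots \<gamma>s" using assms(1) by (rule red_roots_prefix)
  then have \<gamma>r: "set \<gamma>s \<subseteq> roots" by (simp add: red_roots_def)
  have sub: "subgroup ?H W" using \<gamma>r by (intro generate_is_subgroup) auto
  have par: "parabolic_subgroup W R ?F" using \<gamma>r by (intro fixator_parabolic subspace_fixed) auto
  have "?H \<subseteq> ?F"
  proof
    fix h assume h: "h \<in> ?H"
    then have "h \<in> carrier W" by (rule subgroup.mem_carrier[OF sub])
    then show "h \<in> ?F" using h fixed_rprod[OF \<gamma>] by (auto simp: fixator_def fixed_def)
  qed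
  moreover have "?F \<subseteq> ?H"
  proof -
    obtain I g where I: "I \<subseteq> R" and g: "g \<in> carrier W"
      and F: "?F = (\<lambda>h. inv g \<otimes> h \<otimes> g) ` generate W I" using par by (auto simp: parabolic_subgroup_def)
    have refl_in: "inv g \<otimes> r \<otimes> g \<in> ?H" if r: "r \<in> I" for r
    proof -
      have rR: "r \<in> R" using r I by auto
      define \<alpha> where "\<alpha> = act (inv g) (sroot r)"
      have \<alpha>: "\<alpha> \<in> roots" unfolding \<alpha>_def using g rR by (intro act_roots sroot_roots) auto
      have t: "reflection \<alpha> = inv g \<otimes> r \<otimes> g" unfolding \<alpha>_def using g rR by (simp add: refl_conj sroot_roots refl_sroot)
      have "reflection \<alpha> \<in> ?F" unfolding F t using r by (auto intro: generate.incl)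
      then have "B d \<alpha> = 0" if "d \<in> fixed {rprod \<gamma>s}" for d
        using that \<alpha> root_nz[OF \<alpha>] by (auto simp: fixator_def act_refl)
      then have "\<alpha> \<in> span (set \<gamma>s)" using red_roots_span[OF \<gamma> roots_root_space[OF \<alpha>]] by blast
      then have "reflection \<alpha> \<in> ?H"
        using prefix_contains_reflections[OF \<beta>(1) _ \<beta>(3) assms(1) _ _ \<alpha>] quasi_coxeter_spans \<beta> assms by auto
      then show ?thesis using t by simp
    qed
    have "inv g \<otimes> h \<otimes> g \<in> ?H" if h: "h \<in> generate W I" for h
      using h
    proof induction
      case one
      then show ?case using g by (simp add: generate.one)
    next
      case (incl r)
      then show ?case by (rule refl_in)
    next
      case (inv r)
      then show ?case using refl_in[OF inv] I R_inv by auto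
    next
      case (eng h1 h2)
      have h: "h1 \<in> carrier W" "h2 \<in> carrier W" using eng.hyps generate_in_carrier[of I] I R_carrier by auto
      have "inv g \<otimes> (h1 \<otimes> h2) \<otimes> g = (inv g \<otimes> h1 \<otimes> g) \<otimes> (inv g \<otimes> h2 \<otimes> g)"
        using g h by (simp add: m_assoc inv_cancel)
      then show ?case using subgroup.m_closed[OF sub eng.IH] by simp
    qed
    then show ?thesis unfolding F by auto
  qed
  ultimately have "?H = ?F" by blast
  then show ?thesis using par by simp
qed

lemma interval_decomposition:
  assumes "x \<in> abs_interval W R w"
  obtains \<xi>s \<eta>s where "red_roots \<xi>s" "rprod \<xi>s = x" "red_roots (\<xi>s @ \<eta>s)" "rprod (\<xi>s @ \<eta>s) = w"
    "assoc_parabolic W R x = generate W (reflection ` set \<xi>s)"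
    "parabolic_subgroup W R (assoc_parabolic W R x)"
proof -
  have x: "x \<in> carrier W" "abs_le W R x w" using assms by (auto simp: abs_interval_def)
  obtain \<xi>s where \<xi>: "red_roots \<xi>s" "rprod \<xi>s = x" using ex_red_roots[OF x(1)] by blast
  obtain \<eta>s where \<eta>: "red_roots (\<xi>s @ \<eta>s)" "rprod (\<xi>s @ \<eta>s) = w" using abs_le_extend[OF \<xi>(1) w_closed] \<xi>(2) x(2) by auto
  have "parabolic_subgroup W R (generate W (reflection ` set \<xi>s))" using prefix_parabolic[OF \<eta>] .
  then show ?thesis using that[OF \<xi> \<eta>] assoc_parabolic_eqI[OF \<xi>(1)] \<xi>(2) by simp
qed

text \<open>If x lies below y, a reduced factorisation of w can be chosen that starts with one of y, which in
  turn starts with one of x.\<close>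
theorem abs_le_iff_parabolic:
  assumes x: "x \<in> abs_interval W R w" and y: "y \<in> abs_interval W R w"
  shows "abs_le W R x y \<longleftrightarrow> assoc_parabolic W R x \<subseteq> assoc_parabolic W R y"
proof
  assume le: "abs_le W R x y"
  obtain \<xi>s \<eta>s where \<xi>: "red_roots \<xi>s" "rprod \<xi>s = x" "assoc_parabolic W R x = generate W (reflection ` set \<xi>s)"
    using interval_decomposition[OF x] by metis
  have yW: "y \<in> carrier W" "abs_le W R y w" using y by (auto simp: abs_interval_def)
  obtain \<zeta>s where \<zeta>: "red_roots (\<xi>s @ \<zeta>s)" "rprod (\<xi>s @ \<zeta>s) = y" using abs_le_extend[OF \<xi>(1) yW(1)] \<xi>(2) le by auto
  obtain \<kappa>s where \<kappa>: "red_roots ((\<xi>s @ \<zeta>s) @ \<kappa>s)" "rprod ((\<xi>s @ \<zeta>s) @ \<kappa>s) = w"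
    using abs_le_extend[OF \<zeta>(1) w_closed] \<zeta>(2) yW(2) by auto
  have "assoc_parabolic W R y = generate W (reflection ` set (\<xi>s @ \<zeta>s))"
    using assoc_parabolic_eqI[OF \<zeta>(1) prefix_parabolic[OF \<kappa>]] \<zeta>(2) by simp
  then show "assoc_parabolic W R x \<subseteq> assoc_parabolic W R y"
    unfolding \<xi>(3) using mono_generate[of "reflection ` set \<xi>s" "reflection ` set (\<xi>s @ \<zeta>s)"]
    by (simp add: image_mono)
next
  assume sub: "assoc_parabolic W R x \<subseteq> assoc_parabolic W R y"
  obtain \<xi>s \<xi>s' where \<xi>: "red_roots \<xi>s" "rprod \<xi>s = x" "red_roots (\<xi>s @ \<xi>s')" "rprod (\<xi>s @ \<xi>s') = w"
    "assoc_parabolic W R x = generate W (reflection ` set \<xi>s)"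
    using interval_decomposition[OF x] by metis
  obtain \<upsilon>s \<upsilon>s' where \<upsilon>: "red_roots \<upsilon>s" "rprod \<upsilon>s = y" "red_roots (\<upsilon>s @ \<upsilon>s')" "rprod (\<upsilon>s @ \<upsilon>s') = w"
    "assoc_parabolic W R y = generate W (reflection ` set \<upsilon>s)"
    using interval_decomposition[OF y] by metis
  have "fixed (assoc_parabolic W R y) \<subseteq> fixed (assoc_parabolic W R x)" using sub by (auto simp: fixed_def)
  then have "fixed {rprod \<upsilon>s} \<subseteq> fixed {rprod \<xi>s}" unfolding \<xi>(5) \<upsilon>(5) fixed_rprod[OF \<xi>(1)] fixed_rprod[OF \<upsilon>(1)] .
  then show "abs_le W R x y" using fixed_subset_imp_le[OF \<xi>(3,4) \<upsilon>(3,4)] \<xi>(2) \<upsilon>(2) by simp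
qed

lemma assoc_parabolic_subgroup:
  assumes "x \<in> abs_interval W R w" shows "subgroup (assoc_parabolic W R x) W"
proof -
  obtain \<xi>s where \<xi>: "red_roots \<xi>s" "assoc_parabolic W R x = generate W (reflection ` set \<xi>s)"
    using interval_decomposition[OF assms] by metis
  then show ?thesis by (auto simp: red_roots_def intro!: generate_is_subgroup)
qed

lemma subgroup_le_iff:
  assumes "subgroup H W" "subgroup K W" shows "subgroup_le W H K \<longleftrightarrow> H \<subseteq> K"
  unfolding subgroup_le_def using assms subgroup_incl subgroup.subset[of H "W\<lparr>carrier := K\<rparr>"] by auto

lemma abs_le_antisym:
  assumes "x \<in> carrier W" "y \<in> carrier W" "abs_le W R x y" "abs_le W R y x" shows "x = y"
proof -
  let ?z = "inv x \<otimes> y"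
  have "rlen ?z = 0" using assms(3,4) by (simp add: abs_le_def)
  then obtain \<gamma>s where "red_roots \<gamma>s" "rprod \<gamma>s = ?z" "length \<gamma>s = 0" using ex_red_roots[of ?z] assms by auto
  then have "?z = \<one>" by simp
  then show ?thesis using assms(1,2) by (metis inv_cancel(2) r_one)
qed

theorem interval_isomorphism:
  "poset_iso (abs_interval W R w) (abs_le W R)
     (assoc_parabolics W R w) (subgroup_le W) (assoc_parabolic W R)"
proof -
  let ?I = "abs_interval W R w" and ?p = "assoc_parabolic W R"
  have sub: "subgroup (?p x) W" if "x \<in> ?I" for x using assoc_parabolic_subgroup[OF that] .
  have le: "subgroup_le W (?p x) (?p y) \<longleftrightarrow> ?p x \<subseteq> ?p y" if "x \<in> ?I" "y \<in> ?I" for x y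
    using subgroup_le_iff sub that by blast
  have ord: "abs_le W R x y \<longleftrightarrow> ?p x \<subseteq> ?p y" if "x \<in> ?I" "y \<in> ?I" for x y
    using abs_le_iff_parabolic[OF that] .
  have anti: "x = y" if "x \<in> ?I" "y \<in> ?I" "abs_le W R x y" "abs_le W R y x" for x y
    using that abs_le_antisym by (simp add: abs_interval_def)
  have inj: "inj_on ?p ?I" using anti ord by (auto intro!: inj_onI)
  have "poset_on ?I (abs_le W R)"
    unfolding poset_on_def reflp_on_def antisymp_on_def transp_on_def using ord anti by (meson subset_refl subset_trans)
  moreover have "poset_on (assoc_parabolics W R w) (subgroup_le W)"
    unfolding poset_on_def reflp_on_def antisymp_on_def transp_on_def assoc_parabolics_def using le by auto
  moreover have "bij_betw ?p ?I (assoc_parabolics W R w)"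
    unfolding bij_betw_def assoc_parabolics_def using inj by simp
  ultimately show ?thesis unfolding poset_iso_def using ord le by blast
qed

end

end

theorem proposition2p10:
  fixes W :: "('a, 'b) monoid_scheme" and R :: "'a set" and w :: 'a
  assumes "coxeter_system W R"
    and "finite (carrier W)"
    and "quasi_coxeter W R w"
  shows "poset_iso (abs_interval W R w) (abs_le W R)
           (assoc_parabolics W R w) (subgroup_le W) (assoc_parabolic W R)"
proof -
  obtain m where m: "group W" "coxeter_matrix R m" "has_presentation W R (coxeter_relators R m)"
    using assms(1) by (auto simp: coxeter_system_def)
  interpret group W by (rule m(1))
  interpret finite_coxeter W R m by unfold_locales (use m assms(2) in auto)
  obtain ts where ts: "reduced_decomp W R w ts" "generate W (set ts) = carrier W"
    using assms(3) by (auto simp: quasi_coxeter_def)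
  then obtain \<beta>s where "red_roots \<beta>s" "rprod \<beta>s = w" "generate W (reflection ` set \<beta>s) = carrier W"
    unfolding reduced_decomp_iff by auto
  then show ?thesis by (rule interval_isomorphism)
qed

end
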